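(* Let $K$ be an irreducible symmetric cone, realised as the cone of squares of a simple Euclidean Jordan algebra $V$ of rank $r$ and Peirce invariant $d$, with identity $e$ and $\langle x,y\rangle=\operatorname{tr}(x\circ y)$. Let $X$ be an affine process on $K$ with parameters $(Q,b,B,c,\gamma,m,\mu)$ (as specified in the context). Then there exists $\alpha\in K$ such that $$Q(u,u)=4P(u)\alpha\qquad\text{for all }u\in V,$$ where $P$ is the quadratic representation of $V$, and where $\alpha=Q(e,e)/4$. Moreover, if $\dim V>2$, then the linear jump measure $\mu$ additionally satisfies $$\int_K(\|\xi\|\wedge1)\langle x,\mu(d\xi)\rangle<\infty\qquad\text{for all }x\in K.$$ Furthermore, the following drift condition holds: $$b\succeq d(r-1)\alpha .$$
   Context: Symmetric cones. A Euclidean Jordan algebra is a finite-dimensional real inner product space $(V,\langle\cdot,\cdot\rangle)$ with a bilinear product $\circ$ and identity $e$ such that $x\circ y=y\circ x$, $x^2\circ(x\circ y)=x\circ(x^2\circ y)$ (with $x^2=x\circ x$) and $\langle x\circ y,z\rangle=\langle y,x\circ z\rangle$; it is simple if it has no non-trivial ideal. A closed convex cone $K$ is symmetric if it is self-dual ($K^*:=\{u:\langle x,u\rangle\ge0\ \forall x\in K\}=K$) and $\{g\in GL(V):gK=K\}$ acts transitively on its interior; irreducible symmetric cones are exactly the cones $K=\{x^2:x\in V\}$ of simple Euclidean Jordan algebras. $u\preceq v$ means $v-u\in K$. The rank $r$ is the maximal degree of the minimal polynomial of an element; for elements attaining it the minimal polynomial is $\lambda^r-a_1(x)\lambda^{r-1}+\cdots+(-1)^ra_r(x)$,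 and $\operatorname{tr}(x):=a_1(x)$. $L(x)y=x\circ y$ and $P(x)=2L(x)^2-L(x^2)$. A Jordan frame is a family $p_1,\dots,p_r$ of mutually orthogonal primitive idempotents with sum $e$; the Peirce invariant is $d=\dim V_{ij}$ for $i<j$, $V_{ij}=\{x:p_i\circ x=p_j\circ x=\frac12x\}$ (independent of $i<j$ and of the frame; for $r=1$ read $d(r-1)=0$). Affine processes. A time-homogeneous Markov process on $K$ (augmented by a cemetery state $\Delta$, with $p_t(x,\{\Delta\})=1-p_t(x,K)$, $p_t(\Delta,\{\Delta\})=1$) with transition kernels $p_t(x,d\xi)$ is affine if $\lim_{s\to t}p_s(x,\cdot)=p_t(x,\cdot)$ weakly on $K$ for all $t\ge 0$, $x\in K$, and there are $\phi:\mathbb{R}_+\times K\to\mathbb{R}$, $\psi:\mathbb{R}_+\times K\to V$ with $\int_Ke^{-\langle u,\xi\rangle}p_t(x,d\xi)=e^{-\phi(t,u)-\langle\psi(t,u),x\rangle}$ for all $x\in K$, $(t,u)\in\mathbb{R}_+\times K$. Parameters. Fix a truncation function $\chi:V\to V$ (continuous, bounded in norm by $1$, identity near $0$). For every affine process on $K$ the derivatives $F(u)=\partial_t\phi(t,u)|_{t=0}$, $R(u)=\partial_t\psi(t,u)|_{t=0}$ exist and have the form $F(u)=\langle b,u\rangle+c-\int_K(e^{-\langle u,\xi\rangle}-1)m(d\xi)$, $R(u)=-\frac12Q(u,u)+B^\top(u)+\gamma-\int_K(e^{-\langle u,\xi\rangle}-1+\langle\chi(\xi),u\rangle)\mu(d\xi)$,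 where: $b\in K$; $c\ge0$; $m$ is a Borel measure on $K$ with $m(\{0\})=0$, $\int_K(\|\xi\|\wedge1)m(d\xi)<\infty$; $Q:V\times V\to V$ is symmetric bilinear with $Q(v,v)\in K$ for all $v\in V$, and $\langle x,Q(u,v)\rangle=0$ for all $v\in V$ whenever $u,x\in K$, $\langle u,x\rangle=0$; $\gamma\in K$; $\mu$ is a $K$-valued $\sigma$-finite Borel measure on $K$ (so $\langle x,\mu(d\xi)\rangle$ is a nonnegative measure for $x\in K$) with $\mu(\{0\})=0$, $\int_K(\|\xi\|^2\wedge1)\langle x,\mu(d\xi)\rangle<\infty$ for all $x\in K$, and $\int_K\langle\chi(\xi),u\rangle\langle x,\mu(d\xi)\rangle<\infty$ for all $u,x\in K$ with $\langle u,x\rangle=0$; $B^\top:V\to V$ is linear with $\langle x,B^\top(u)\rangle-\int_K\langle\chi(\xi),u\rangle\langle x,\mu(d\xi)\rangle\ge0$ for all $u,x\in K$ with $\langle u,x\rangle=0$. These are "the parameters" of $X$. *)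

theory Defs
  imports "HOL-Analysis.Analysis" "HOL-Probability.Probability"
    "HOL-Computational_Algebra.Polynomial"
begin

section \<open>Euclidean Jordan algebras\<close>

text \<open>The inner product of the algebra is the one of the type class.\<close>

locale euclidean_jordan_algebra =
  fixes J :: "'a::euclidean_space \<Rightarrow> 'a \<Rightarrow> 'a" and e :: 'a
  assumes bilinear: "bilinear J"
    and commute: "J x y = J y x"
    and jordan_identity: "J (J x x) (J x y) = J x (J (J x x) y)"
    and unit: "J e x = x"
    and inner_assoc: "J x y \<bullet> z = y \<bullet> J x z"

definition jordan_ideal :: "('a::euclidean_space \<Rightarrow> 'a \<Rightarrow> 'a) \<Rightarrow> 'a set \<Rightarrow> bool" where
  "jordan_ideal J I \<longleftrightarrow> subspace I \<and> (\<forall>x. \<forall>y\<in>I. J x y \<in> I)"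

locale simple_euclidean_jordan_algebra = euclidean_jordan_algebra +
  assumes simple: "jordan_ideal J I \<Longrightarrow> I = {0} \<or> I = UNIV"

definition cone_of_squares :: "('a \<Rightarrow> 'a \<Rightarrow> 'a) \<Rightarrow> 'a set" where
  "cone_of_squares J = {J x x | x. True}"

definition cone_le :: "'a::minus set \<Rightarrow> 'a \<Rightarrow> 'a \<Rightarrow> bool" where
  "cone_le K u v \<longleftrightarrow> v - u \<in> K"

definition quad_rep :: "('a::real_vector \<Rightarrow> 'a \<Rightarrow> 'a) \<Rightarrow> 'a \<Rightarrow> 'a \<Rightarrow> 'a" where
  "quad_rep J x y = 2 *\<^sub>R J x (J x y) - J (J x x) y"

fun jordan_power :: "('a \<Rightarrow> 'a \<Rightarrow> 'a) \<Rightarrow> 'a \<Rightarrow> 'a \<Rightarrow> nat \<Rightarrow> 'a" where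
  "jordan_power J e x 0 = e"
| "jordan_power J e x (Suc n) = J x (jordan_power J e x n)"

definition jordan_poly :: "('a::real_vector \<Rightarrow> 'a \<Rightarrow> 'a) \<Rightarrow> 'a \<Rightarrow> real poly \<Rightarrow> 'a \<Rightarrow> 'a" where
  "jordan_poly J e q x = (\<Sum>i\<le>degree q. coeff q i *\<^sub>R jordan_power J e x i)"

definition jordan_min_poly :: "('a::real_vector \<Rightarrow> 'a \<Rightarrow> 'a) \<Rightarrow> 'a \<Rightarrow> 'a \<Rightarrow> real poly" where
  "jordan_min_poly J e x =
    (THE q. lead_coeff q = 1 \<and> jordan_poly J e q x = 0 \<and>
      (\<forall>q'. q' \<noteq> 0 \<and> jordan_poly J e q' x = 0 \<longrightarrow> degree q \<le> degree q'))"

definition jordan_rank :: "('a::real_vector \<Rightarrow> 'a \<Rightarrow> 'a) \<Rightarrow> 'a \<Rightarrow> nat" where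
  "jordan_rank J e = Max (range (\<lambda>x. degree (jordan_min_poly J e x)))"

text \<open>
  The coefficient \<open>a\<^sub>1\<close> of the minimal polynomial is only given at the elements of
  maximal degree; as a homogeneous polynomial of degree one it extends to \<open>V\<close> as a linear
  functional, uniquely because these elements are dense.  A function \<open>tr\<close> satisfies the
  following predicate iff it is this extension.
\<close>

definition jordan_trace :: "('a::real_vector \<Rightarrow> 'a \<Rightarrow> 'a) \<Rightarrow> 'a \<Rightarrow> ('a \<Rightarrow> real) \<Rightarrow> bool" where
  "jordan_trace J e tr \<longleftrightarrow> linear tr \<and>
    (\<forall>x. degree (jordan_min_poly J e x) = jordan_rank J e \<longrightarrow>
       tr x = - coeff (jordan_min_poly J e x) (jordan_rank J e - 1))"

definition jordan_idempotent :: "('a \<Rightarrow> 'a \<Rightarrow> 'a) \<Rightarrow> 'a \<Rightarrow> bool" where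
  "jordan_idempotent J p \<longleftrightarrow> J p p = p"

definition primitive_idempotent :: "('a::real_vector \<Rightarrow> 'a \<Rightarrow> 'a) \<Rightarrow> 'a \<Rightarrow> bool" where
  "primitive_idempotent J p \<longleftrightarrow> jordan_idempotent J p \<and> p \<noteq> 0 \<and>
    \<not> (\<exists>p1 p2. jordan_idempotent J p1 \<and> jordan_idempotent J p2 \<and>
          p1 \<noteq> 0 \<and> p2 \<noteq> 0 \<and> p = p1 + p2)"

definition jordan_frame :: "('a::real_vector \<Rightarrow> 'a \<Rightarrow> 'a) \<Rightarrow> 'a \<Rightarrow> (nat \<Rightarrow> 'a) \<Rightarrow> bool" where
  "jordan_frame J e p \<longleftrightarrow>
    (\<forall>i<jordan_rank J e. primitive_idempotent J (p i)) \<and>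
    (\<forall>i<jordan_rank J e. \<forall>j<jordan_rank J e. i \<noteq> j \<longrightarrow> J (p i) (p j) = 0) \<and>
    (\<Sum>i<jordan_rank J e. p i) = e"

definition peirce_space ::
    "('a::real_vector \<Rightarrow> 'a \<Rightarrow> 'a) \<Rightarrow> (nat \<Rightarrow> 'a) \<Rightarrow> nat \<Rightarrow> nat \<Rightarrow> 'a set" where
  "peirce_space J p i j = {x. J (p i) x = (1/2) *\<^sub>R x \<and> J (p j) x = (1/2) *\<^sub>R x}"

text \<open>
  In rank one the condition is empty, so \<open>d\<close> is arbitrary; it only occurs in the product
  \<open>d * (r - 1)\<close>, which is then 0.
\<close>

definition peirce_invariant :: "('a::euclidean_space \<Rightarrow> 'a \<Rightarrow> 'a) \<Rightarrow> 'a \<Rightarrow> nat \<Rightarrow> bool" where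
  "peirce_invariant J e d \<longleftrightarrow>
    (\<forall>p i j. jordan_frame J e p \<and> i < j \<and> j < jordan_rank J e \<longrightarrow>
       dim (peirce_space J p i j) = d)"


section \<open>Affine processes\<close>

abbreviation borel_on :: "'a::topological_space set \<Rightarrow> 'a measure" where
  "borel_on K \<equiv> restrict_space borel K"

text \<open>
  A Markov process is represented by its transition semigroup.  The cemetery state is not
  added to the type: it is absorbing and carries the mass missing from \<open>p t x\<close>, so the
  kernels on the augmented space and the sub-Markov kernels on \<open>K\<close> determine each other.
\<close>

locale markov_semigroup =
  fixes K :: "'a::euclidean_space set" and p :: "real \<Rightarrow> 'a \<Rightarrow> 'a measure"
  assumes kernel: "t \<ge> 0 \<Longrightarrow> p t \<in> measurable (borel_on K) (subprob_algebra (borel_on K))"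
    and start: "x \<in> K \<Longrightarrow> p 0 x = return (borel_on K) x"
    and chapman_kolmogorov:
      "s \<ge> 0 \<Longrightarrow> t \<ge> 0 \<Longrightarrow> x \<in> K \<Longrightarrow> p (s + t) x = bind (p s x) (p t)"

text \<open>Only the values of \<open>\<phi>\<close> and \<open>\<psi>\<close> at \<open>t \<ge> 0\<close> and \<open>u \<in> K\<close> matter.\<close>

locale affine_process = markov_semigroup +
  fixes \<phi> :: "real \<Rightarrow> 'a::euclidean_space \<Rightarrow> real" and \<psi> :: "real \<Rightarrow> 'a \<Rightarrow> 'a"
  assumes stochastically_continuous:
      "t \<ge> 0 \<Longrightarrow> x \<in> K \<Longrightarrow> continuous_on K f \<Longrightarrow> bounded (f ` K) \<Longrightarrow>
        ((\<lambda>s. \<integral>\<xi>. (f \<xi> :: real) \<partial>(p s x)) \<longlongrightarrow> (\<integral>\<xi>. f \<xi> \<partial>(p t x))) (at t within {0..})"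
    and affine:
      "t \<ge> 0 \<Longrightarrow> u \<in> K \<Longrightarrow> x \<in> K \<Longrightarrow>
        (\<integral>\<xi>. exp (- (u \<bullet> \<xi>)) \<partial>(p t x)) = exp (- \<phi> t u - \<psi> t u \<bullet> x)"

definition truncation_function :: "('a::euclidean_space \<Rightarrow> 'a) \<Rightarrow> bool" where
  "truncation_function h \<longleftrightarrow> continuous_on UNIV h \<and> (\<forall>\<xi>. norm (h \<xi>) \<le> 1) \<and>
    (\<exists>\<delta>>0. \<forall>\<xi>. norm \<xi> < \<delta> \<longrightarrow> h \<xi> = \<xi>)"

text \<open>
  A \<open>\<sigma>\<close>-finite \<open>K\<close>-valued measure has values in \<open>K\<close> only on small sets.  It is represented by
  its scalar components: \<open>\<mu> x\<close> is the measure \<open>\<langle>x, \<mu>(d\<xi>)\<rangle>\<close>, for \<open>x \<in> K\<close>.  On the Borel subsets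
  \<open>A\<close> of each member of a countable cover of \<open>K\<close> the value \<open>v = \<mu>(A) \<in> K\<close> exists as a vector.
\<close>

definition cone_valued_measure ::
    "'a::euclidean_space set \<Rightarrow> ('a \<Rightarrow> 'a measure) \<Rightarrow> bool" where
  "cone_valued_measure K \<mu> \<longleftrightarrow>
    (\<forall>x\<in>K. sets (\<mu> x) = sets (borel_on K)) \<and>
    (\<exists>E :: nat \<Rightarrow> 'a set. range E \<subseteq> sets (borel_on K) \<and> (\<Union>n. E n) = K \<and>
      (\<forall>n. \<forall>A\<in>sets (borel_on K). A \<subseteq> E n \<longrightarrow>
        (\<exists>v\<in>K. \<forall>x\<in>K. emeasure (\<mu> x) A = ennreal (x \<bullet> v))))"

text \<open>The integral of a scalar function against a \<open>K\<close>-valued measure; \<open>K\<close> spans the space,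
  so the vector \<open>v\<close> is unique.\<close>

definition has_cone_integral ::
    "'a::euclidean_space set \<Rightarrow> ('a \<Rightarrow> 'a measure) \<Rightarrow> ('a \<Rightarrow> real) \<Rightarrow> 'a \<Rightarrow> bool" where
  "has_cone_integral K \<mu> f v \<longleftrightarrow>
    (\<forall>x\<in>K. integrable (\<mu> x) f \<and> x \<bullet> v = (\<integral>\<xi>. f \<xi> \<partial>(\<mu> x)))"

text \<open>\<open>h\<close> is the truncation function; \<open>adjoint B\<close> is \<open>B\<^sup>T\<close>.\<close>

locale admissible_parameters =
  fixes K :: "'a::euclidean_space set" and h :: "'a \<Rightarrow> 'a"
    and Q :: "'a \<Rightarrow> 'a \<Rightarrow> 'a" and b :: 'a and B :: "'a \<Rightarrow> 'a" and c :: real and \<gamma> :: 'a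
    and m :: "'a measure" and \<mu> :: "'a \<Rightarrow> 'a measure"
  assumes b: "b \<in> K"
    and c: "c \<ge> 0"
    and m_sets: "sets m = sets (borel_on K)"
    and m_zero: "emeasure m {0} = 0"
    and m_integrable: "(\<integral>\<^sup>+\<xi>. ennreal (min (norm \<xi>) 1) \<partial>m) < \<infinity>"
    and Q_bilinear: "bilinear Q"
    and Q_sym: "Q u v = Q v u"
    and Q_cone: "Q v v \<in> K"
    and Q_boundary: "u \<in> K \<Longrightarrow> x \<in> K \<Longrightarrow> u \<bullet> x = 0 \<Longrightarrow> x \<bullet> Q u v = 0"
    and \<gamma>: "\<gamma> \<in> K"
    and \<mu>_measure: "cone_valued_measure K \<mu>"
    and \<mu>_zero: "x \<in> K \<Longrightarrow> emeasure (\<mu> x) {0} = 0"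
    and \<mu>_integrable: "x \<in> K \<Longrightarrow> (\<integral>\<^sup>+\<xi>. ennreal (min ((norm \<xi>)\<^sup>2) 1) \<partial>(\<mu> x)) < \<infinity>"
    and \<mu>_boundary: "u \<in> K \<Longrightarrow> x \<in> K \<Longrightarrow> u \<bullet> x = 0 \<Longrightarrow> integrable (\<mu> x) (\<lambda>\<xi>. h \<xi> \<bullet> u)"
    and B_linear: "linear B"
    and B_boundary:
      "u \<in> K \<Longrightarrow> x \<in> K \<Longrightarrow> u \<bullet> x = 0 \<Longrightarrow> x \<bullet> adjoint B u - (\<integral>\<xi>. h \<xi> \<bullet> u \<partial>(\<mu> x)) \<ge> 0"

text \<open>The tuple is the parameters of the affine process with exponents \<open>\<phi>\<close> and \<open>\<psi>\<close>:
  the two derivatives are \<open>F(u)\<close> and \<open>R(u)\<close>.\<close>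

locale affine_parameters = admissible_parameters +
  fixes \<phi> :: "real \<Rightarrow> 'a::euclidean_space \<Rightarrow> real" and \<psi> :: "real \<Rightarrow> 'a \<Rightarrow> 'a"
  assumes F: "u \<in> K \<Longrightarrow>
      ((\<lambda>t. \<phi> t u) has_real_derivative
        (b \<bullet> u + c - (\<integral>\<xi>. exp (- (u \<bullet> \<xi>)) - 1 \<partial>m))) (at 0 within {0..})"
    and R: "u \<in> K \<Longrightarrow>
      \<exists>v. has_cone_integral K \<mu> (\<lambda>\<xi>. exp (- (u \<bullet> \<xi>)) - 1 + h \<xi> \<bullet> u) v \<and>
        ((\<lambda>t. \<psi> t u) has_vector_derivative
          (- (1/2) *\<^sub>R Q u u + adjoint B u + \<gamma> - v)) (at 0 within {0..})"

end

theory Submission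
  imports Defs
begin

text \<open>
  Everything is tested on idempotents, and the spectral theorem \<open>u = \<Sum> t g\<^sub>t\<close> (the \<open>g\<^sub>t\<close> orthogonal
  idempotents) carries the results to the whole algebra. It holds because the multiplications by
  the powers of \<open>u\<close> commute and are symmetric (\<open>spectral_theorem_peirce_one\<close>). It yields that the
  cone of squares is self-dual, that it is generated by the primitive idempotents
  (\<open>squares_induct\<close>), and that for the trace form all primitive idempotents have norm one.

  \<^bold>\<open>The diffusion.\<close> For an idempotent \<open>c\<close> the boundary condition confines \<open>Q(c,c)\<close> to the face of
  \<open>c\<close>, the Peirce space \<open>V\<^sub>1(c)\<close>, and shows that on this face \<open>Q(c,c)\<close> and \<open>Q(e,e)\<close> pair equally
  with every vector. Hence \<open>Q(c,c) = P(c) Q(e,e)\<close>. Both sides are quadratic in \<open>c\<close>; comparing them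
  at \<open>g\<^sub>s\<close>, \<open>g\<^sub>t\<close> and \<open>g\<^sub>s + g\<^sub>t\<close> gives \<open>Q(u,u) = P(u) Q(e,e)\<close> for all \<open>u\<close>
  (\<open>boundary_form_eq_quad_rep\<close>).

  \<^bold>\<open>The orbit of a primitive idempotent.\<close> For \<open>v\<close> in \<open>V\<^sub>h(p)\<close>, the Peirce space of the eigenvalue
  \<open>1/2\<close>, the vector \<open>p + v + a\<close>, where \<open>a\<close> is the part of \<open>v\<^sup>2\<close> in \<open>V\<^sub>0(p)\<close>, lies in the cone
  (\<open>orbit_in_squares\<close>). For symmetric matrices these are the matrices \<open>(1,s) (1,s)\<^sup>T\<close>. Pairing an
  element of the cone with these vectors gives the quadratic inequalities that replace the
  positivity of minors and of Schur complements.

  \<^bold>\<open>The jumps.\<close> If \<open>|v|\<^sup>2 = 2\<close>, then \<open>a\<close> is an idempotent, and \<open>(p, a)\<close> and \<open>(p + a + v, p + a - v)\<close>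
  are two orthogonal pairs in the cone, to which the boundary condition applies. For every \<open>\<xi>\<close> in
  the cone, \<open>\<langle>p + a, \<xi>\<rangle>\<close> is comparable with the pairings of \<open>\<xi>\<close> with both members of one of the
  two pairs. On the corresponding set of jumps the measures of both members integrate
  \<open>\<langle>p + a, \<xi>\<rangle> \<and> 1\<close>, and hence so does their sum (\<open>primitive_integrable\<close>).

  \<^bold>\<open>The drift.\<close> The kernels are positive measures on the cone, so a finite sum \<open>f\<close> of exponentials
  that is nonnegative on the cone and vanishes at \<open>x\<close> has a nonnegative generator at \<open>x\<close>. Products
  of such sums are again such sums. Adding a penalty of fourth order makes it sufficient that \<open>f\<close>
  is nonnegative near \<open>x\<close>, and multiplying by high powers of a function with a strict maximum at
  \<open>x\<close> removes the jump integrals; the first and second order terms at \<open>x\<close> do not change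
  (\<open>local_maximum_principle\<close>). This is applied at \<open>x = t (e - g)\<close>, \<open>g\<close> primitive, to a sum
  modelled on \<open>t \<langle>g, \<xi>\<rangle>\<close> minus half of the squared length of the component of \<open>\<xi>\<close> in \<open>V\<^sub>h(g)\<close>. The
  constant drift contributes \<open>t \<langle>b, g\<rangle>\<close> and the diffusion \<open>- t \<langle>\<alpha>, g\<rangle>\<close> for each dimension of this
  space, and there are \<open>d (r - 1)\<close> of them. The linear drift and the linear jumps contribute terms
  of order \<open>t\<^sup>2\<close>, so \<open>t \<rightarrow> 0\<close> leaves \<open>\<langle>b, g\<rangle> \<ge> d (r - 1) \<langle>\<alpha>, g\<rangle>\<close> (\<open>drift_estimate\<close>), and
  self-duality of the cone concludes.
\<close>

section \<open>Eigenspaces of symmetric operators\<close>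

text \<open>
  A maximiser of \<open>\<langle>T x, x\<rangle>\<close> on the unit sphere of \<open>S\<close> is an eigenvector.
\<close>

lemma symmetric_eigenvector:
  fixes T :: "'a::euclidean_space \<Rightarrow> 'a"
  assumes T: "linear T" and S: "subspace S" "S \<noteq> {0}" and inv: "\<And>x. x \<in> S \<Longrightarrow> T x \<in> S"
    and sym: "\<And>x y. T x \<bullet> y = x \<bullet> T y"
  shows "\<exists>v\<in>S. \<exists>t. v \<noteq> 0 \<and> T v = t *\<^sub>R v"
proof -
  let ?D = "S \<inter> sphere 0 1"
  obtain w where w: "w \<in> S" "w \<noteq> 0"
    using S subspace_0 by blast
  have "w /\<^sub>R norm w \<in> ?D"
    using w S(1) by (simp add: subspace_scale)
  moreover have "compact ?D"
    by (simp add: S(1) closed_subspace closed_Int_compact)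
  moreover have "continuous_on ?D (\<lambda>x. T x \<bullet> x)"
    using linear_continuous_on[OF linear_conv_bounded_linear[THEN iffD1, OF T]]
    by (intro continuous_intros)
  ultimately have "\<exists>v\<in>?D. \<forall>x\<in>?D. T x \<bullet> x \<le> T v \<bullet> v"
    by (intro continuous_attains_sup) blast+
  then obtain v where v: "v \<in> ?D" and mx: "\<And>x. x \<in> ?D \<Longrightarrow> T x \<bullet> x \<le> T v \<bullet> v"
    by blast
  define M where "M = T v \<bullet> v"
  have le: "T x \<bullet> x \<le> M * (x \<bullet> x)" if "x \<in> S" for x
  proof (cases "x = 0")
    case False
    have "x /\<^sub>R norm x \<in> ?D"
      using False that S(1) by (simp add: subspace_scale)
    from mx[OF this] have "(T x \<bullet> x) / (norm x)\<^sup>2 \<le> M"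
      by (simp add: linear_scale[OF T] M_def power2_eq_square divide_simps)
    thus ?thesis
      using False by (simp add: divide_simps dot_square_norm)
  qed (simp add: linear_0[OF T])
  have nv: "v \<bullet> v = 1"
    using v by (simp add: dot_square_norm)
  define z where "z = M *\<^sub>R v - T v"
  have z: "z \<in> S"
    using v inv S(1) unfolding z_def by (auto intro!: subspace_diff subspace_scale)
  have vz: "v \<bullet> z = 0"
    by (simp add: z_def inner_diff_right M_def nv inner_commute)
  \<comment> \<open>The form \<open>M |x|\<^sup>2 - \<langle>T x, x\<rangle>\<close> is nonnegative on \<open>S\<close> and vanishes at \<open>v\<close>, so its derivative at \<open>v\<close>
    in the direction \<open>- z\<close> vanishes.\<close>
  have "2 * s * (z \<bullet> z) \<le> s\<^sup>2 * (M * (z \<bullet> z) - T z \<bullet> z)" for s :: real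
  proof -
    have "v - s *\<^sub>R z \<in> S"
      using v z S(1) by (auto intro!: subspace_diff subspace_scale)
    from le[OF this]
    have "M - s * (T v \<bullet> z) - s * (T z \<bullet> v) + s\<^sup>2 * (T z \<bullet> z) \<le> M * (1 + s\<^sup>2 * (z \<bullet> z))"
      by (simp add: linear_diff[OF T] linear_scale[OF T] inner_diff_left inner_diff_right
          nv vz inner_commute[of z v] power2_eq_square M_def[symmetric] algebra_simps)
    moreover have "T v \<bullet> z = - (z \<bullet> z)"
    proof -
      have "z \<bullet> z = M * (v \<bullet> z) - T v \<bullet> z"
        by (subst (1) z_def) (simp only: inner_diff_left inner_scaleR_left)
      thus ?thesis by (simp add: vz)
    qed
    moreover have "T z \<bullet> v = T v \<bullet> z"
      using sym[of z v] by (simp only: inner_commute)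
    ultimately show ?thesis by (simp add: algebra_simps)
  qed
  note q = this
  have "z \<bullet> z = 0"
  proof (rule ccontr)
    assume "z \<bullet> z \<noteq> 0"
    hence pos: "z \<bullet> z > 0" by (simp add: order_less_le)
    define N where "N = \<bar>M * (z \<bullet> z) - T z \<bullet> z\<bar> + z \<bullet> z"
    have N: "N > 0" unfolding N_def using pos by linarith
    have "2 * (z \<bullet> z / N) * (z \<bullet> z) \<le> (z \<bullet> z / N)\<^sup>2 * (M * (z \<bullet> z) - T z \<bullet> z)" by (rule q)
    also have "\<dots> \<le> (z \<bullet> z / N)\<^sup>2 * N"
      unfolding N_def using pos by (intro mult_left_mono zero_le_power2) linarith
    also have "\<dots> = (z \<bullet> z / N) * (z \<bullet> z)" using N by (simp add: power2_eq_square)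
    finally have "2 * ((z \<bullet> z / N) * (z \<bullet> z)) \<le> (z \<bullet> z / N) * (z \<bullet> z)"
      by (simp only: mult.assoc)
    moreover have "0 < (z \<bullet> z / N) * (z \<bullet> z)"
      using pos N by (intro mult_pos_pos divide_pos_pos)
    ultimately show False by linarith
  qed
  hence "T v = M *\<^sub>R v" by (simp add: z_def)
  moreover have "v \<noteq> 0" using nv by auto
  ultimately show ?thesis using v by blast
qed

text \<open>
  Split off an eigenvector and continue in its orthogonal complement in \<open>S\<close>. Components with the
  same eigenvalue are collected, so that the eigenvalues can index the sum.
\<close>

lemma symmetric_eigenvector_sum:
  fixes T :: "'a::euclidean_space \<Rightarrow> 'a"
  assumes T: "linear T" and sym: "\<And>x y. T x \<bullet> y = x \<bullet> T y"
    and S: "subspace S" and inv: "\<And>x. x \<in> S \<Longrightarrow> T x \<in> S" and c: "c \<in> S"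
  shows "\<exists>\<Lambda> g. finite \<Lambda> \<and> c = (\<Sum>t\<in>\<Lambda>. g t) \<and> (\<forall>t\<in>\<Lambda>. g t \<in> S \<and> T (g t) = t *\<^sub>R g t)"
  using S inv c
proof (induction "dim S" arbitrary: S c rule: less_induct)
  case less
  show ?case
  proof (cases "S = {0}")
    case True
    thus ?thesis using less.prems by (intro exI[of _ "{}"]) auto
  next
    case False
    from symmetric_eigenvector[OF T less.prems(1) this less.prems(2) sym]
    obtain v t where v: "v \<in> S" "v \<noteq> 0" "T v = t *\<^sub>R v" by blast
    define S' where "S' = S \<inter> {x. v \<bullet> x = 0}"
    have S': "subspace S'"
      unfolding S'_def by (intro subspace_inter less.prems subspace_hyperplane)
    have "v \<notin> S'" using v by (simp add: S'_def)
    moreover have "S' \<subseteq> S" by (simp add: S'_def)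
    ultimately have "S' \<subset> S" using v(1) by blast
    hence "dim S' < dim S"
      by (metis S' dim_psubset less.prems(1) span_eq_iff)
    moreover have "T x \<in> S'" if "x \<in> S'" for x
      using that v less.prems(2) by (auto simp: S'_def sym[symmetric])
    moreover define k where "k = (v \<bullet> c) / (v \<bullet> v)"
    define c' where "c' = c - k *\<^sub>R v"
    have "c' \<in> S'"
      using v less.prems(1,3) by (auto simp: S'_def c'_def k_def inner_diff_right
          intro!: subspace_diff subspace_scale)
    ultimately obtain \<Lambda> g where g: "finite \<Lambda>" "c' = (\<Sum>t\<in>\<Lambda>. g t)"
      "\<And>t. t \<in> \<Lambda> \<Longrightarrow> g t \<in> S' \<and> T (g t) = t *\<^sub>R g t"
      using less.hyps[OF _ S'] by blast
    define g' where "g' = (\<lambda>s. (if s \<in> \<Lambda> then g s else 0) + (if s = t then k *\<^sub>R v else 0))"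
    have "(\<Sum>s\<in>insert t \<Lambda>. g' s) = (\<Sum>s\<in>insert t \<Lambda>. if s \<in> \<Lambda> then g s else 0) + k *\<^sub>R v"
      using g(1) by (simp add: g'_def sum.distrib)
    also have "(\<Sum>s\<in>insert t \<Lambda>. if s \<in> \<Lambda> then g s else 0) = c'"
      unfolding g(2) using g(1) by (intro sum.mono_neutral_cong_right) auto
    finally have "c = (\<Sum>s\<in>insert t \<Lambda>. g' s)" by (simp add: c'_def)
    moreover have "g' s \<in> S \<and> T (g' s) = s *\<^sub>R g' s" for s
      using v g(3)[of s] less.prems(1)
      by (auto simp: g'_def S'_def linear_add[OF T] linear_scale[OF T] linear_0[OF T] algebra_simps
          subspace_0 intro!: subspace_add subspace_scale)
    ultimately show ?thesis using g(1) by (intro exI[of _ "insert t \<Lambda>"] exI[of _ g']) auto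
  qed
qed

section \<open>Idempotents and the spectral theorem\<close>

context euclidean_jordan_algebra
begin

lemmas prod_simps =
  bilinear_ladd[OF bilinear] bilinear_radd[OF bilinear] bilinear_lmul[OF bilinear]
  bilinear_rmul[OF bilinear] bilinear_lneg[OF bilinear] bilinear_rneg[OF bilinear]
  bilinear_lsub[OF bilinear] bilinear_rsub[OF bilinear] bilinear_lzero[OF bilinear]
  bilinear_rzero[OF bilinear]

lemma linear_left: "linear (J x)"
  using bilinear by (simp add: bilinear_def)

lemma sum_right: "J x (sum g A) = (\<Sum>i\<in>A. J x (g i))"
  by (rule linear_sum[OF linear_left])

lemma sum_left: "J (sum g A) x = (\<Sum>i\<in>A. J (g i) x)"
  by (subst (1 2) commute) (rule sum_right)

lemma unit_right [simp]: "J x e = x"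
  by (simp add: commute[of x e] unit)

text \<open>
  The Jordan identity is cubic in \<open>x\<close>. Adding it at \<open>x + z\<close> and \<open>x - z\<close> isolates the part of degree
  two in \<open>z\<close>, and polarising this part in \<open>z\<close> gives the full linearisation.
\<close>

lemma linearized_jordan_identity:
  "J (J a b) (J c y) + J (J b c) (J a y) + J (J c a) (J b y) =
   J c (J (J a b) y) + J a (J (J b c) y) + J b (J (J c a) y)"
proof -
  define T where "T = (\<lambda>u v w. J (J u v) (J w y) - J w (J (J u v) y))"
  have 0: "T x x x = 0" for x by (simp add: T_def jordan_identity)
  have sym: "T u v w = T v u w" for u v w by (simp add: T_def commute[of u v])
  have add: "T (u + u') v w = T u v w + T u' v w" "T v (u + u') w = T v u w + T v u' w"
    "T u v (w + w') = T u v w + T u v w'" for u u' v w w'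
    by (simp_all add: T_def prod_simps)
  have neg: "T (- u) v w = - T u v w" "T u (- v) w = - T u v w" "T u v (- w) = - T u v w" for u v w
    by (simp_all add: T_def prod_simps)
  have half: "u = 0" if "u + u = 0" for u :: 'a
  proof -
    have "2 *\<^sub>R u = 0" using that by (simp only: scaleR_2)
    thus ?thesis by simp
  qed
  have cube: "T (x + z) (x + z) (x + z) =
    T x x x + (T x x z + (T z x x + T z x x)) + (T z z x + (T x z z + T x z z)) + T z z z" for x z
    by (simp only: add sym[of x z x] sym[of z x z] add_ac)
  have 1: "T z z x + (T x z z + T x z z) = 0" (is "?A = 0") for x z
  proof (rule half)
    let ?B = "T x x z + (T z x x + T z x x)"
    have "?B + ?A = 0" using cube[of x z] by (simp add: 0)
    moreover have "- ?B + ?A = 0" using cube[of x "- z"] by (simp add: 0 neg add_ac)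
    ultimately have "(?B + ?A) + (- ?B + ?A) = 0" by simp
    moreover have "(u + v) + (- u + v) = v + v" for u v :: 'a by simp
    ultimately show "?A + ?A = 0" by simp
  qed
  have "T (a + b) (a + b) c + (T c (a + b) (a + b) + T c (a + b) (a + b)) =
    (T a a c + (T c a a + T c a a)) + (T b b c + (T c b b + T c b b)) +
    ((T a b c + T c a b + T b c a) + (T a b c + T c a b + T b c a))"
    by (simp only: add sym[of b a c] sym[of b c a] add_ac)
  hence "(T a b c + T c a b + T b c a) + (T a b c + T c a b + T b c a) = 0"
    unfolding 1 by simp
  hence "T a b c + T c a b + T b c a = 0" by (rule half)
  thus ?thesis by (simp add: T_def algebra_simps)
qed

text \<open>
  Read as an identity between operators acting on \<open>z\<close>, the linearised identity expresses the
  multiplication by \<open>u (u w)\<close> through the multiplications by \<open>u\<close>, \<open>u\<^sup>2\<close>, \<open>w\<close> and \<open>u w\<close>. This is the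
  recursion behind power associativity.
\<close>

lemma multiplication_power_step:
  "J (J u (J u w)) z = 2 *\<^sub>R J (J u w) (J u z) + J (J u u) (J w z) - J u (J u (J w z)) - J w (J u (J u z))"
proof -
  have "J (J u w) (J u z) + J (J u u) (J w z) + J (J u w) (J u z) =
    J (J u (J u w)) z + J u (J u (J w z)) + J w (J u (J u z))"
    using linearized_jordan_identity[of u w z u]
    by (simp only: commute[of z] commute[of w u] commute[of "J w z" "J u u"]
        commute[of "J u z" "J u w"] commute[of "J u w" u] commute[of "J w z" u] commute[of "J u z" u])
  thus ?thesis by (simp add: scaleR_2 algebra_simps)
qed

lemma peirce_polynomial:
  assumes "J c c = c"
  shows "2 *\<^sub>R J c (J c (J c x)) = 3 *\<^sub>R J c (J c x) - J c x"
proof -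
  have "J c (J c x) + J c (J c x) + J c (J c x) = J c x + J c (J c (J c x)) + J c (J c (J c x))"
    using linearized_jordan_identity[of c c x c] assms
    by (simp only: commute[of x c] commute[of "J c x" c] add_ac)
  moreover have "3 *\<^sub>R z = z + z + z" for z :: 'a
    using scaleR_left_distrib[of 2 1 z] by (simp add: scaleR_2)
  ultimately show ?thesis by (simp add: scaleR_2 algebra_simps)
qed

text \<open>
  The eigenvalues of multiplication by an idempotent are \<open>0\<close>, \<open>1/2\<close> and \<open>1\<close>; the eigenspaces
  are called the Peirce spaces of the idempotent.
\<close>

definition peirce_half :: "'a \<Rightarrow> 'a set" where
  "peirce_half c = {x. J c x = (1/2) *\<^sub>R x}"

text \<open>
  If \<open>c x = t x\<close>, the linearised identity at \<open>(c, c, x)\<close> is \<open>1 - 2 t\<close> times the commutator of the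
  two multiplications. The factor vanishes only for the eigenvalue \<open>1/2\<close>.
\<close>

lemma idempotent_commutes:
  assumes c: "J c c = c" and x: "J c x = x \<or> J c x = 0"
  shows "J c (J x y) = J x (J c y)"
proof -
  obtain t :: real where t: "J c x = t *\<^sub>R x" "t = 0 \<or> t = 1"
    using x by (metis scaleR_one scaleR_zero_left)
  define A where "A = J c (J x y)"
  define B where "B = J x (J c y)"
  have "B + t *\<^sub>R A + t *\<^sub>R A = A + t *\<^sub>R B + t *\<^sub>R B"
    using linearized_jordan_identity[of c x c y] c t(1)
    by (simp add: prod_simps commute[of x c] A_def B_def add_ac)
  thus ?thesis
    using t(2) by (auto simp: A_def B_def)
qed

text \<open>
  The three eigenvalues satisfy \<open>t = t\<^sup>2 + 4 (t - t\<^sup>2)\<^sup>2\<close>, which writes the multiplication by an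
  idempotent as a sum of squares of symmetric operators.
\<close>

lemma idempotent_inner:
  assumes "J c c = c"
  shows "J c x \<bullet> x = J c x \<bullet> J c x + 4 * ((J c x - J c (J c x)) \<bullet> (J c x - J c (J c x)))"
proof -
  have m: "J c u \<bullet> v = u \<bullet> J c v" for u v
    by (rule inner_assoc)
  have p3: "J c (J c (J c z)) = (3/2) *\<^sub>R J c (J c z) - (1/2) *\<^sub>R J c z" for z
    using arg_cong[OF peirce_polynomial[OF assms, of z], of "scaleR (1/2)"]
    by (simp add: scaleR_diff_right)
  have 1: "J c x \<bullet> J c x = x \<bullet> J c (J c x)" "J c (J c x) \<bullet> J c x = x \<bullet> J c (J c (J c x))"
    "J c x \<bullet> J c (J c x) = x \<bullet> J c (J c (J c x))"
    "J c (J c x) \<bullet> J c (J c x) = x \<bullet> J c (J c (J c (J c x)))"  "J c x \<bullet> x = x \<bullet> J c x"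
    by (simp_all only: m)
  show ?thesis
    unfolding inner_diff_left inner_diff_right 1 p3
    by (simp add: prod_simps inner_diff_right p3 algebra_simps)
qed

lemma idempotent_nonneg:
  assumes "J c c = c"
  shows "J c x \<bullet> x \<ge> 0"
  unfolding idempotent_inner[OF assms, of x] by simp

lemma idempotent_inner_eq_0:
  assumes "J c c = c" "J c x \<bullet> x = 0"
  shows "J c x = 0"
proof -
  have "J c x \<bullet> J c x \<le> 0"
    using idempotent_inner[OF assms(1), of x] assms(2)
    by (smt (verit) inner_ge_zero)
  thus ?thesis using inner_ge_zero[of "J c x"] inner_eq_zero_iff[of "J c x"] by simp
qed

lemma idempotent_complement:
  assumes "J c c = c"
  shows "J (e - c) (e - c) = e - c"
  using assms by (simp add: prod_simps unit)

lemma complement_left: "J (e - c) x = x - J c x"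
  by (simp add: prod_simps unit)

subsection \<open>Powers\<close>

text \<open>
  An idempotent \<open>c\<close> with \<open>c u = u\<close> takes the role of the zeroth power, so that the result applies
  inside the Peirce space of \<open>c\<close> as well.
\<close>

lemma multiplications_by_powers_commute:
  assumes c: "J c c = c" and u: "J c u = u"
  shows "(\<forall>y. J (jordan_power J c u n) (J u y) = J u (J (jordan_power J c u n) y)) \<and>
    (\<forall>y. J (jordan_power J c u n) (J (J u u) y) = J (J u u) (J (jordan_power J c u n) y))"
proof (induction n rule: induct_nat_012)
  case 0
  have "J c (J u u) = J u u"
    using idempotent_commutes[OF c, of u u] u by simp
  thus ?case using idempotent_commutes[OF c] u by simp
next
  case 1
  show ?case using u jordan_identity[of u] by (simp add: commute[of u c])
next
  case (ge2 n)
  let ?w = "jordan_power J c u n"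
  have w: "J ?w (J u y) = J u (J ?w y)" "J ?w (J (J u u) y) = J (J u u) (J ?w y)"
    "J (J u ?w) (J u y) = J u (J (J u ?w) y)"
    "J (J u ?w) (J (J u u) y) = J (J u u) (J (J u ?w) y)" for y
    using ge2 by simp_all
  have uu: "J (J u u) (J u y) = J u (J (J u u) y)" for y by (rule jordan_identity)
  show ?case
    by (simp add: multiplication_power_step w uu prod_simps)
qed

text \<open>
  On the span \<open>S\<close> of the powers of \<open>u\<close> the multiplication by \<open>u\<close> is symmetric and commutes with the
  multiplication by every element of \<open>S\<close>. Let \<open>g\<^sub>t\<close> be the components of \<open>c\<close> in its eigenspaces. Then
  \<open>u (g\<^sub>s g\<^sub>t)\<close> equals both \<open>s g\<^sub>s g\<^sub>t\<close> and \<open>t g\<^sub>s g\<^sub>t\<close>, so different components are orthogonal, and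
  \<open>g\<^sub>t = c g\<^sub>t = g\<^sub>t\<^sup>2\<close>.
\<close>

theorem spectral_theorem_peirce_one:
  assumes c: "J c c = c" and u: "J c u = u"
  shows "\<exists>\<Lambda> g. finite \<Lambda> \<and> (\<forall>t\<in>\<Lambda>. J (g t) (g t) = g t \<and> g t \<noteq> 0 \<and> J c (g t) = g t) \<and>
    (\<forall>s\<in>\<Lambda>. \<forall>t\<in>\<Lambda>. s \<noteq> t \<longrightarrow> J (g s) (g t) = 0) \<and>
    c = (\<Sum>t\<in>\<Lambda>. g t) \<and> u = (\<Sum>t\<in>\<Lambda>. t *\<^sub>R g t)"
proof -
  define S where "S = span (range (jordan_power J c u))"
  have S: "subspace S" by (simp add: S_def)
  have lin: "linear (\<lambda>s. J s y)" for y
    using bilinear by (simp add: bilinear_def)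
  have pw: "J u (jordan_power J c u n) \<in> S \<and> J c (jordan_power J c u n) = jordan_power J c u n" for n
  proof
    show "J u (jordan_power J c u n) \<in> S"
      unfolding S_def by (rule span_base) (metis jordan_power.simps(2) rangeI)
    show "J c (jordan_power J c u n) = jordan_power J c u n"
      by (induction n) (use c u idempotent_commutes[OF c, of u] in auto)
  qed
  have inS: "J u s \<in> S \<and> J c s = s \<and> (\<forall>y. J s (J u y) = J u (J s y))" if "s \<in> S" for s
    using that unfolding S_def
  proof (induction rule: span_induct_alt)
    case base
    show ?case by (simp add: prod_simps span_zero)
  next
    case (step k x y)
    then obtain n where n: "x = jordan_power J c u n" by auto
    show ?case
      using step.IH pw[of n] multiplications_by_powers_commute[OF c u, of n] unfolding n S_def[symmetric]
      by (auto simp: prod_simps S subspace_add subspace_scale)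
  qed
  have "c \<in> S"
    unfolding S_def by (rule span_base) (metis jordan_power.simps(1) rangeI)
  moreover have "J u x \<bullet> y = x \<bullet> J u y" for x y
    by (rule inner_assoc)
  ultimately obtain \<Lambda> g where g: "finite \<Lambda>" "c = (\<Sum>t\<in>\<Lambda>. g t)"
    "\<And>t. t \<in> \<Lambda> \<Longrightarrow> g t \<in> S \<and> J u (g t) = t *\<^sub>R g t"
    using symmetric_eigenvector_sum[OF linear_left _ S, of u c] inS by blast
  have orth: "J (g s) (g t) = 0" if "s \<in> \<Lambda>" "t \<in> \<Lambda>" "s \<noteq> t" for s t
  proof -
    have "t *\<^sub>R J (g s) (g t) = J (g s) (J u (g t))" using g(3) that by (simp add: prod_simps)
    also have "\<dots> = J u (J (g s) (g t))" using inS g(3) that by blast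
    also have "\<dots> = J u (J (g t) (g s))" by (simp add: commute)
    also have "\<dots> = J (g t) (J u (g s))" using inS g(3) that by (metis (no_types))
    also have "\<dots> = s *\<^sub>R J (g s) (g t)" using g(3) that by (simp add: prod_simps commute)
    finally show ?thesis using that(3) by simp
  qed
  have idem: "J (g t) (g t) = g t" if "t \<in> \<Lambda>" for t
  proof -
    have "g t = J c (g t)" using inS g(3) that by simp
    also have "\<dots> = (\<Sum>s\<in>\<Lambda>. J (g s) (g t))" by (subst g(2)) (simp add: sum_left)
    also have "\<dots> = (\<Sum>s\<in>\<Lambda>. if s = t then J (g t) (g t) else 0)"
      by (intro sum.cong) (auto simp: orth that)
    also have "\<dots> = J (g t) (g t)" using that g(1) by simp
    finally show ?thesis by simp
  qed
  have "u = J u c" using u by (simp add: commute)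
  also have "\<dots> = (\<Sum>t\<in>\<Lambda>. t *\<^sub>R g t)"
    by (subst g(2)) (simp add: sum_right g(3))
  finally have u_eq: "u = (\<Sum>t\<in>\<Lambda>. t *\<^sub>R g t)" .
  let ?M = "{t \<in> \<Lambda>. g t \<noteq> 0}"
  have "c = (\<Sum>t\<in>?M. g t)" "u = (\<Sum>t\<in>?M. t *\<^sub>R g t)"
    by (subst g(2) u_eq, rule sum.mono_neutral_right, use g(1) in auto)+
  thus ?thesis
    using g(1,3) idem orth inS by (intro exI[of _ ?M] exI[of _ g]) auto
qed

end

context euclidean_jordan_algebra
begin

lemma spectral_theorem:
  "\<exists>\<Lambda> g. finite \<Lambda> \<and> (\<forall>t\<in>\<Lambda>. J (g t) (g t) = g t \<and> g t \<noteq> 0) \<and>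
    (\<forall>s\<in>\<Lambda>. \<forall>t\<in>\<Lambda>. s \<noteq> t \<longrightarrow> J (g s) (g t) = 0) \<and>
    e = (\<Sum>t\<in>\<Lambda>. g t) \<and> u = (\<Sum>t\<in>\<Lambda>. t *\<^sub>R g t)"
  using spectral_theorem_peirce_one[of e u] unit by auto

lemma inner_eq_0_of_mult_eq_0: "J c c = c \<Longrightarrow> J c d = 0 \<Longrightarrow> c \<bullet> d = 0"
  by (metis inner_assoc inner_zero_right)

section \<open>The cone of squares\<close>

abbreviation squares :: "'a set" where
  "squares \<equiv> cone_of_squares J"

lemma square_in_squares [simp, intro]: "J x x \<in> squares"
  by (auto simp: cone_of_squares_def)

lemma idempotent_in_squares: "J c c = c \<Longrightarrow> c \<in> squares"
  by (metis square_in_squares)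

lemma unit_in_squares [simp]: "e \<in> squares"
  by (rule idempotent_in_squares) (rule unit)

lemma square_inner_idempotent: "J x x \<bullet> c = J c x \<bullet> x"
  by (metis inner_assoc commute inner_commute)

lemma orthogonal_square:
  assumes "finite \<Lambda>" "\<And>s t. s \<in> \<Lambda> \<Longrightarrow> t \<in> \<Lambda> \<Longrightarrow> s \<noteq> t \<Longrightarrow> J (g s) (g t) = 0"
    and "\<And>t. t \<in> \<Lambda> \<Longrightarrow> J (g t) (g t) = g t"
  shows "J (\<Sum>t\<in>\<Lambda>. f t *\<^sub>R g t) (\<Sum>t\<in>\<Lambda>. h t *\<^sub>R g t) = (\<Sum>t\<in>\<Lambda>. (f t * h t) *\<^sub>R g t)"
proof -
  have "J (\<Sum>t\<in>\<Lambda>. f t *\<^sub>R g t) (\<Sum>t\<in>\<Lambda>. h t *\<^sub>R g t) =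
    (\<Sum>s\<in>\<Lambda>. \<Sum>t\<in>\<Lambda>. (f s * h t) *\<^sub>R J (g s) (g t))"
    by (simp add: sum_left sum_right prod_simps scaleR_sum_right mult.commute) (rule sum.swap)
  also have "\<dots> = (\<Sum>s\<in>\<Lambda>. \<Sum>t\<in>\<Lambda>. if t = s then (f s * h s) *\<^sub>R g s else 0)"
    by (intro sum.cong) (use assms in auto)
  also have "\<dots> = (\<Sum>t\<in>\<Lambda>. (f t * h t) *\<^sub>R g t)"
    using assms(1) by simp
  finally show ?thesis .
qed

lemma orthogonal_sum_inner:
  assumes "finite \<Lambda>" "\<And>s t. s \<in> \<Lambda> \<Longrightarrow> t \<in> \<Lambda> \<Longrightarrow> s \<noteq> t \<Longrightarrow> J (g s) (g t) = 0"
    and "\<And>t. t \<in> \<Lambda> \<Longrightarrow> J (g t) (g t) = g t" and "s \<in> \<Lambda>"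
  shows "(\<Sum>t\<in>\<Lambda>. f t *\<^sub>R g t) \<bullet> g s = f s * (g s \<bullet> g s)"
proof -
  have "(\<Sum>t\<in>\<Lambda>. f t *\<^sub>R g t) \<bullet> g s = (\<Sum>t\<in>\<Lambda>. if t = s then f s * (g s \<bullet> g s) else 0)"
    unfolding inner_sum_left
    by (intro sum.cong) (use assms inner_eq_0_of_mult_eq_0 in auto)
  thus ?thesis using assms(1,4) by simp
qed

text \<open>
  Pairing \<open>a\<^sup>2\<close> with the spectral decomposition of \<open>b\<^sup>2\<close> gives a sum of terms
  \<open>t\<^sup>2 \<langle>g\<^sub>t a, a\<rangle>\<close>, which are nonnegative.
\<close>

lemma squares_inner_nonneg:
  assumes "x \<in> squares" "y \<in> squares"
  shows "x \<bullet> y \<ge> 0"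
proof -
  obtain a b where ab: "x = J a a" "y = J b b"
    using assms by (auto simp: cone_of_squares_def)
  obtain \<Lambda> g where g: "finite \<Lambda>" "\<And>t. t \<in> \<Lambda> \<Longrightarrow> J (g t) (g t) = g t"
    "\<And>s t. s \<in> \<Lambda> \<Longrightarrow> t \<in> \<Lambda> \<Longrightarrow> s \<noteq> t \<Longrightarrow> J (g s) (g t) = 0"
    "b = (\<Sum>t\<in>\<Lambda>. t *\<^sub>R g t)"
    using spectral_theorem[of b] by blast
  have "y = (\<Sum>t\<in>\<Lambda>. (t * t) *\<^sub>R g t)"
    unfolding ab(2) g(4) by (rule orthogonal_square) (use g in auto)
  hence "x \<bullet> y = (\<Sum>t\<in>\<Lambda>. (t * t) * (J (g t) a \<bullet> a))"
    unfolding ab(1) by (simp add: inner_sum_right)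
      (intro sum.cong refl arg_cong2[where f = "(*)"] square_inner_idempotent)
  also have "\<dots> \<ge> 0"
    by (rule sum_nonneg, rule mult_nonneg_nonneg[OF zero_le_square], rule idempotent_nonneg, rule g(2))
  finally show ?thesis .
qed

text \<open>
  The spectral idempotents of \<open>x\<close> are squares, and pairing \<open>x\<close> with one of them gives a positive
  multiple of the eigenvalue.
\<close>

lemma spectral_theorem_nonneg:
  assumes "\<And>y. y \<in> squares \<Longrightarrow> x \<bullet> y \<ge> 0"
  shows "\<exists>\<Lambda> g. finite \<Lambda> \<and> (\<forall>t\<in>\<Lambda>. 0 \<le> t \<and> J (g t) (g t) = g t) \<and>
    (\<forall>s\<in>\<Lambda>. \<forall>t\<in>\<Lambda>. s \<noteq> t \<longrightarrow> J (g s) (g t) = 0) \<and> x = (\<Sum>t\<in>\<Lambda>. t *\<^sub>R g t)"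
proof -
  obtain \<Lambda> g where g: "finite \<Lambda>" "\<And>t. t \<in> \<Lambda> \<Longrightarrow> J (g t) (g t) = g t \<and> g t \<noteq> 0"
    "\<And>s t. s \<in> \<Lambda> \<Longrightarrow> t \<in> \<Lambda> \<Longrightarrow> s \<noteq> t \<Longrightarrow> J (g s) (g t) = 0"
    "x = (\<Sum>t\<in>\<Lambda>. t *\<^sub>R g t)"
    using spectral_theorem[of x] by blast
  have "t \<ge> 0" if "t \<in> \<Lambda>" for t
  proof -
    have "x \<bullet> g t = t * (g t \<bullet> g t)"
      unfolding g(4) by (rule orthogonal_sum_inner) (use g that in auto)
    moreover have "x \<bullet> g t \<ge> 0"
      using assms idempotent_in_squares[of "g t"] g(2)[OF that] by auto
    moreover have "g t \<bullet> g t > 0"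
      using g(2)[OF that] by simp
    ultimately show ?thesis
      using mult_neg_pos[of t "g t \<bullet> g t"] by linarith
  qed
  hence "\<forall>t\<in>\<Lambda>. 0 \<le> t \<and> J (g t) (g t) = g t" using g(2) by simp
  moreover have "\<forall>s\<in>\<Lambda>. \<forall>t\<in>\<Lambda>. s \<noteq> t \<longrightarrow> J (g s) (g t) = 0" using g(3) by blast
  ultimately show ?thesis
    by - (rule exI[of _ \<Lambda>], rule exI[of _ g], intro conjI g(1,4), assumption+)
qed

lemma squares_self_dual:
  "x \<in> squares \<longleftrightarrow> (\<forall>y\<in>squares. x \<bullet> y \<ge> 0)"
proof
  assume *: "\<forall>y\<in>squares. x \<bullet> y \<ge> 0"
  obtain \<Lambda> g where g: "finite \<Lambda>" "\<And>t. t \<in> \<Lambda> \<Longrightarrow> 0 \<le> t \<and> J (g t) (g t) = g t"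
    "\<And>s t. s \<in> \<Lambda> \<Longrightarrow> t \<in> \<Lambda> \<Longrightarrow> s \<noteq> t \<Longrightarrow> J (g s) (g t) = 0"
    "x = (\<Sum>t\<in>\<Lambda>. t *\<^sub>R g t)"
    using spectral_theorem_nonneg[OF bspec[OF *]] by blast
  have "J (\<Sum>t\<in>\<Lambda>. sqrt t *\<^sub>R g t) (\<Sum>t\<in>\<Lambda>. sqrt t *\<^sub>R g t) = (\<Sum>t\<in>\<Lambda>. (sqrt t * sqrt t) *\<^sub>R g t)"
    by (rule orthogonal_square) (use g in auto)
  also have "\<dots> = x"
    unfolding g(4) by (intro sum.cong) (use g(2) in auto)
  finally show "x \<in> squares" by (metis square_in_squares)
qed (simp add: squares_inner_nonneg)

lemma squares_add: "x \<in> squares \<Longrightarrow> y \<in> squares \<Longrightarrow> x + y \<in> squares"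
  by (subst squares_self_dual) (simp add: inner_add_left squares_inner_nonneg)

lemma squares_scale: "x \<in> squares \<Longrightarrow> t \<ge> 0 \<Longrightarrow> t *\<^sub>R x \<in> squares"
  by (subst squares_self_dual) (simp add: squares_inner_nonneg)

lemma squares_zero [simp]: "0 \<in> squares"
  by (subst squares_self_dual) simp

text \<open>
  For \<open>x = s\<^sup>2\<close> the pairing with the unit is \<open>|s|\<^sup>2\<close>, and the product is bounded.
\<close>

lemma norm_squares_bound:
  "\<exists>M>0. \<forall>x\<in>squares. norm x \<le> M * (x \<bullet> e)"
proof -
  have "bounded_bilinear J"
    using bilinear bilinear_conv_bounded_bilinear by blast
  then obtain M where M: "M > 0" "\<And>a b. norm (J a b) \<le> norm a * norm b * M"
    using bounded_bilinear.pos_bounded by blast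
  have "norm x \<le> M * (x \<bullet> e)" if x: "x \<in> squares" for x
  proof -
    obtain s where s: "x = J s s" using x by (auto simp: cone_of_squares_def)
    have "x \<bullet> e = norm s * norm s"
      using square_inner_idempotent[of s e] by (simp add: s unit dot_square_norm power2_eq_square)
    thus ?thesis using M(2)[of s s] by (simp add: s mult.commute)
  qed
  thus ?thesis using M(1) by blast
qed

section \<open>Peirce spaces\<close>

lemma peirce_zero_mult:
  assumes "J c c = c" "J c x = 0" "J c y = 0"
  shows "J c (J x y) = 0"
  using idempotent_commutes[of c x y] assms by (simp add: prod_simps)

lemma peirce_one_mult:
  assumes "J c c = c" "J c x = x" "J c y = y"
  shows "J c (J x y) = J x y"
  using idempotent_commutes[of c x y] assms by simp

lemma peirce_one_zero:
  assumes "J c c = c" "J c x = x" "J c y = 0"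
  shows "J x y = 0"
proof -
  have "J c (J x y) = 0" using idempotent_commutes[of c x y] assms by (simp add: prod_simps)
  moreover have "J c (J y x) = J y x" using idempotent_commutes[of c y x] assms by simp
  ultimately show ?thesis by (simp add: commute)
qed

text \<open>
  By the linearised identity the multiplications by \<open>c\<close> and by \<open>v\<^sup>2\<close> commute on \<open>c\<close>, which excludes a component
  of \<open>v\<^sup>2\<close> in the half space.
\<close>

lemma peirce_half_square:
  assumes c: "J c c = c" and v: "v \<in> peirce_half c"
  shows "J c (J c (J v v)) = J c (J v v)"
proof -
  have "J (J v v) (J c c) = J c (J (J v v) c)"
    using linearized_jordan_identity[of v v c c] v
    by (simp add: peirce_half_def prod_simps commute[of v c] commute[of "J v v" c])
  thus ?thesis by (simp add: c commute[of "J v v" c])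
qed

text \<open>
  The faces of the cone: if \<open>s\<^sup>2\<close> is orthogonal to \<open>e - c\<close>, then semidefiniteness of the
  multiplication by \<open>e - c\<close> forces \<open>(e - c) s = 0\<close>.
\<close>

lemma orthogonal_to_complement:
  assumes c: "J c c = c" and q: "q \<in> squares" "q \<bullet> (e - c) = 0"
  shows "J c q = q"
proof -
  obtain s where s: "q = J s s" using q by (auto simp: cone_of_squares_def)
  let ?d = "e - c"
  note d = idempotent_complement[OF c]
  have "J ?d s = 0"
    using q(2) idempotent_inner_eq_0[OF d, of s] square_inner_idempotent[of s ?d] by (simp add: s)
  hence "J ?d q = 0"
    unfolding s by (intro peirce_zero_mult d)
  thus ?thesis by (simp add: complement_left)
qed

lemma idempotent_diff:
  assumes "J c c = c" "J d d = d" "J c d = d"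
  shows "J (c - d) (c - d) = c - d"
  using assms by (simp add: prod_simps commute[of d c])

section \<open>Primitive idempotents\<close>

lemma idempotent_sum_orthogonal:
  assumes "J c c = c" "J d d = d" "J (c + d) (c + d) = c + d"
  shows "J c d = 0"
proof -
  have "c + d + 2 *\<^sub>R J c d = c + d"
    using assms by (simp add: prod_simps commute[of d c] scaleR_2 algebra_simps)
  thus ?thesis by simp
qed

lemma primitive_decomposition:
  assumes "J c c = c"
  shows "\<exists>P. finite P \<and> (\<forall>p\<in>P. primitive_idempotent J p \<and> J c p = p) \<and>
    (\<forall>p\<in>P. \<forall>q\<in>P. p \<noteq> q \<longrightarrow> J p q = 0) \<and> c = \<Sum>P"
  using assms
proof (induction "dim {x. J c x = x}" arbitrary: c rule: less_induct)
  case (less c)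
  show ?case
  proof (cases "c = 0 \<or> primitive_idempotent J c")
    case True
    thus ?thesis
      by (elim disjE) (intro exI[of _ "{}"] exI[of _ "{c}"]; use less.prems in simp)+
  next
    case False
    then obtain c1 c2 where c12: "J c1 c1 = c1" "J c2 c2 = c2" "c1 \<noteq> 0" "c2 \<noteq> 0" "c = c1 + c2"
      using less.prems by (auto simp: primitive_idempotent_def jordan_idempotent_def)
    have o: "J c1 c2 = 0"
      using c12 less.prems by (intro idempotent_sum_orthogonal) auto
    have sub: "subspace {x. J d x = x}" for d
      by (auto simp: subspace_def prod_simps)
    have smaller: "dim {x. J d x = x} < dim {x. J c x = x}" and inv: "\<And>x. J d x = x \<Longrightarrow> J c x = x"
      if d: "J d d = d" "J d d' = 0" "c = d + d'" "J d' d' = d'" "d' \<noteq> 0" for d d'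
    proof -
      show inv: "J c x = x" if "J d x = x" for x
        using peirce_one_zero[OF d(1) that d(2)] that by (simp add: d(3) prod_simps commute[of d' x])
      have "d' \<in> {x. J c x = x}" "d' \<notin> {x. J d x = x}"
        using d by (auto simp: prod_simps)
      with inv have "{x. J d x = x} \<subset> {x. J c x = x}" by blast
      thus "dim {x. J d x = x} < dim {x. J c x = x}"
        by (metis dim_psubset span_eq_iff sub)
    qed
    note s1 = smaller[of c1 c2] and s2 = smaller[of c2 c1]
    have o': "J c2 c1 = 0" using o by (simp add: commute)
    obtain P1 where P1: "finite P1" "\<And>p. p \<in> P1 \<Longrightarrow> primitive_idempotent J p \<and> J c1 p = p"
      "\<And>p q. p \<in> P1 \<Longrightarrow> q \<in> P1 \<Longrightarrow> p \<noteq> q \<Longrightarrow> J p q = 0" "c1 = \<Sum>P1"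
      using less.hyps[OF s1] c12 o by (metis (no_types, lifting))
    obtain P2 where P2: "finite P2" "\<And>p. p \<in> P2 \<Longrightarrow> primitive_idempotent J p \<and> J c2 p = p"
      "\<And>p q. p \<in> P2 \<Longrightarrow> q \<in> P2 \<Longrightarrow> p \<noteq> q \<Longrightarrow> J p q = 0" "c2 = \<Sum>P2"
      using less.hyps[OF s2] c12 o' by (metis (no_types, lifting) add.commute)
    have c2P1: "J c2 p = 0" if "p \<in> P1" for p
      using peirce_one_zero[OF c12(1) _ o, of p] P1(2)[OF that] by (simp add: commute)
    have cross: "J p q = 0" if "p \<in> P1" "q \<in> P2" for p q
      using peirce_one_zero[OF c12(2) _ c2P1[OF that(1)], of q] P2(2)[OF that(2)]
      by (simp add: commute)
    have "p \<noteq> 0 \<and> J p p = p" if "p \<in> P1 \<union> P2" for p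
      using that P1(2) P2(2) by (auto simp: primitive_idempotent_def jordan_idempotent_def)
    hence "P1 \<inter> P2 = {}" using cross by (metis UnI1 disjoint_iff)
    hence sum: "c = \<Sum>(P1 \<union> P2)"
      using P1 P2 c12(5) by (simp add: sum.union_disjoint)
    have unit: "J c p = p" if "p \<in> P1 \<union> P2" for p
      using that inv[of c1 c2 p] inv[of c2 c1 p] c12 o o' P1(2) P2(2) by (auto simp: add.commute)
    have "J p q = 0" if "p \<in> P1 \<union> P2" "q \<in> P1 \<union> P2" "p \<noteq> q" for p q
      using that cross[of p q] cross[of q p] commute[of p q] P1(3)[of p q] P2(3)[of p q] by auto
    moreover have "primitive_idempotent J p" if "p \<in> P1 \<union> P2" for p
      using that P1(2) P2(2) by auto
    moreover have "finite (P1 \<union> P2)" using P1(1) P2(1) by simp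
    ultimately show ?thesis
      using sum unit by metis
  qed
qed

lemma primitive_idempotentD:
  assumes "primitive_idempotent J p"
  shows "J p p = p" "p \<noteq> 0"
  using assms by (auto simp: primitive_idempotent_def jordan_idempotent_def)

lemma primitive_minimal:
  assumes "primitive_idempotent J p" "J g g = g" "g \<noteq> 0" "J p g = g"
  shows "g = p"
proof (rule ccontr)
  assume "g \<noteq> p"
  have "J (p - g) (p - g) = p - g"
    using idempotent_diff assms primitive_idempotentD by blast
  moreover have "p = g + (p - g)" "p - g \<noteq> 0" using \<open>g \<noteq> p\<close> by simp_all
  ultimately have "\<exists>p1 p2. jordan_idempotent J p1 \<and> jordan_idempotent J p2 \<and>
      p1 \<noteq> 0 \<and> p2 \<noteq> 0 \<and> p = p1 + p2"
    using assms(2,3) unfolding jordan_idempotent_def by blast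
  thus False
    using assms(1) unfolding primitive_idempotent_def by blast
qed

text \<open>
  The spectral idempotents of \<open>u\<close> lie below \<open>p\<close>, and nothing but \<open>p\<close> does.
\<close>

lemma peirce_one_primitive:
  assumes p: "primitive_idempotent J p" and u: "J p u = u"
  shows "\<exists>t. u = t *\<^sub>R p"
proof -
  obtain \<Lambda> g where g: "finite \<Lambda>" "\<And>t. t \<in> \<Lambda> \<Longrightarrow> J (g t) (g t) = g t \<and> g t \<noteq> 0 \<and> J p (g t) = g t"
    "\<And>s t. s \<in> \<Lambda> \<Longrightarrow> t \<in> \<Lambda> \<Longrightarrow> s \<noteq> t \<Longrightarrow> J (g s) (g t) = 0"
    "p = (\<Sum>t\<in>\<Lambda>. g t)" "u = (\<Sum>t\<in>\<Lambda>. t *\<^sub>R g t)"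
    using spectral_theorem_peirce_one[OF primitive_idempotentD(1)[OF p] u] by blast
  have "g t = p" if "t \<in> \<Lambda>" for t
    using primitive_minimal[OF p] g(2)[OF that] by blast
  hence "u = (\<Sum>t\<in>\<Lambda>. t) *\<^sub>R p"
    by (simp add: g(5) scaleR_sum_left)
  thus ?thesis by blast
qed

text \<open>
  The primitive idempotents generate the cone.
\<close>

lemma squares_induct [consumes 1, case_names zero primitive add scale]:
  assumes "x \<in> squares"
    and "Pr 0" "\<And>p. primitive_idempotent J p \<Longrightarrow> Pr p"
    and add: "\<And>x y. x \<in> squares \<Longrightarrow> y \<in> squares \<Longrightarrow> Pr x \<Longrightarrow> Pr y \<Longrightarrow> Pr (x + y)"
    and scale: "\<And>x t. x \<in> squares \<Longrightarrow> t \<ge> 0 \<Longrightarrow> Pr x \<Longrightarrow> Pr (t *\<^sub>R x)"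
  shows "Pr x"
proof -
  have sum: "Pr (\<Sum>i\<in>A. f i) \<and> (\<Sum>i\<in>A. f i) \<in> squares"
    if "finite A" "\<And>i. i \<in> A \<Longrightarrow> Pr (f i) \<and> f i \<in> squares" for A :: "'b set" and f
    using that by (induction A rule: finite_induct) (auto intro: assms(2) add squares_add)
  have idem: "Pr c" if c: "J c c = c" for c
  proof -
    obtain P where P: "finite P" "\<And>p. p \<in> P \<Longrightarrow> primitive_idempotent J p" "c = (\<Sum>p\<in>P. p)"
      using primitive_decomposition[OF c] by blast
    have "Pr p \<and> p \<in> squares" if "p \<in> P" for p
      using assms(3)[OF P(2)[OF that]] idempotent_in_squares[OF primitive_idempotentD(1)[OF P(2)[OF that]]]
      by simp
    from sum[OF P(1), of "\<lambda>p. p", OF this] show ?thesis unfolding P(3) by blast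
  qed
  obtain \<Lambda> g where g: "finite \<Lambda>" "\<And>t. t \<in> \<Lambda> \<Longrightarrow> 0 \<le> t \<and> J (g t) (g t) = g t"
    "x = (\<Sum>t\<in>\<Lambda>. t *\<^sub>R g t)"
    using spectral_theorem_nonneg[OF squares_inner_nonneg[OF assms(1)]] by blast
  have "Pr (t *\<^sub>R g t) \<and> t *\<^sub>R g t \<in> squares" if "t \<in> \<Lambda>" for t
    using g(2)[OF that] scale[of "g t" t] squares_scale[of "g t" t] idem[of "g t"]
      idempotent_in_squares[of "g t"] by simp
  from sum[OF g(1), of "\<lambda>t. t *\<^sub>R g t", OF this] show ?thesis unfolding g(3) by blast
qed

end

section \<open>Minimal polynomials and the rank\<close>

lemma prod_linear_factors:
  fixes \<tau> :: "'b \<Rightarrow> real"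
  assumes "finite C"
  shows "coeff (\<Prod>c\<in>C. [:- \<tau> c, 1:]) (card C) = 1 \<and> degree (\<Prod>c\<in>C. [:- \<tau> c, 1:]) = card C \<and>
    (\<forall>k. Suc k = card C \<longrightarrow> coeff (\<Prod>c\<in>C. [:- \<tau> c, 1:]) k = - (\<Sum>c\<in>C. \<tau> c))"
  using assms
proof (induction C rule: finite_induct)
  case (insert c C)
  let ?q = "\<Prod>c\<in>C. [:- \<tau> c, 1:]"
  have eq: "(\<Prod>c\<in>insert c C. [:- \<tau> c, 1:]) = smult (- \<tau> c) ?q + pCons 0 ?q"
    using insert by simp
  have "?q \<noteq> 0" using insert.hyps(1) by simp
  have deg: "degree (\<Prod>c\<in>insert c C. [:- \<tau> c, 1:]) = card (insert c C)"
    by (subst degree_prod_eq_sum_degree) (use insert in auto)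
  have 0: "coeff ?q (Suc (card C)) = 0"
    using insert.IH by (intro coeff_eq_0) simp
  have "coeff (smult (- \<tau> c) ?q + pCons 0 ?q) (card C) = - \<tau> c - (\<Sum>c\<in>C. \<tau> c)"
  proof (cases "card C")
    case 0
    thus ?thesis using insert by simp
  next
    case (Suc k)
    thus ?thesis using insert by (simp add: coeff_pCons)
  qed
  thus ?case
    using insert deg 0 unfolding eq by (simp add: coeff_pCons)
qed simp

context euclidean_jordan_algebra
begin

definition idempotent_system :: "'a set \<Rightarrow> bool" where
  "idempotent_system C \<longleftrightarrow> finite C \<and> (\<forall>c\<in>C. J c c = c \<and> c \<noteq> 0) \<and>
    (\<forall>c\<in>C. \<forall>d\<in>C. c \<noteq> d \<longrightarrow> J c d = 0) \<and> \<Sum>C = e"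

lemma idempotent_systemD:
  assumes "idempotent_system C"
  shows "finite C" "\<And>c. c \<in> C \<Longrightarrow> J c c = c" "\<And>c. c \<in> C \<Longrightarrow> c \<noteq> 0"
    "\<And>c d. c \<in> C \<Longrightarrow> d \<in> C \<Longrightarrow> c \<noteq> d \<Longrightarrow> J c d = 0" "(\<Sum>c\<in>C. c) = e"
  using assms by (auto simp: idempotent_system_def)

lemma jordan_power_system:
  assumes "idempotent_system C"
  shows "jordan_power J e (\<Sum>c\<in>C. \<tau> c *\<^sub>R c) n = (\<Sum>c\<in>C. \<tau> c ^ n *\<^sub>R c)"
proof (induction n)
  case 0
  show ?case using idempotent_systemD(5)[OF assms] by simp
next
  case (Suc n)
  have "J (\<Sum>c\<in>C. \<tau> c *\<^sub>R c) (\<Sum>c\<in>C. \<tau> c ^ n *\<^sub>R c) = (\<Sum>c\<in>C. (\<tau> c * \<tau> c ^ n) *\<^sub>R c)"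
    by (rule orthogonal_square) (use idempotent_systemD[OF assms] in auto)
  thus ?case by (simp add: Suc)
qed

lemma jordan_poly_system:
  assumes "idempotent_system C"
  shows "jordan_poly J e q (\<Sum>c\<in>C. \<tau> c *\<^sub>R c) = (\<Sum>c\<in>C. poly q (\<tau> c) *\<^sub>R c)"
  unfolding jordan_poly_def jordan_power_system[OF assms]
  by (simp add: poly_altdef scaleR_sum_right scaleR_sum_left) (rule sum.swap)

text \<open>
  The minimal polynomial of \<open>\<Sum> \<tau>\<^sub>c c\<close> can be read off from the eigenvalues \<open>\<tau>\<^sub>c\<close>; this is how systems
  of orthogonal idempotents enter the rank.
\<close>

lemma jordan_poly_system_eq_0:
  assumes C: "idempotent_system C"
  shows "jordan_poly J e q (\<Sum>c\<in>C. \<tau> c *\<^sub>R c) = 0 \<longleftrightarrow> (\<forall>c\<in>C. poly q (\<tau> c) = 0)"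
proof
  assume *: "jordan_poly J e q (\<Sum>c\<in>C. \<tau> c *\<^sub>R c) = 0"
  show "\<forall>c\<in>C. poly q (\<tau> c) = 0"
  proof
    fix c assume c: "c \<in> C"
    have "(\<Sum>d\<in>C. poly q (\<tau> d) *\<^sub>R d) \<bullet> c = poly q (\<tau> c) * (c \<bullet> c)"
      by (rule orthogonal_sum_inner[where g = "\<lambda>c. c"]) (use idempotent_systemD[OF C] c in auto)
    thus "poly q (\<tau> c) = 0"
      using * idempotent_systemD(3)[OF C c] by (simp add: jordan_poly_system[OF C])
  qed
qed (simp add: jordan_poly_system[OF C])

lemma jordan_min_poly_system:
  assumes C: "idempotent_system C" and inj: "inj_on \<tau> C"
  shows "jordan_min_poly J e (\<Sum>c\<in>C. \<tau> c *\<^sub>R c) = (\<Prod>c\<in>C. [:- \<tau> c, 1:])"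
proof -
  let ?u = "\<Sum>c\<in>C. \<tau> c *\<^sub>R c" and ?q = "\<Prod>c\<in>C. [:- \<tau> c, 1:]"
  note finC = idempotent_systemD(1)[OF C]
  note q = prod_linear_factors[OF finC, of \<tau>]
  have root: "jordan_poly J e q' ?u = 0 \<longleftrightarrow> (\<forall>z\<in>\<tau> ` C. poly q' z = 0)" for q'
    by (simp add: jordan_poly_system_eq_0[OF C])
  have q0: "jordan_poly J e ?q ?u = 0"
    unfolding root using finC by (auto simp: poly_prod)
  have card: "card (\<tau> ` C) = card C" using inj by (rule card_image)
  have deg: "card C \<le> degree q'" if "q' \<noteq> 0" "jordan_poly J e q' ?u = 0" for q'
  proof -
    have "card (\<tau> ` C) \<le> card {z. poly q' z = 0}"
      using that by (intro card_mono poly_roots_finite) (auto simp: root)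
    thus ?thesis using card_poly_roots_bound[OF that(1)] card by linarith
  qed
  show ?thesis
    unfolding jordan_min_poly_def
  proof (rule the_equality, intro conjI allI impI)
    show "lead_coeff ?q = 1" using q by simp
    show "jordan_poly J e ?q ?u = 0" by (rule q0)
    show "degree ?q \<le> degree q'" if "q' \<noteq> 0 \<and> jordan_poly J e q' ?u = 0" for q'
      using deg that q by simp
  next
    fix q' assume *: "lead_coeff q' = 1 \<and> jordan_poly J e q' ?u = 0 \<and>
      (\<forall>q''. q'' \<noteq> 0 \<and> jordan_poly J e q'' ?u = 0 \<longrightarrow> degree q' \<le> degree q'')"
    have "?q \<noteq> 0" using finC by simp
    hence "degree q' \<le> card C" using * q0 q by metis
    moreover have "q' \<noteq> 0" using * by auto
    ultimately have d: "degree q' = card C" using deg * by (simp add: antisym)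
    show "q' = ?q"
    proof (rule poly_eqI_degree_lead_coeff)
      show "coeff q' (card C) = coeff ?q (card C)" using * d q by metis
      show "poly q' z = poly ?q z" if "z \<in> \<tau> ` C" for z
        using * q0 that unfolding root by metis
    qed (use d q card in auto)
  qed
qed

lemma exists_system:
  obtains C \<tau> where "idempotent_system C" "inj_on \<tau> C" "u = (\<Sum>c\<in>C. \<tau> c *\<^sub>R c)"
proof -
  obtain \<Lambda> g where g: "finite \<Lambda>" "\<And>t. t \<in> \<Lambda> \<Longrightarrow> J (g t) (g t) = g t \<and> g t \<noteq> 0"
    "\<And>s t. s \<in> \<Lambda> \<Longrightarrow> t \<in> \<Lambda> \<Longrightarrow> s \<noteq> t \<Longrightarrow> J (g s) (g t) = 0"
    "e = (\<Sum>t\<in>\<Lambda>. g t)" "u = (\<Sum>t\<in>\<Lambda>. t *\<^sub>R g t)"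
    using spectral_theorem[of u] by blast
  have inj: "inj_on g \<Lambda>"
    by (rule inj_onI) (metis g(2,3))
  define \<tau> where "\<tau> = the_inv_into \<Lambda> g"
  have \<tau>: "\<tau> (g t) = t" if "t \<in> \<Lambda>" for t
    using that inj by (simp add: \<tau>_def the_inv_into_f_f)
  have "idempotent_system (g ` \<Lambda>)"
    unfolding idempotent_system_def using g inj by (auto simp: sum.reindex)
  moreover have "inj_on \<tau> (g ` \<Lambda>)"
    using \<tau> by (auto intro!: inj_onI)
  moreover have "u = (\<Sum>c\<in>g ` \<Lambda>. \<tau> c *\<^sub>R c)"
    using g(5) inj \<tau> by (simp add: sum.reindex)
  ultimately show thesis by (rule that)
qed

lemma card_system_le_dim:
  assumes C: "idempotent_system C"
  shows "card C \<le> DIM('a)"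
proof -
  have "pairwise orthogonal C"
    using idempotent_systemD[OF C] inner_eq_0_of_mult_eq_0
    by (auto simp: pairwise_def orthogonal_def)
  moreover have "0 \<notin> C" using idempotent_systemD(3)[OF C] by blast
  ultimately show ?thesis
    using pairwise_orthogonal_independent independent_bound by blast
qed

lemma finite_min_poly_degrees: "finite (range (\<lambda>x. degree (jordan_min_poly J e x)))"
proof (rule finite_subset)
  show "range (\<lambda>x. degree (jordan_min_poly J e x)) \<subseteq> {..DIM('a)}"
  proof
    fix n assume "n \<in> range (\<lambda>x. degree (jordan_min_poly J e x))"
    then obtain x where x: "n = degree (jordan_min_poly J e x)" by blast
    obtain C \<tau> where C: "idempotent_system C" "inj_on \<tau> C" "x = (\<Sum>c\<in>C. \<tau> c *\<^sub>R c)"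
      by (rule exists_system)
    have "n = card C"
      unfolding x C(3) jordan_min_poly_system[OF C(1,2)]
      using prod_linear_factors[OF idempotent_systemD(1)[OF C(1)]] by simp
    thus "n \<in> {..DIM('a)}" using card_system_le_dim[OF C(1)] by simp
  qed
qed simp

lemma degree_min_poly_system:
  assumes "idempotent_system C" "inj_on \<tau> C"
  shows "degree (jordan_min_poly J e (\<Sum>c\<in>C. \<tau> c *\<^sub>R c)) = card C"
  unfolding jordan_min_poly_system[OF assms]
  using prod_linear_factors[OF idempotent_systemD(1)[OF assms(1)]] by simp

lemma card_system_le_rank:
  assumes C: "idempotent_system C"
  shows "card C \<le> jordan_rank J e"
proof -
  obtain \<tau> :: "'a \<Rightarrow> nat" where "inj_on \<tau> C"
    using finite_imp_inj_to_nat_seg[OF idempotent_systemD(1)[OF C]] by blast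
  hence "inj_on (\<lambda>c. real (\<tau> c)) C" by (simp add: inj_on_def)
  from degree_min_poly_system[OF C this]
  have "card C \<in> range (\<lambda>x. degree (jordan_min_poly J e x))" by (metis rangeI)
  thus ?thesis
    unfolding jordan_rank_def using finite_min_poly_degrees by simp
qed

lemma maximal_system_exists:
  obtains C where "idempotent_system C" "card C = jordan_rank J e"
proof -
  have "jordan_rank J e \<in> range (\<lambda>x. degree (jordan_min_poly J e x))"
    unfolding jordan_rank_def using finite_min_poly_degrees by (intro Max_in) auto
  then obtain x where x: "jordan_rank J e = degree (jordan_min_poly J e x)" by blast
  obtain C \<tau> where "idempotent_system C" "inj_on \<tau> C" "x = (\<Sum>c\<in>C. \<tau> c *\<^sub>R c)"
    by (rule exists_system)
  with x degree_min_poly_system show thesis by (metis that)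
qed

text \<open>
  Splitting a member would give a system with more members than the rank.
\<close>

lemma maximal_system_primitive:
  assumes C: "idempotent_system C" "card C = jordan_rank J e" and g: "g \<in> C"
  shows "primitive_idempotent J g"
proof (rule ccontr)
  assume "\<not> primitive_idempotent J g"
  then obtain c d where cd: "J c c = c" "J d d = d" "c \<noteq> 0" "d \<noteq> 0" "g = c + d"
    using idempotent_systemD[OF C(1)] g
    unfolding primitive_idempotent_def jordan_idempotent_def by blast
  have gg: "J g g = g" using idempotent_systemD(2)[OF C(1) g] .
  have o: "J c d = 0"
    using cd gg by (intro idempotent_sum_orthogonal) auto
  have o': "J d c = 0" using o by (simp add: commute)
  let ?D = "C - {g}"
  have Jg: "J g c = c" "J g d = d" by (simp_all add: cd o o' prod_simps)
  have other: "J c x = 0" "J d x = 0" if "x \<in> ?D" for x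
    using peirce_one_zero[OF gg Jg(1), of x] peirce_one_zero[OF gg Jg(2), of x]
      idempotent_systemD(4)[OF C(1) g, of x] that by auto
  have other': "J x c = 0" "J x d = 0" if "x \<in> ?D" for x
    using other[OF that] by (simp_all add: commute)
  have nin: "c \<notin> ?D" "d \<notin> ?D" "c \<noteq> d" using other cd o by force+
  have fin: "finite ?D" using idempotent_systemD(1)[OF C(1)] by simp
  have "\<Sum>(insert c (insert d ?D)) = c + d + \<Sum>?D" using nin fin by simp
  also have "\<dots> = \<Sum>C"
    using idempotent_systemD(1)[OF C(1)] g cd(5) by (simp add: sum.remove)
  finally have s: "\<Sum>(insert c (insert d ?D)) = e" using idempotent_systemD(5)[OF C(1)] by simp
  have "idempotent_system (insert c (insert d ?D))"
    unfolding idempotent_system_def s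
    using fin cd o o' other other' idempotent_systemD[OF C(1)] by auto
  from card_system_le_rank[OF this] have "Suc (card C) \<le> jordan_rank J e"
    using nin fin g idempotent_systemD(1)[OF C(1)]
    by (simp add: card_Suc_Diff1)
  thus False using C(2) by simp
qed

text \<open>
  Both sides equal \<open>2 |p q|\<^sup>2 - \<langle>p, q\<rangle>\<close>. For primitive idempotents the two sides are computed from
  \<open>\<langle>p, q\<rangle>\<close> and one of the norms, so the symmetry compares the norms.
\<close>

lemma quad_rep_inner_sym:
  assumes "J p p = p" "J q q = q"
  shows "quad_rep J p q \<bullet> q = quad_rep J q p \<bullet> p"
proof -
  have "J p (J p q) \<bullet> q = J p q \<bullet> J p q" "J q (J q p) \<bullet> p = J q p \<bullet> J q p"
    by (simp_all add: inner_assoc)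
  moreover have "J p q \<bullet> q = J q p \<bullet> p"
    using square_inner_idempotent[of q p] square_inner_idempotent[of p q] assms
      inner_commute[of p q] by simp
  ultimately show ?thesis
    using assms by (simp add: quad_rep_def inner_diff_left commute[of q p])
qed

lemma quad_rep_primitive:
  assumes p: "primitive_idempotent J p"
  shows "quad_rep J p x = ((p \<bullet> x) / (p \<bullet> p)) *\<^sub>R p"
proof -
  note pp = primitive_idempotentD[OF p]
  have "J p (quad_rep J p x) = quad_rep J p x"
    using peirce_polynomial[OF pp(1), of x] pp(1)
    by (simp add: quad_rep_def prod_simps) (simp add: scaleR_left_distrib[of 2 1, simplified] scaleR_2)
  then obtain t where t: "quad_rep J p x = t *\<^sub>R p"
    using peirce_one_primitive[OF p] by blast
  have m: "y \<bullet> J p z = J p y \<bullet> z" for y z by (simp add: inner_assoc)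
  have "p \<bullet> quad_rep J p x = p \<bullet> x"
    by (simp add: quad_rep_def inner_diff_right m pp(1))
  hence "t * (p \<bullet> p) = p \<bullet> x" using t by simp
  hence "t = (p \<bullet> x) / (p \<bullet> p)" using pp(2) by (simp add: eq_divide_eq)
  thus ?thesis using t by simp
qed

end

section \<open>The trace form\<close>

locale trace_form = euclidean_jordan_algebra J e
  for J :: "'a::euclidean_space \<Rightarrow> 'a \<Rightarrow> 'a" and e :: 'a +
  fixes tr :: "'a \<Rightarrow> real"
  assumes trace: "jordan_trace J e tr"
    and inner_trace: "x \<bullet> y = tr (J x y)"
begin

text \<open>
  The trace of \<open>\<Sum> \<tau>\<^sub>c c\<close> is \<open>\<Sum> \<tau>\<^sub>c\<close> for all choices of distinct \<open>\<tau>\<^sub>c\<close>. Changing the value at \<open>g\<close>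
  alone isolates the trace of \<open>g\<close>.
\<close>

lemma trace_maximal_system:
  assumes C: "idempotent_system C" "card C = jordan_rank J e" and g: "g \<in> C"
  shows "tr g = 1"
proof -
  note finC = idempotent_systemD(1)[OF C(1)]
  have lin: "linear tr" using trace by (simp add: jordan_trace_def)
  have tr_eq: "(\<Sum>c\<in>C. \<tau> c * tr c) = (\<Sum>c\<in>C. \<tau> c)" if "inj_on \<tau> C" for \<tau>
  proof -
    let ?u = "\<Sum>c\<in>C. \<tau> c *\<^sub>R c"
    have "card C > 0" using g finC card_gt_0_iff by blast
    hence S: "Suc (card C - 1) = card C" by simp
    have "tr ?u = - coeff (jordan_min_poly J e ?u) (card C - 1)"
      using trace degree_min_poly_system[OF C(1) that] C(2) by (simp add: jordan_trace_def)
    also have "\<dots> = (\<Sum>c\<in>C. \<tau> c)"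
      unfolding jordan_min_poly_system[OF C(1) that]
      using prod_linear_factors[OF finC, of \<tau>] S by simp
    finally show ?thesis
      by (simp add: linear_sum[OF lin] linear_scale[OF lin])
  qed
  obtain n where "bij_betw n C {0..<card C}"
    using ex_bij_betw_finite_nat[OF finC] by blast
  hence n: "inj_on n C" "n ` C = {0..<card C}" by (auto simp: bij_betw_def)
  define \<tau> where "\<tau> = (\<lambda>c. real (n c))"
  \<comment> \<open>The value \<open>card C\<close> at \<open>g\<close> exceeds all values of \<open>\<tau>\<close>, so \<open>\<tau>'\<close> is injective again.\<close>
  define \<tau>' where "\<tau>' = (\<lambda>c. if c = g then real (card C) else \<tau> c)"
  have i: "inj_on \<tau> C" using n by (simp add: \<tau>_def inj_on_def)
  have lt: "\<tau> c < real (card C)" if "c \<in> C" for c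
    using n(2) that by (auto simp: \<tau>_def)
  have ne: "\<tau> c \<noteq> real (card C)" "real (card C) \<noteq> \<tau> c" if "c \<in> C" for c
    using lt[OF that] by simp_all
  have i': "inj_on \<tau>' C"
    by (rule inj_onI) (simp add: \<tau>'_def ne inj_on_eq_iff[OF i] split: if_splits)
  have d: "(\<Sum>c\<in>C. \<tau>' c * f c) = (\<Sum>c\<in>C. \<tau> c * f c) + (real (card C) - \<tau> g) * f g" for f :: "'a \<Rightarrow> real"
    unfolding sum.remove[OF finC g]
    by (simp add: \<tau>'_def algebra_simps)
  have "(real (card C) - \<tau> g) * tr g = (real (card C) - \<tau> g) * 1"
    using d[of tr] d[of "\<lambda>_. 1"] tr_eq[OF i] tr_eq[OF i'] by simp
  thus ?thesis using lt[OF g] by simp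
qed

text \<open>
  Some member \<open>p\<close> of a maximal system is not orthogonal to \<open>q\<close>, since the system sums to the unit.
  It has norm one by its trace, and \<open>\<langle>P(p) q, q\<rangle> = \<langle>P(q) p, p\<rangle>\<close> transfers this to \<open>q\<close>.
\<close>

lemma primitive_norm:
  assumes q: "primitive_idempotent J q"
  shows "q \<bullet> q = 1"
proof -
  note qq = primitive_idempotentD[OF q]
  obtain C where C: "idempotent_system C" "card C = jordan_rank J e"
    by (rule maximal_system_exists)
  have "q \<bullet> e \<noteq> 0"
    using inner_assoc[of q q e] qq by simp
  hence "(\<Sum>c\<in>C. q \<bullet> c) \<noteq> 0"
    unfolding idempotent_systemD(5)[OF C(1), symmetric] by (simp add: inner_sum_right)
  then obtain p where p: "p \<in> C" "q \<bullet> p \<noteq> 0"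
    by (meson sum.neutral)
  have pprim: "primitive_idempotent J p"
    using maximal_system_primitive[OF C p(1)] .
  note pp = primitive_idempotentD[OF pprim]
  have "p \<bullet> p = 1"
    using trace_maximal_system[OF C p(1)] pp(1) by (simp add: inner_trace)
  hence "(p \<bullet> q) * (p \<bullet> q) = (q \<bullet> p) / (q \<bullet> q) * (q \<bullet> p)"
    using quad_rep_inner_sym[OF pp(1) qq(1)]
    by (simp add: quad_rep_primitive[OF pprim] quad_rep_primitive[OF q])
  thus ?thesis using p(2) qq(2) by (simp add: inner_commute[of p q] divide_simps)
qed

lemma unit_norm: "e \<bullet> e = real (jordan_rank J e)"
proof -
  obtain C where C: "idempotent_system C" "card C = jordan_rank J e"
    by (rule maximal_system_exists)
  have lin: "linear tr" using trace by (simp add: jordan_trace_def)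
  have "e \<bullet> e = tr (\<Sum>c\<in>C. c)"
    by (simp add: inner_trace unit idempotent_systemD(5)[OF C(1)])
  also have "\<dots> = (\<Sum>c\<in>C. 1)"
    unfolding linear_sum[OF lin] by (intro sum.cong trace_maximal_system[OF C]) auto
  finally show ?thesis using C(2) by simp
qed

lemma orthogonal_norm:
  assumes "finite P" "\<And>p. p \<in> P \<Longrightarrow> primitive_idempotent J p"
    "\<And>p q. p \<in> P \<Longrightarrow> q \<in> P \<Longrightarrow> p \<noteq> q \<Longrightarrow> J p q = 0"
  shows "\<Sum>P \<bullet> \<Sum>P = real (card P)"
proof -
  have "(\<Sum>p\<in>P. p) \<bullet> (\<Sum>q\<in>P. q) = (\<Sum>q\<in>P. (\<Sum>p\<in>P. 1 *\<^sub>R p) \<bullet> q)" by (simp add: inner_sum_right)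
  also have "\<dots> = (\<Sum>q\<in>P. 1 * (q \<bullet> q))"
    by (intro sum.cong orthogonal_sum_inner[where g = "\<lambda>p. p"])
       (use assms primitive_idempotentD in auto)
  also have "\<dots> = real (card P)" using assms(2) by (simp add: primitive_norm)
  finally show ?thesis .
qed

lemma idempotent_norm_ge_1:
  assumes "J c c = c" "c \<noteq> 0"
  shows "c \<bullet> c \<ge> 1"
proof -
  obtain P where P: "finite P" "\<And>p. p \<in> P \<Longrightarrow> primitive_idempotent J p"
    "\<And>p q. p \<in> P \<Longrightarrow> q \<in> P \<Longrightarrow> p \<noteq> q \<Longrightarrow> J p q = 0" "c = \<Sum>P"
    using primitive_decomposition[OF assms(1)] by blast
  have "P \<noteq> {}" using P(4) assms(2) by auto
  hence "card P \<ge> 1" using P(1) by (simp add: Suc_le_eq card_gt_0_iff)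
  thus ?thesis using orthogonal_norm[OF P(1-3)] P(4) by simp
qed

text \<open>
  Decompose \<open>e - p\<close> into primitive idempotents. Their number is determined by
  \<open>|e|\<^sup>2\<close>, because orthogonal primitive idempotents have norm one.
\<close>

lemma primitive_extends_to_frame:
  assumes p: "primitive_idempotent J p"
  obtains f where "jordan_frame J e f" "f 0 = p" "jordan_rank J e > 0"
proof -
  note pp = primitive_idempotentD[OF p]
  have pe: "J (e - p) p = 0" by (simp add: complement_left pp)
  obtain P where P: "finite P" "\<And>q. q \<in> P \<Longrightarrow> primitive_idempotent J q \<and> J (e - p) q = q"
    "\<And>q q'. q \<in> P \<Longrightarrow> q' \<in> P \<Longrightarrow> q \<noteq> q' \<Longrightarrow> J q q' = 0" "e - p = \<Sum>P"
    using primitive_decomposition[OF idempotent_complement[OF pp(1)]] by blast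
  have pq: "J p q = 0" "J q p = 0" if "q \<in> P" for q
    using P(2)[OF that] complement_left[of p q] commute[of p q] by auto
  have nin: "p \<notin> P" using pq pp by force
  let ?P = "insert p P"
  have sum: "\<Sum>?P = e" using nin P(1,4) by (simp flip: P(4))
  have orth: "J q q' = 0" if "q \<in> ?P" "q' \<in> ?P" "q \<noteq> q'" for q q'
    using that pq P(3) by auto
  have prim: "primitive_idempotent J q" if "q \<in> ?P" for q using that P(2) p by auto
  have "real (card ?P) = real (jordan_rank J e)"
    using orthogonal_norm[of ?P] P(1) prim orth unit_norm unfolding sum by (metis finite_insert)
  hence card: "card ?P = jordan_rank J e" by simp
  then obtain n where n: "jordan_rank J e = Suc n" and cardP: "card P = n"
    using P(1) nin by simp
  obtain h where h: "bij_betw h {0..<n} P"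
    using ex_bij_betw_nat_finite[OF P(1)] cardP by blast
  define f where "f = (\<lambda>i. case i of 0 \<Rightarrow> p | Suc j \<Rightarrow> h j)"
  have "bij_betw f {..<jordan_rank J e} ?P"
  proof -
    have im: "h ` {..<n} = P" "inj_on h {..<n}" using h by (auto simp: bij_betw_def lessThan_atLeast0)
    have "f ` {..<Suc n} = ?P"
      unfolding lessThan_Suc_eq_insert_0 using im by (auto simp: f_def image_image)
    moreover have "inj_on f {..<Suc n}"
      unfolding lessThan_Suc_eq_insert_0 using im nin
      by (auto simp: f_def inj_on_def)
    ultimately show ?thesis by (simp add: bij_betw_def n)
  qed
  note bij = this
  have mem: "f i \<in> ?P" if "i < jordan_rank J e" for i
    using bij that by (auto simp: bij_betw_def)
  have neq: "f i \<noteq> f j" if "i < jordan_rank J e" "j < jordan_rank J e" "i \<noteq> j" for i j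
    using bij that by (auto simp: bij_betw_def inj_on_def)
  have "(\<Sum>i<jordan_rank J e. f i) = (\<Sum>q\<in>?P. q)"
    using sum.reindex_bij_betw[OF bij, of "\<lambda>q. q"] by simp
  hence "jordan_frame J e f"
    unfolding jordan_frame_def using mem neq orth prim sum by metis
  moreover have "f 0 = p" by (simp add: f_def)
  ultimately show thesis using that n by simp
qed

end

section \<open>The half space of a primitive idempotent\<close>

lemma dim_orthogonal_Union:
  fixes V :: "'i \<Rightarrow> 'a::euclidean_space set"
  assumes "finite I" "\<And>i j x y. i \<in> I \<Longrightarrow> j \<in> I \<Longrightarrow> i \<noteq> j \<Longrightarrow> x \<in> V i \<Longrightarrow> y \<in> V j \<Longrightarrow> x \<bullet> y = 0"
  shows "dim (\<Union>i\<in>I. V i) = (\<Sum>i\<in>I. dim (V i))"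
  using assms
proof (induction I rule: finite_induct)
  case (insert i I)
  have "dim (V i \<union> (\<Union>i\<in>I. V i)) = dim (V i) + dim (\<Union>i\<in>I. V i)"
    using insert.hyps insert.prems by (intro dim_orthogonal_sum) blast
  moreover have "dim (\<Union>i\<in>I. V i) = (\<Sum>i\<in>I. dim (V i))"
    using insert.prems by (intro insert.IH) blast
  ultimately show ?case using insert.hyps by simp
qed simp

context euclidean_jordan_algebra
begin

lemma subspace_peirce_half: "subspace (peirce_half c)"
  by (auto simp: peirce_half_def subspace_def prod_simps scaleR_add_right)

text \<open>
  The component of \<open>x\<close> in \<open>V\<^sub>1(q)\<close> is a multiple of \<open>q\<close>, and it lies in the half space of \<open>p\<close>
  because the two multiplications commute. As \<open>p q = 0\<close>, it vanishes.
\<close>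

lemma peirce_half_mult_complementary:
  assumes p: "primitive_idempotent J p" and q: "primitive_idempotent J q" and pq: "J p q = 0"
    and x: "x \<in> peirce_half p"
  shows "J q x \<in> peirce_half p \<inter> peirce_half q"
proof -
  note pp = primitive_idempotentD[OF p] and qq = primitive_idempotentD[OF q]
  have com: "J p (J q y) = J q (J p y)" for y
    by (rule idempotent_commutes) (use pp pq in auto)
  have px: "J p x = (1/2) *\<^sub>R x" using x by (simp add: peirce_half_def)
  have 1: "J q x \<in> peirce_half p"
    by (simp add: peirce_half_def com px prod_simps)
  define t where "t = (q \<bullet> x) / (q \<bullet> q)"
  have t: "2 *\<^sub>R J q (J q x) - J q x = t *\<^sub>R q"
    using quad_rep_primitive[OF q, of x] qq by (simp add: quad_rep_def t_def)
  have "J p (2 *\<^sub>R J q (J q x) - J q x) = (1/2) *\<^sub>R (2 *\<^sub>R J q (J q x) - J q x)"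
    by (simp add: prod_simps com px scaleR_diff_right)
  hence "t *\<^sub>R q = 0" unfolding t by (simp add: prod_simps pq)
  hence "2 *\<^sub>R J q (J q x) - J q x = 0" using t by simp
  hence "2 *\<^sub>R J q (J q x) = J q x" by simp
  hence "(1/2) *\<^sub>R (2 *\<^sub>R J q (J q x)) = (1/2) *\<^sub>R J q x" by simp
  thus ?thesis using 1 by (simp add: peirce_half_def)
qed

end

context trace_form
begin

text \<open>
  The half space is the orthogonal sum of the Peirce spaces \<open>V\<^sub>0\<^sub>j\<close> of a frame that starts with \<open>p\<close>.
\<close>

lemma dim_peirce_half:
  assumes p: "primitive_idempotent J p" and d: "peirce_invariant J e d"
  shows "dim (peirce_half p) = d * (jordan_rank J e - 1)"
proof -
  let ?r = "jordan_rank J e"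
  obtain f where f: "jordan_frame J e f" "f 0 = p" "?r > 0"
    using primitive_extends_to_frame[OF p] .
  have prim: "primitive_idempotent J (f i)" if "i < ?r" for i
    using f(1) that by (simp add: jordan_frame_def)
  note idem = primitive_idempotentD(1)[OF prim]
  have orth: "J (f i) (f j) = 0" if "i < ?r" "j < ?r" "i \<noteq> j" for i j
    using f(1) that by (simp add: jordan_frame_def)
  have sum: "(\<Sum>i<?r. f i) = e" using f(1) by (simp add: jordan_frame_def)
  define I where "I = {1..<?r}"
  let ?V = "\<lambda>j. peirce_space J f 0 j"
  have V_eq: "?V j = peirce_half p \<inter> peirce_half (f j)" for j
    by (auto simp: peirce_space_def peirce_half_def f(2))
  have dimV: "dim (?V j) = d" if "j \<in> I" for j
    using d f(1) that unfolding peirce_invariant_def I_def by auto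
  have ann: "J (f i) y = 0" if "i \<in> I" "j \<in> I" "i \<noteq> j" "y \<in> ?V j" for i j y
  proof -
    let ?c = "e - (p + f j)"
    have r: "i < ?r" "j < ?r" "i \<noteq> 0" "j \<noteq> 0" using that by (auto simp: I_def)
    have "J p (f j) = 0" "J (f j) p = 0" "J p p = p"
      using orth[of 0 j] orth[of j 0] r f idem[of 0] by auto
    hence "J (p + f j) (p + f j) = p + f j" using idem[OF r(2)] by (simp add: prod_simps)
    hence c: "J ?c ?c = ?c" by (rule idempotent_complement)
    have "J ?c (f i) = f i"
      unfolding complement_left using orth[of 0 i] orth[of j i] r f that(3) by (simp add: prod_simps)
    moreover have "J ?c y = 0"
      unfolding complement_left using that(4)
      by (simp add: prod_simps V_eq peirce_half_def flip: scaleR_left_distrib)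
    ultimately show ?thesis by (rule peirce_one_zero[OF c])
  qed
  have ort: "x \<bullet> y = 0" if "i \<in> I" "j \<in> I" "i \<noteq> j" "x \<in> ?V i" "y \<in> ?V j" for i j x y
  proof -
    have "J (f i) x \<bullet> y = 0" using ann[OF that(1-3,5)] by (simp add: inner_assoc)
    thus ?thesis using that(4) by (simp add: V_eq peirce_half_def)
  qed
  have "x \<in> span (\<Union>j\<in>I. ?V j)" if x: "x \<in> peirce_half p" for x
  proof -
    have r0: "{..<?r} = insert 0 I" using f(3) by (auto simp: I_def)
    have "x = (\<Sum>i<?r. J (f i) x)" by (simp add: sum unit flip: sum_left)
    also have "\<dots> = (1/2) *\<^sub>R x + (\<Sum>i\<in>I. J (f i) x)"
      unfolding r0 using x f(2) by (simp add: I_def peirce_half_def)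
    finally have "(1/2) *\<^sub>R x + (\<Sum>i\<in>I. J (f i) x) = (1/2) *\<^sub>R x + (1/2) *\<^sub>R x"
      by (simp flip: scaleR_left_distrib)
    hence "(1/2) *\<^sub>R x = (\<Sum>i\<in>I. J (f i) x)" by simp
    also have "\<dots> \<in> span (\<Union>j\<in>I. ?V j)"
    proof (intro span_sum span_base UN_I)
      fix i assume i: "i \<in> I"
      hence "i < ?r" "i \<noteq> 0" by (auto simp: I_def)
      thus "J (f i) x \<in> ?V i"
        unfolding V_eq using orth[of 0 i] f(2,3)
        by (intro peirce_half_mult_complementary[OF p prim _ x]) auto
    qed
    finally show ?thesis using span_scale[of "(1/2) *\<^sub>R x" _ 2] by simp
  qed
  moreover have "(\<Union>j\<in>I. ?V j) \<subseteq> peirce_half p" by (auto simp: V_eq)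
  ultimately have "span (\<Union>j\<in>I. ?V j) = peirce_half p"
    by (metis span_minimal subspace_peirce_half subset_antisym subsetI)
  hence "dim (peirce_half p) = dim (\<Union>j\<in>I. ?V j)" by (metis dim_span)
  also have "\<dots> = (\<Sum>j\<in>I. dim (?V j))"
    by (rule dim_orthogonal_Union) (use ort in \<open>auto simp: I_def\<close>)
  also have "\<dots> = d * (?r - 1)" using dimV by (simp add: I_def)
  finally show ?thesis .
qed

text \<open>
  Idempotents have norm at least one, so the eigenvalues of \<open>x\<close> are bounded by the norm of \<open>x\<close>.
\<close>

lemma spectral_bounds:
  shows "J x x \<bullet> x \<le> norm x ^ 3" and "norm x \<le> 1 \<Longrightarrow> e + x \<in> squares"
proof -
  obtain C \<tau> where C: "idempotent_system C" "x = (\<Sum>c\<in>C. \<tau> c *\<^sub>R c)"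
    by (rule exists_system)
  note CD = idempotent_systemD[OF C(1)]
  have inn: "(\<Sum>c\<in>C. f c *\<^sub>R c) \<bullet> c = f c * (c \<bullet> c)" if "c \<in> C" for c f
    by (rule orthogonal_sum_inner[where g = "\<lambda>c. c"]) (use CD that in auto)
  have inn2: "(\<Sum>c\<in>C. f c *\<^sub>R c) \<bullet> (\<Sum>c\<in>C. h c *\<^sub>R c) = (\<Sum>c\<in>C. f c * h c * (c \<bullet> c))" for f h
    unfolding inner_sum_right[of _ _ C] by (intro sum.cong) (simp_all add: inn mult_ac)
  have x2: "(norm x)\<^sup>2 = (\<Sum>c\<in>C. \<tau> c * \<tau> c * (c \<bullet> c))"
    unfolding power2_norm_eq_inner C(2) by (rule inn2)
  have bound: "\<bar>\<tau> c\<bar> \<le> norm x" if c: "c \<in> C" for c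
  proof -
    have "\<tau> c * \<tau> c * 1 \<le> \<tau> c * \<tau> c * (c \<bullet> c)"
      using idempotent_norm_ge_1[OF CD(2,3)[OF c]] by (intro mult_left_mono) auto
    also have "\<dots> \<le> (norm x)\<^sup>2"
      unfolding x2 by (rule member_le_sum[OF c]) (use CD(1) in auto)
    finally show ?thesis by (simp add: power2_eq_square[symmetric] abs_le_square_iff[symmetric])
  qed
  have xx: "J x x = (\<Sum>c\<in>C. (\<tau> c * \<tau> c) *\<^sub>R c)"
    unfolding C(2) by (rule orthogonal_square[where g = "\<lambda>c. c"]) (use CD in auto)
  have "J x x \<bullet> x = (\<Sum>c\<in>C. \<tau> c * \<tau> c * \<tau> c * (c \<bullet> c))"
    unfolding xx by (subst C(2)) (rule inn2)
  also have "\<dots> \<le> (\<Sum>c\<in>C. norm x * (\<tau> c * \<tau> c * (c \<bullet> c)))"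
  proof (rule sum_mono)
    fix c assume "c \<in> C"
    hence "\<tau> c * (\<tau> c * \<tau> c * (c \<bullet> c)) \<le> norm x * (\<tau> c * \<tau> c * (c \<bullet> c))"
      using bound by (intro mult_right_mono) (auto simp: abs_le_iff)
    thus "\<tau> c * \<tau> c * \<tau> c * (c \<bullet> c) \<le> norm x * (\<tau> c * \<tau> c * (c \<bullet> c))" by (simp add: mult_ac)
  qed
  also have "\<dots> = norm x * (norm x)\<^sup>2" by (simp add: x2 sum_distrib_left)
  also have "\<dots> = norm x ^ 3" by (simp add: power3_eq_cube power2_eq_square)
  finally show "J x x \<bullet> x \<le> norm x ^ 3" .
  assume x1: "norm x \<le> 1"
  have "e + x = (\<Sum>c\<in>C. (1 + \<tau> c) *\<^sub>R c)"
    using CD(5) by (simp add: C(2) scaleR_left_distrib sum.distrib)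
  moreover have "(\<Sum>c\<in>A. (1 + \<tau> c) *\<^sub>R c) \<in> squares" if "A \<subseteq> C" for A
    using finite_subset[OF that CD(1)] that
  proof (induction A rule: finite_induct)
    case (insert c A)
    hence "c \<in> C" by simp
    from bound[OF this] x1 have "1 + \<tau> c \<ge> 0" by linarith
    thus ?case
      using insert CD(2) by (simp add: squares_add squares_scale idempotent_in_squares)
  qed simp
  ultimately show "e + x \<in> squares" by simp
qed

text \<open>
  A vector \<open>v\<close> of the half space of \<open>p\<close> moves \<open>p\<close> to the point \<open>p + v + a\<close> of the cone, where
  \<open>a\<close> is the component of \<open>v\<^sup>2\<close> in the algebra orthogonal to \<open>p\<close>.
\<close>

definition half_square :: "'a \<Rightarrow> 'a \<Rightarrow> 'a" where
  "half_square p v = J v v - (v \<bullet> v / 2) *\<^sub>R p"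

text \<open>
  Comparing \<open>v\<^sup>2 v\<^sup>2\<close> with \<open>v (v v\<^sup>2)\<close> gives \<open>|a| = l\<close> and \<open>|v a|\<^sup>2 = \<langle>a\<^sup>2, a\<rangle> - l\<^sup>3/2\<close>. As the eigenvalues of
  \<open>a\<close> are at most \<open>l\<close>, this is at most \<open>l\<^sup>3/2\<close>. On the other hand \<open>\<langle>v a, v\<rangle> = l\<^sup>2\<close> and \<open>|v|\<^sup>2 = 2 l\<close>, so
  equality holds in the Cauchy--Schwarz inequality for \<open>v a\<close> and \<open>v\<close>.
\<close>

lemma half_square_relations:
  assumes p: "primitive_idempotent J p" and v: "v \<in> peirce_half p"
  defines "l \<equiv> v \<bullet> v / 2" and "a \<equiv> half_square p v"
  shows "J p a = 0" "a \<bullet> a = l\<^sup>2" "J v a = (l / 2) *\<^sub>R v" "J a a = l *\<^sub>R a" "J p (J v v) = l *\<^sub>R p"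
proof -
  note pp = primitive_idempotentD[OF p]
  have pn: "p \<bullet> p = 1" by (rule primitive_norm[OF p])
  have pv: "J p v = (1/2) *\<^sub>R v" using v by (simp add: peirce_half_def)
  have l0: "l \<ge> 0" by (simp add: l_def)
  have vv: "v \<bullet> v = 2 * l" by (simp add: l_def)
  obtain t where t: "J p (J v v) = t *\<^sub>R p"
    using peirce_one_primitive[OF p peirce_half_square[OF pp(1) v]] by blast
  have pvv: "p \<bullet> J v v = l"
    using square_inner_idempotent[of v p] by (simp add: pv l_def inner_commute)
  have "t = p \<bullet> J p (J v v)" using t pn by simp
  also have "\<dots> = p \<bullet> J v v" using inner_assoc[of p p "J v v"] pp(1) by simp
  finally have tl: "t = l" using pvv by simp
  show pvv': "J p (J v v) = l *\<^sub>R p" using t tl by simp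
  have vv_eq: "J v v = l *\<^sub>R p + a" by (simp add: a_def half_square_def l_def)
  show pa: "J p a = 0"
    using pvv' unfolding vv_eq by (simp add: prod_simps pp(1))
  have ap: "J a p = 0" using pa by (simp add: commute)
  have pa_inner: "p \<bullet> a = 0" using inner_eq_0_of_mult_eq_0[OF pp(1) pa] .
  have pow: "J (J v v) (J v v) = J v (J v (J v v))"
    using jordan_identity[of v v] by (simp add: commute[of "J v v" v])
  have nvv: "J v v \<bullet> J v v = l\<^sup>2 + a \<bullet> a"
    unfolding vv_eq by (simp add: inner_add_left inner_add_right pn pa_inner inner_commute[of a p] power2_eq_square)
  have "p \<bullet> J (J v v) (J v v) = J (J v v) p \<bullet> J v v" by (simp add: inner_assoc)
  also have "\<dots> = l\<^sup>2"
    using pvv pvv' by (simp add: commute[of _ p] power2_eq_square)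
  finally have 1: "p \<bullet> J (J v v) (J v v) = l\<^sup>2" .
  have "p \<bullet> J v (J v (J v v)) = J v p \<bullet> J v (J v v)" by (simp add: inner_assoc)
  also have "\<dots> = (v \<bullet> J v (J v v)) / 2" by (simp add: commute[of v p] pv)
  also have "v \<bullet> J v (J v v) = J v v \<bullet> J v v" by (simp add: inner_assoc)
  finally have "l\<^sup>2 = (l\<^sup>2 + a \<bullet> a) / 2" using 1 nvv pow by simp
  thus aa: "a \<bullet> a = l\<^sup>2" by simp
  have na: "norm a = l" using aa l0 by (simp add: norm_eq_sqrt_inner)
  have "J v (J v v) = (l/2) *\<^sub>R v + J v a"
    using arg_cong[OF vv_eq, of "J v"] by (simp add: prod_simps commute[of v p] pv)
  hence "J v (J v (J v v)) = (l/2) *\<^sub>R J v v + J v (J v a)"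
    by (simp add: prod_simps)
  hence vva: "J v (J v a) = l\<^sup>2 *\<^sub>R p + J a a - (l/2) *\<^sub>R J v v"
    unfolding pow[symmetric] by (simp add: vv_eq prod_simps pp(1) pa ap power2_eq_square)
  have "J v a \<bullet> v = a \<bullet> J v v" by (rule inner_assoc)
  hence va_v: "J v a \<bullet> v = l\<^sup>2"
    by (simp add: vv_eq inner_add_right aa inner_commute[of a p] pa_inner)
  have "J v a \<bullet> J v a = J v (J v a) \<bullet> a" by (simp add: inner_assoc)
  also have "\<dots> = J a a \<bullet> a - (l/2) * l\<^sup>2"
    unfolding vva vv_eq by (simp add: inner_add_left inner_diff_left pa_inner aa)
  also have "\<dots> \<le> l ^ 3 - (l/2) * l\<^sup>2" using spectral_bounds(1)[of a] na by simp
  finally have va_va: "J v a \<bullet> J v a \<le> l ^ 3 / 2" by (simp add: power3_eq_cube power2_eq_square)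
  have "(J v a - (l/2) *\<^sub>R v) \<bullet> (J v a - (l/2) *\<^sub>R v) =
    J v a \<bullet> J v a - l * (J v a \<bullet> v) + l\<^sup>2 / 4 * (v \<bullet> v)"
    by (simp add: inner_diff_left inner_diff_right inner_commute[of v "J v a"] power2_eq_square field_simps)
  also have "\<dots> \<le> 0"
    using va_va by (simp add: va_v vv power3_eq_cube power2_eq_square)
  finally have le: "(J v a - (l/2) *\<^sub>R v) \<bullet> (J v a - (l/2) *\<^sub>R v) \<le> 0" .
  have "(J v a - (l/2) *\<^sub>R v) \<bullet> (J v a - (l/2) *\<^sub>R v) = 0"
    by (rule order_antisym[OF le inner_ge_zero])
  thus va: "J v a = (l / 2) *\<^sub>R v" by (simp only: inner_eq_zero_iff right_minus_eq)
  have "(l/2) *\<^sub>R J v v = l\<^sup>2 *\<^sub>R p + J a a - (l/2) *\<^sub>R J v v"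
    using vva by (simp only: va prod_simps)
  hence "(l/2) *\<^sub>R J v v + (l/2) *\<^sub>R J v v = l\<^sup>2 *\<^sub>R p + J a a"
    by (simp only: eq_diff_eq)
  hence "l *\<^sub>R J v v = l\<^sup>2 *\<^sub>R p + J a a" by (simp flip: scaleR_left_distrib)
  thus "J a a = l *\<^sub>R a"
    unfolding vv_eq by (simp add: scaleR_add_right power2_eq_square)
qed

text \<open>
  The vector squares to \<open>1 + |v|\<^sup>2/2\<close> times itself.
\<close>

lemma orbit_in_squares:
  assumes p: "primitive_idempotent J p" and v: "v \<in> peirce_half p"
  shows "p + v + half_square p v \<in> squares"
proof -
  let ?a = "half_square p v" and ?l = "v \<bullet> v / 2"
  let ?q = "p + v + ?a"
  note pp = primitive_idempotentD[OF p] and F = half_square_relations[OF p v]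
  have pv: "J p v = (1/2) *\<^sub>R v" using v by (simp add: peirce_half_def)
  have vv: "J v v = ?l *\<^sub>R p + ?a" by (simp add: half_square_def)
  have half: "(1/2) *\<^sub>R x + (1/2) *\<^sub>R x = x" "(?l/2) *\<^sub>R x + (?l/2) *\<^sub>R x = ?l *\<^sub>R x" for x :: 'a
    by (simp_all flip: scaleR_left_distrib)
  have "J ?q ?q = p + ((1/2) *\<^sub>R v + (1/2) *\<^sub>R v) + J v v + ((?l/2) *\<^sub>R v + (?l/2) *\<^sub>R v) + ?l *\<^sub>R ?a"
    using F(1) commute[of v p] commute[of ?a p] commute[of ?a v]
    by (simp only: prod_simps F pp pv add_ac add_0_left add_0_right)
  also have "\<dots> = (1 + ?l) *\<^sub>R ?q"
    unfolding half vv by (simp add: algebra_simps)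
  finally have "J ?q ?q = (1 + ?l) *\<^sub>R ?q" .
  moreover have "1 + ?l > 0"
    using inner_ge_zero[of v] by linarith
  ultimately have "?q = inverse (1 + ?l) *\<^sub>R J ?q ?q" "inverse (1 + ?l) \<ge> 0" by auto
  thus ?thesis using squares_scale[OF square_in_squares] by metis
qed

end

section \<open>The diffusion parameter\<close>

context euclidean_jordan_algebra
begin

text \<open>
  For an idempotent \<open>c\<close>, \<open>Q(c,c)\<close> lies in the face of \<open>c\<close>, and there it agrees with \<open>Q(e,e)\<close> since the
  boundary condition removes all terms that contain \<open>e - c\<close>. This proves the identity at
  idempotents, and the defect \<open>D\<close> is a symmetric bilinear map. It vanishes at orthogonal
  idempotents \<open>g\<^sub>s\<close>, \<open>g\<^sub>t\<close> and at their sum, so the mixed values \<open>D(g\<^sub>s, g\<^sub>t)\<close> vanish too.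
\<close>

lemma boundary_form_eq_quad_rep:
  assumes bil: "bilinear Q" and sym: "\<And>u v. Q u v = Q v u" and pos: "\<And>v. Q v v \<in> squares"
    and bd: "\<And>u v x. u \<in> squares \<Longrightarrow> x \<in> squares \<Longrightarrow> u \<bullet> x = 0 \<Longrightarrow> x \<bullet> Q u v = 0"
  shows "Q u u = quad_rep J u (Q e e)"
proof -
  note Q_simps = bilinear_ladd[OF bil] bilinear_radd[OF bil] bilinear_lmul[OF bil]
    bilinear_rmul[OF bil] bilinear_lsub[OF bil] bilinear_rsub[OF bil]
  have idem: "Q c c = quad_rep J c (Q e e)" if c: "J c c = c" for c
  proof -
    have ec: "J (e - c) (e - c) = e - c" by (rule idempotent_complement[OF c])
    have oc: "J c (e - c) = 0" by (simp add: prod_simps c)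
    have sq: "c \<in> squares" "e - c \<in> squares" using c ec idempotent_in_squares by auto
    have ce: "c \<bullet> (e - c) = 0" by (rule inner_eq_0_of_mult_eq_0[OF c oc])
    have "Q c c \<bullet> (e - c) = 0" using bd[OF sq ce] by (simp add: inner_commute)
    hence Qc: "J c (Q c c) = Q c c" by (rule orthogonal_to_complement[OF c pos])
    define w where "w = Q e e - Q c c"
    have square: "J y y \<bullet> w = 0" if y: "J c y = y" for y
    proof -
      have "(e - c) \<bullet> J y y = 0"
        using inner_eq_0_of_mult_eq_0[OF ec, of "J y y"] peirce_one_mult[OF c y y]
        by (simp add: complement_left)
      hence z: "J y y \<bullet> Q (e - c) x = 0" for x by (intro bd sq square_in_squares)
      have "w = Q (e - c) e + Q (e - c) c"
        by (simp add: w_def Q_simps sym[of c e])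
      thus ?thesis by (simp add: inner_add_right z)
    qed
    have all: "y \<bullet> w = 0" if y: "J c y = y" for y
    proof -
      have "J (c + y) (c + y) \<bullet> w = 0" "J (c - y) (c - y) \<bullet> w = 0"
        by (intro square; simp add: prod_simps c y)+
      moreover have "J (c + y) (c + y) = c + y + y + J y y" "J (c - y) (c - y) = c - y - y + J y y"
        by (simp_all add: prod_simps c y commute[of y c])
      ultimately show ?thesis by (simp add: inner_add_left inner_diff_left)
    qed
    define z where "z = quad_rep J c w"
    have Jz: "J c z = z"
      using peirce_polynomial[OF c, of w] c
      by (simp add: z_def quad_rep_def prod_simps) (simp add: scaleR_left_distrib[of 2 1, simplified] scaleR_2)
    have m: "y \<bullet> J c y' = J c y \<bullet> y'" for y y' by (simp add: inner_assoc)
    have "z \<bullet> z = z \<bullet> (2 *\<^sub>R J c (J c w) - J c w)" by (subst (2) z_def) (simp add: quad_rep_def c)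
    also have "\<dots> = 2 * (z \<bullet> w) - z \<bullet> w"
      by (simp only: inner_diff_right inner_scaleR_right m Jz)
    also have "\<dots> = 0" using all[OF Jz] by simp
    finally have "z = 0" by simp
    moreover have "quad_rep J c (Q c c) = Q c c"
      by (simp add: quad_rep_def c Qc scaleR_2)
    ultimately show ?thesis
      by (simp add: z_def w_def quad_rep_def prod_simps algebra_simps)
  qed
  define A where "A = Q e e"
  define D where "D = (\<lambda>u v. Q u v - (J u (J v A) + J v (J u A) - J (J u v) A))"
  have Dlin: "D (\<Sum>t\<in>\<Lambda>. x t) v = (\<Sum>t\<in>\<Lambda>. D (x t) v)" "D v (\<Sum>t\<in>\<Lambda>. x t) = (\<Sum>t\<in>\<Lambda>. D v (x t))"
    for x :: "real \<Rightarrow> 'a" and \<Lambda> v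
  proof -
    have "linear (\<lambda>u. D u v)" "linear (\<lambda>u. D v u)" for v
      by (auto intro!: linearI simp: D_def prod_simps Q_simps algebra_simps)
    thus "D (\<Sum>t\<in>\<Lambda>. x t) v = (\<Sum>t\<in>\<Lambda>. D (x t) v)" "D v (\<Sum>t\<in>\<Lambda>. x t) = (\<Sum>t\<in>\<Lambda>. D v (x t))"
      using linear_sum[of "\<lambda>u. D u v" x \<Lambda>] linear_sum[of "\<lambda>u. D v u" x \<Lambda>] by auto
  qed
  have Dscale: "D (s *\<^sub>R x) (t *\<^sub>R y) = (s * t) *\<^sub>R D x y" for s t x y
    by (simp add: D_def prod_simps Q_simps algebra_simps)
  have Dquad: "D x x = Q x x - quad_rep J x A" for x
    by (simp add: D_def quad_rep_def scaleR_2)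
  obtain \<Lambda> g where g: "finite \<Lambda>" "\<And>t. t \<in> \<Lambda> \<Longrightarrow> J (g t) (g t) = g t"
    "\<And>s t. s \<in> \<Lambda> \<Longrightarrow> t \<in> \<Lambda> \<Longrightarrow> s \<noteq> t \<Longrightarrow> J (g s) (g t) = 0" "u = (\<Sum>t\<in>\<Lambda>. t *\<^sub>R g t)"
    using spectral_theorem[of u] by blast
  have D0: "D c c = 0" if "J c c = c" for c
    using idem[OF that] by (simp add: Dquad A_def)
  have "D (g s) (g t) = 0" if "s \<in> \<Lambda>" "t \<in> \<Lambda>" for s t
  proof (cases "s = t")
    case False
    have "J (g s + g t) (g s + g t) = g s + g t"
      using g(2,3) that False by (auto simp: prod_simps)
    hence "D (g s + g t) (g s + g t) = 0" by (rule D0)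
    moreover have "D (g s + g t) (g s + g t) = D (g s) (g s) + D (g t) (g t) + (D (g s) (g t) + D (g s) (g t))"
      by (simp add: D_def prod_simps Q_simps sym[of "g t" "g s"] commute[of "g t" "g s"])
    ultimately have "2 *\<^sub>R D (g s) (g t) = 0" using g(2) that by (simp add: D0 scaleR_2)
    thus ?thesis by simp
  qed (use g(2) that D0 in auto)
  hence "D u u = 0" unfolding g(4) Dlin Dscale by simp
  thus ?thesis by (simp add: Dquad A_def)
qed

end

section \<open>Cone-valued measures\<close>

lemma nn_integral_linear_measure:
  assumes N1: "sets M1 = sets N" and N2: "sets M2 = sets N"
    and em: "\<And>A. A \<in> sets N \<Longrightarrow> emeasure N A = s * emeasure M1 A + t * emeasure M2 A"
    and f: "f \<in> borel_measurable N"
  shows "nn_integral N f = s * nn_integral M1 f + t * nn_integral M2 f"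
proof -
  note [measurable_cong] = N1 N2
  have sp: "space M1 = space N" "space M2 = space N"
    using N1 N2 by (auto dest: sets_eq_imp_space_eq)
  show ?thesis
    using f
  proof (induction f rule: borel_measurable_induct)
    case (cong f g)
    have "nn_integral N f = nn_integral N g" "nn_integral M1 f = nn_integral M1 g"
      "nn_integral M2 f = nn_integral M2 g"
      using cong.hyps sp by (auto intro!: nn_integral_cong)
    thus ?case using cong.IH by simp
  next
    case (set A)
    have "A \<in> sets M1" "A \<in> sets M2" using set N1 N2 by simp_all
    thus ?case using em[OF set] set by simp
  next
    case (mult u k)
    have m: "u \<in> borel_measurable M1" "u \<in> borel_measurable M2" using mult.hyps(2) by measurable
    show ?case
      using mult.hyps mult.IH m by (simp add: nn_integral_cmult distrib_left mult_ac)
  next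
    case (add u v)
    have m: "u \<in> borel_measurable M1" "u \<in> borel_measurable M2"
      "v \<in> borel_measurable M1" "v \<in> borel_measurable M2"
      using add.hyps(1,3) by measurable
    show ?case
      using add.hyps(1,3) add.IH m by (simp add: nn_integral_add distrib_left add_ac)
  next
    case (seq U)
    have m: "\<And>i. U i \<in> borel_measurable M1" "\<And>i. U i \<in> borel_measurable M2"
      using seq.hyps(1) by measurable
    have inc: "incseq (\<lambda>i. k * nn_integral M (U i))" for M :: "'a measure" and k
      using seq.hyps(3) by (auto intro!: nn_integral_mono mult_left_mono simp: incseq_def le_fun_def)
    have sup: "nn_integral M (SUP i. U i) = (SUP i. nn_integral M (U i))"
      if "\<And>i. U i \<in> borel_measurable M" for M
      using nn_integral_monotone_convergence_SUP[OF seq.hyps(3), of M] that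
      by (simp add: Sup_fun_def image_comp)
    have "nn_integral N (SUP i. U i) = (SUP i. s * nn_integral M1 (U i) + t * nn_integral M2 (U i))"
      using sup[of N] seq.hyps(1) seq.IH by simp
    also have "\<dots> = s * (SUP i. nn_integral M1 (U i)) + t * (SUP i. nn_integral M2 (U i))"
      unfolding SUP_mult_left_ennreal by (rule ennreal_SUP_add[OF inc inc])
    also have "\<dots> = s * nn_integral M1 (SUP i. U i) + t * nn_integral M2 (SUP i. U i)"
      using sup m by simp
    finally show ?case .
  qed
qed

text \<open>
  On a Borel subset of a member of the cover the measures are the pairings with one vector. A
  general set is cut along the disjointed cover.
\<close>

lemma cone_valued_measure_linear:
  fixes K :: "'a::euclidean_space set"
  assumes \<mu>: "cone_valued_measure K \<mu>" and dual: "\<And>x y. x \<in> K \<Longrightarrow> y \<in> K \<Longrightarrow> x \<bullet> y \<ge> 0"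
    and xy: "x \<in> K" "y \<in> K" "s *\<^sub>R x + t *\<^sub>R y \<in> K" and st: "s \<ge> 0" "t \<ge> 0"
    and A: "A \<in> sets (borel_on K)"
  shows "emeasure (\<mu> (s *\<^sub>R x + t *\<^sub>R y)) A = ennreal s * emeasure (\<mu> x) A + ennreal t * emeasure (\<mu> y) A"
proof -
  have sets: "sets (\<mu> z) = sets (borel_on K)" if "z \<in> K" for z
    using \<mu> that by (simp add: cone_valued_measure_def)
  have "\<exists>E :: nat \<Rightarrow> 'a set. range E \<subseteq> sets (borel_on K) \<and> (\<Union>n. E n) = K \<and>
      (\<forall>n. \<forall>A\<in>sets (borel_on K). A \<subseteq> E n \<longrightarrow>
        (\<exists>v\<in>K. \<forall>x\<in>K. emeasure (\<mu> x) A = ennreal (x \<bullet> v)))"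
    using \<mu> unfolding cone_valued_measure_def by (rule conjunct2)
  then obtain E :: "nat \<Rightarrow> 'a set" where E: "range E \<subseteq> sets (borel_on K)" "(\<Union>n. E n) = K"
    and val: "\<forall>n. \<forall>A\<in>sets (borel_on K). A \<subseteq> E n \<longrightarrow>
        (\<exists>v\<in>K. \<forall>x\<in>K. emeasure (\<mu> x) A = ennreal (x \<bullet> v))"
    by (elim exE conjE) (rule that)
  define D where "D = (\<lambda>n. A \<inter> disjointed E n)"
  have "range (disjointed E) \<subseteq> sets (borel_on K)"
    using E(1) by (rule sets.range_disjointed_sets)
  hence D: "D n \<in> sets (borel_on K)" for n using A by (auto simp: D_def)
  have dis: "disjoint_family D"
    using disjoint_family_disjointed[of E] by (auto simp: disjoint_family_on_def D_def)
  have "A \<subseteq> K" using sets.sets_into_space[OF A] by (simp add: space_restrict_space)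
  hence UN: "(\<Union>n. D n) = A"
    using UN_disjointed_eq[of E] E(2) by (auto simp: D_def)
  have em: "emeasure (\<mu> z) A = (\<Sum>n. emeasure (\<mu> z) (D n))" if "z \<in> K" for z
    using suminf_emeasure[of D "\<mu> z"] D dis sets[OF that] UN by (auto simp: image_subset_iff)
  have "emeasure (\<mu> (s *\<^sub>R x + t *\<^sub>R y)) (D n) =
    ennreal s * emeasure (\<mu> x) (D n) + ennreal t * emeasure (\<mu> y) (D n)" for n
  proof -
    have "D n \<subseteq> E n" using disjointed_subset[of E n] by (auto simp: D_def)
    then obtain v where v: "v \<in> K" "\<And>x. x \<in> K \<Longrightarrow> emeasure (\<mu> x) (D n) = ennreal (x \<bullet> v)"
      using val[rule_format, OF D] by blast
    show ?thesis
      using v xy st dual by (simp add: inner_add_left ennreal_plus ennreal_mult)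
  qed
  hence "emeasure (\<mu> (s *\<^sub>R x + t *\<^sub>R y)) A =
    (\<Sum>n. ennreal s * emeasure (\<mu> x) (D n) + ennreal t * emeasure (\<mu> y) (D n))"
    using em[OF xy(3)] by simp
  also have "\<dots> = (\<Sum>n. ennreal s * emeasure (\<mu> x) (D n)) + (\<Sum>n. ennreal t * emeasure (\<mu> y) (D n))"
    by (intro suminf_add[symmetric] summableI)
  also have "\<dots> = ennreal s * emeasure (\<mu> x) A + ennreal t * emeasure (\<mu> y) A"
    by (simp only: ennreal_suminf_cmult em[OF xy(1)] em[OF xy(2)])
  finally show ?thesis .
qed

locale jordan_parameters =
  trace_form J e tr + admissible_parameters "cone_of_squares J" h Q b B c \<gamma> m \<mu>
  for J :: "'a::euclidean_space \<Rightarrow> 'a \<Rightarrow> 'a" and e tr h Q b B c \<gamma> m \<mu> +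
  assumes simple: "jordan_ideal J I \<Longrightarrow> I = {0} \<or> I = UNIV"
    and truncation: "truncation_function h"
begin

lemma sets_\<mu> [measurable_cong]: "x \<in> squares \<Longrightarrow> sets (\<mu> x) = sets (borel_on squares)"
  using \<mu>_measure by (simp add: cone_valued_measure_def)

lemma space_\<mu>: "x \<in> squares \<Longrightarrow> space (\<mu> x) = squares"
  using sets_eq_imp_space_eq[OF sets_\<mu>] by (simp add: space_restrict_space)

lemma measurable_\<mu>:
  "x \<in> squares \<Longrightarrow> f \<in> measurable borel N \<Longrightarrow> f \<in> measurable (\<mu> x) N"
  using measurable_cong_sets[OF sets_\<mu> refl] measurable_restrict_space1 by blast

lemma nn_integral_\<mu>_linear:
  assumes "x \<in> squares" "y \<in> squares" "s \<ge> 0" "t \<ge> 0" and f: "f \<in> borel_measurable borel"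
  shows "(\<integral>\<^sup>+\<xi>. f \<xi> \<partial>\<mu> (s *\<^sub>R x + t *\<^sub>R y)) =
    ennreal s * (\<integral>\<^sup>+\<xi>. f \<xi> \<partial>\<mu> x) + ennreal t * (\<integral>\<^sup>+\<xi>. f \<xi> \<partial>\<mu> y)"
proof -
  have z: "s *\<^sub>R x + t *\<^sub>R y \<in> squares" using assms by (intro squares_add squares_scale)
  show ?thesis
    by (rule nn_integral_linear_measure)
       (use assms z cone_valued_measure_linear[OF \<mu>_measure squares_inner_nonneg assms(1,2) z]
         sets_\<mu> in \<open>auto intro: measurable_\<mu>\<close>)
qed

section \<open>Integrability of the linear jump measure\<close>

text \<open>
  Near the origin the truncation function is the identity, and away from it the second moment
  condition dominates.
\<close>

lemma boundary_integrable:
  assumes u: "u \<in> squares" and x: "x \<in> squares" and ux: "u \<bullet> x = 0"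
  shows "(\<integral>\<^sup>+\<xi>. ennreal (min (u \<bullet> \<xi>) 1) \<partial>\<mu> x) < \<infinity>"
proof -
  obtain \<delta> where \<delta>: "\<delta> > 0" "\<And>\<xi>. norm \<xi> < \<delta> \<Longrightarrow> h \<xi> = \<xi>"
    using truncation by (auto simp: truncation_function_def)
  define C where "C = 1 / min (\<delta>\<^sup>2) 1"
  have C: "C > 0" using \<delta>(1) by (simp add: C_def)
  have hm: "h \<in> borel_measurable borel"
    using truncation by (intro borel_measurable_continuous_onI) (simp add: truncation_function_def)
  have le: "min (u \<bullet> \<xi>) 1 \<le> norm (h \<xi> \<bullet> u) + C * min ((norm \<xi>)\<^sup>2) 1" for \<xi>
  proof (cases "norm \<xi> < \<delta>")
    case True
    have "0 \<le> C * min ((norm \<xi>)\<^sup>2) 1" using C by simp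
    moreover have "min (u \<bullet> \<xi>) 1 \<le> norm (h \<xi> \<bullet> u)"
      using \<delta>(2)[OF True] by (auto simp: inner_commute[of \<xi> u] min_def)
    ultimately show ?thesis by linarith
  next
    case False
    hence "\<delta>\<^sup>2 \<le> (norm \<xi>)\<^sup>2" using \<delta>(1) by (intro power_mono) auto
    hence "C * min (\<delta>\<^sup>2) 1 \<le> C * min ((norm \<xi>)\<^sup>2) 1"
      using C by (intro mult_left_mono) (auto simp: min_def)
    moreover have "C * min (\<delta>\<^sup>2) 1 = 1" using \<delta>(1) by (simp add: C_def min_def)
    moreover have "min (u \<bullet> \<xi>) 1 \<le> 1" "norm (h \<xi> \<bullet> u) \<ge> 0" by simp_all
    ultimately show ?thesis by linarith
  qed
  have "(\<integral>\<^sup>+\<xi>. ennreal (min (u \<bullet> \<xi>) 1) \<partial>\<mu> x) \<le>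
    (\<integral>\<^sup>+\<xi>. ennreal (norm (h \<xi> \<bullet> u)) + ennreal C * ennreal (min ((norm \<xi>)\<^sup>2) 1) \<partial>\<mu> x)"
    using le C by (intro nn_integral_mono) (simp add: ennreal_mult[symmetric] ennreal_plus[symmetric] ennreal_leI del: ennreal_plus)
  also have "\<dots> = (\<integral>\<^sup>+\<xi>. ennreal (norm (h \<xi> \<bullet> u)) \<partial>\<mu> x) +
      ennreal C * (\<integral>\<^sup>+\<xi>. ennreal (min ((norm \<xi>)\<^sup>2) 1) \<partial>\<mu> x)"
    using hm by (subst nn_integral_add) (auto intro!: measurable_\<mu>[OF x] simp: nn_integral_cmult measurable_\<mu>[OF x])
  also have "\<dots> < \<infinity>"
    using \<mu>_boundary[OF u x ux] \<mu>_integrable[OF x]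
    by (simp add: integrable_iff_bounded ennreal_mult_less_top)
  finally show ?thesis .
qed

text \<open>
  Without a half space the line through \<open>p\<close> would be an ideal.
\<close>

lemma exists_peirce_half:
  assumes p: "primitive_idempotent J p" and dim: "DIM('a) > 2"
  shows "\<exists>v\<in>peirce_half p. v \<bullet> v = 2"
proof -
  note pp = primitive_idempotentD[OF p]
  have "\<exists>v\<in>peirce_half p. v \<noteq> 0"
  proof (rule ccontr)
    assume no: "\<not> (\<exists>v\<in>peirce_half p. v \<noteq> 0)"
    have line: "\<exists>t. J p x = t *\<^sub>R p" for x
    proof -
      have p3: "J p (J p (J p x)) = (3/2) *\<^sub>R J p (J p x) - (1/2) *\<^sub>R J p x"
        using arg_cong[OF peirce_polynomial[OF pp(1), of x], of "scaleR (1/2)"]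
        by (simp add: scaleR_diff_right)
      have "J p x - J p (J p x) \<in> peirce_half p"
        using scaleR_left_distrib[of 1 "1/2" "J p (J p x)"]
        by (simp add: peirce_half_def prod_simps p3 algebra_simps)
      hence "J p (J p x) = J p x" using no by auto
      thus ?thesis by (rule peirce_one_primitive[OF p])
    qed
    have "jordan_ideal J (span {p})"
      unfolding jordan_ideal_def
    proof (intro conjI allI ballI)
      fix x y assume "y \<in> span {p}"
      then obtain s where "y = s *\<^sub>R p" by (auto simp: span_singleton)
      moreover obtain t where "J p x = t *\<^sub>R p" using line by blast
      ultimately show "J x y \<in> span {p}"
        by (simp add: prod_simps commute[of x p] span_scale span_base)
    qed simp
    moreover have "span {p} \<noteq> {0}" using pp(2) span_base[of p "{p}"] by auto
    ultimately have "span {p} = UNIV" using simple by blast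
    hence "DIM('a) \<le> card {p}"
      by (metis dim_UNIV dim_le_card finite.emptyI finite.insertI order_refl)
    thus False using dim by simp
  qed
  then obtain v where v: "v \<in> peirce_half p" "v \<noteq> 0" by blast
  have "(sqrt 2 / norm v) *\<^sub>R v \<in> peirce_half p"
    using v(1) subspace_peirce_half by (simp add: subspace_scale)
  moreover have "((sqrt 2 / norm v) *\<^sub>R v) \<bullet> ((sqrt 2 / norm v) *\<^sub>R v) =
      (sqrt 2)\<^sup>2 / (norm v)\<^sup>2 * (norm v)\<^sup>2"
    by (simp only: inner_scaleR_left inner_scaleR_right dot_square_norm) (simp add: power2_eq_square)
  moreover have "\<dots> = 2" using v(2) by simp
  ultimately show ?thesis by metis
qed

text \<open>
  Write \<open>f = p + a\<close>. The positivity of \<open>p + s v + s\<^sup>2 a\<close> in \<open>s\<close> gives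
  \<open>\<langle>\<xi>, v\<rangle>\<^sup>2 + \<langle>\<xi>, p - a\<rangle>\<^sup>2 \<le> \<langle>\<xi>, f\<rangle>\<^sup>2\<close>. Hence one of the two terms on the left is at most
  \<open>(3/4)\<^sup>2 \<langle>\<xi>, f\<rangle>\<^sup>2\<close>, as \<open>2 (3/4)\<^sup>2 > 1\<close>. If it is the first, then \<open>\<langle>\<xi>, f\<rangle>\<close> is comparable with both of
  \<open>\<langle>\<xi>, f \<plusminus> v\<rangle>\<close>; if it is the second, with both of \<open>\<langle>\<xi>, p\<rangle>\<close> and \<open>\<langle>\<xi>, a\<rangle>\<close>. In each case the boundary
  condition for an orthogonal pair that sums to a multiple of \<open>f\<close> bounds the integral against \<open>\<mu> f\<close>, which
  dominates \<open>\<mu> p\<close>. The pairing with \<open>e - p\<close> is covered by the boundary condition at \<open>p\<close>.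
\<close>

lemma primitive_integrable:
  assumes p: "primitive_idempotent J p" and dim: "DIM('a) > 2"
  shows "(\<integral>\<^sup>+\<xi>. ennreal (min (e \<bullet> \<xi>) 1) \<partial>\<mu> p) < \<infinity>"
proof -
  note pp = primitive_idempotentD[OF p]
  have pn: "p \<bullet> p = 1" by (rule primitive_norm[OF p])
  obtain v where v: "v \<in> peirce_half p" "v \<bullet> v = 2" using exists_peirce_half[OF p dim] by blast
  define a where "a = half_square p v"
  define f where "f = p + a"
  have scaled: "s *\<^sub>R v \<in> peirce_half p" for s
    using v(1) subspace_peirce_half by (simp add: subspace_scale)
  have a_scaled: "half_square p (s *\<^sub>R v) = s\<^sup>2 *\<^sub>R a" for s
    by (simp add: half_square_def a_def v(2) prod_simps power2_eq_square scaleR_diff_right)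
  have orbit: "p + s *\<^sub>R v + s\<^sup>2 *\<^sub>R a \<in> squares" for s
    using orbit_in_squares[OF p scaled] by (simp add: a_scaled)
  have fv: "f + v \<in> squares" "f - v \<in> squares"
    using orbit[of 1] orbit[of "-1"] by (simp_all add: f_def algebra_simps)
  have F: "J p a = 0" "a \<bullet> a = 1" "J a a = a"
    using half_square_relations[OF p v(1)] v(2) by (simp_all add: a_def)
  have sq: "p \<in> squares" "a \<in> squares" "f \<in> squares" "e - p \<in> squares"
    using pp F(3) idempotent_in_squares idempotent_complement squares_add by (auto simp: f_def)
  have pa: "p \<bullet> a = 0" by (rule inner_eq_0_of_mult_eq_0[OF pp(1) F(1)])
  have orth: "(f + v) \<bullet> (f - v) = 0"
    by (simp add: f_def inner_add_left inner_add_right inner_diff_right pn F pa v(2)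
        inner_commute[of a p] inner_commute[of v p] inner_commute[of v a])
  hence orth': "(f - v) \<bullet> (f + v) = 0" by (simp only: inner_commute)
  have ap: "a \<bullet> p = 0" using pa by (simp only: inner_commute)
  have pe: "(e - p) \<bullet> p = 0"
    using inner_eq_0_of_mult_eq_0[OF pp(1), of "e - p"] by (simp add: prod_simps pp(1) inner_commute)
  have im [measurable]: "(\<bullet>) u \<in> borel_measurable borel" for u :: 'a
    by (rule borel_measurable_continuous_onI[OF linear_continuous_on[OF bounded_linear_inner_right]])
  define \<phi> where "\<phi> = (\<lambda>u (\<xi>::'a). ennreal (min (u \<bullet> \<xi>) 1))"
  have \<phi>m [measurable]: "\<phi> u \<in> borel_measurable borel" for u unfolding \<phi>_def by measurable
  have fin: "(\<integral>\<^sup>+\<xi>. \<phi> u \<xi> \<partial>\<mu> x) < \<infinity>" if "u \<in> squares" "x \<in> squares" "u \<bullet> x = 0" for u x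
    unfolding \<phi>_def using boundary_integrable[OF that] .
  \<comment> \<open>The jumps on which \<open>\<langle>\<xi>, f\<rangle>\<close> is comparable with both of \<open>\<langle>\<xi>, f \<plusminus> v\<rangle>\<close>.\<close>
  define R where "R = {\<xi>. \<bar>v \<bullet> \<xi>\<bar> \<le> (3/4) * (f \<bullet> \<xi>)}"
  have Rm [measurable]: "R \<in> sets borel" unfolding R_def by measurable
  have comp: "\<phi> f \<xi> \<le> 8 * \<phi> u \<xi>" if "f \<bullet> \<xi> \<le> 8 * (u \<bullet> \<xi>)" "u \<bullet> \<xi> \<ge> 0" for u \<xi>
  proof -
    have "min (f \<bullet> \<xi>) 1 \<le> 8 * min (u \<bullet> \<xi>) 1" using that by (auto simp: min_def)
    hence "ennreal (min (f \<bullet> \<xi>) 1) \<le> ennreal (8 * min (u \<bullet> \<xi>) 1)" by (rule ennreal_leI)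
    also have "\<dots> = 8 * \<phi> u \<xi>" using that by (simp add: \<phi>_def ennreal_mult)
    finally show ?thesis by (simp add: \<phi>_def)
  qed
  \<comment> \<open>The quadratic polynomial \<open>s \<mapsto> \<langle>\<xi>, p + s v + s\<^sup>2 a\<rangle>\<close> is nonnegative.\<close>
  have disc: "(v \<bullet> \<xi>)\<^sup>2 \<le> 4 * (p \<bullet> \<xi>) * (a \<bullet> \<xi>)" if \<xi>: "\<xi> \<in> squares" for \<xi>
  proof -
    have poly: "p \<bullet> \<xi> + s * (v \<bullet> \<xi>) + s\<^sup>2 * (a \<bullet> \<xi>) \<ge> 0" for s
      using squares_inner_nonneg[OF orbit \<xi>, of s] by (simp add: inner_add_left)
    have a0: "a \<bullet> \<xi> \<ge> 0" "p \<bullet> \<xi> \<ge> 0" using squares_inner_nonneg sq \<xi> by auto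
    show ?thesis
    proof (cases "a \<bullet> \<xi> = 0")
      case True
      have "v \<bullet> \<xi> = 0"
      proof (rule ccontr)
        assume n: "v \<bullet> \<xi> \<noteq> 0"
        thus False using poly[of "- (p \<bullet> \<xi> + 1) / (v \<bullet> \<xi>)"] True by simp
      qed
      thus ?thesis using True by simp
    next
      case False
      hence pos: "a \<bullet> \<xi> > 0" using a0 by simp
      have "0 \<le> 4 * (a \<bullet> \<xi>) * (p \<bullet> \<xi> + (- (v \<bullet> \<xi>) / (2 * (a \<bullet> \<xi>))) * (v \<bullet> \<xi>) +
          (- (v \<bullet> \<xi>) / (2 * (a \<bullet> \<xi>)))\<^sup>2 * (a \<bullet> \<xi>))"
        using poly[of "- (v \<bullet> \<xi>) / (2 * (a \<bullet> \<xi>))"] pos by (intro mult_nonneg_nonneg) auto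
      also have "\<dots> = 4 * (p \<bullet> \<xi>) * (a \<bullet> \<xi>) - (v \<bullet> \<xi>)\<^sup>2"
        using pos by (simp add: field_simps power2_eq_square)
      finally show ?thesis by simp
    qed
  qed
  have inR: "\<phi> f \<xi> \<le> 8 * \<phi> (f - v) \<xi>" "\<phi> f \<xi> \<le> 8 * \<phi> (f + v) \<xi>" if "\<xi> \<in> squares" "\<xi> \<in> R" for \<xi>
    using that fv squares_inner_nonneg[OF fv(1) that(1)] squares_inner_nonneg[OF fv(2) that(1)]
    by (intro comp; simp add: R_def inner_add_left inner_diff_left)+
  have outR: "\<phi> f \<xi> \<le> 8 * \<phi> a \<xi>" "\<phi> f \<xi> \<le> 8 * \<phi> p \<xi>" if \<xi>: "\<xi> \<in> squares" "\<xi> \<notin> R" for \<xi>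
  proof -
    let ?x = "p \<bullet> \<xi>" and ?y = "a \<bullet> \<xi>" and ?s = "f \<bullet> \<xi>"
    have s: "?s = ?x + ?y" by (simp add: f_def inner_add_left)
    have nn: "?x \<ge> 0" "?y \<ge> 0" using squares_inner_nonneg sq \<xi> by auto
    have "(3/4 * ?s)\<^sup>2 \<le> \<bar>v \<bullet> \<xi>\<bar>\<^sup>2"
      using \<xi>(2) nn s by (intro power_mono) (auto simp: R_def)
    moreover have ss: "(3/4 * ?s)\<^sup>2 = 9/16 * (?x + ?y)\<^sup>2"
      unfolding s power_mult_distrib by (simp add: power2_eq_square)
    ultimately have "9/16 * (?x + ?y)\<^sup>2 \<le> 4 * ?x * ?y"
      using disc[OF \<xi>(1)] by simp
    moreover have "(?x - ?y)\<^sup>2 = (?x + ?y)\<^sup>2 - 4 * ?x * ?y"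
      by (simp add: power2_eq_square algebra_simps)
    ultimately have q: "(?x - ?y)\<^sup>2 \<le> (3/4 * ?s)\<^sup>2"
      using zero_le_power2[of "?x + ?y"] unfolding ss by linarith
    have "\<bar>?x - ?y\<bar> \<le> 3/4 * ?s"
      by (rule power2_le_imp_le) (use q nn s in auto)
    thus "\<phi> f \<xi> \<le> 8 * \<phi> a \<xi>" "\<phi> f \<xi> \<le> 8 * \<phi> p \<xi>"
      using nn s by (intro comp; linarith)+
  qed
  have part: "(\<integral>\<^sup>+\<xi>. \<phi> f \<xi> * indicator A \<xi> \<partial>\<mu> x) < \<infinity>"
    if x: "x \<in> squares" and u: "u \<in> squares" "u \<bullet> x = 0" and A: "\<And>\<xi>. \<xi> \<in> squares \<Longrightarrow> \<xi> \<in> A \<Longrightarrow> \<phi> f \<xi> \<le> 8 * \<phi> u \<xi>"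
    for x u A
  proof -
    have "(\<integral>\<^sup>+\<xi>. \<phi> f \<xi> * indicator A \<xi> \<partial>\<mu> x) \<le> (\<integral>\<^sup>+\<xi>. 8 * \<phi> u \<xi> \<partial>\<mu> x)"
      using A by (intro nn_integral_mono) (auto simp: space_\<mu>[OF x] indicator_def)
    also have "\<dots> = 8 * (\<integral>\<^sup>+\<xi>. \<phi> u \<xi> \<partial>\<mu> x)"
      by (intro nn_integral_cmult measurable_\<mu>[OF x]) simp
    also have "\<dots> < \<infinity>" using fin[OF u(1) x u(2)] by (simp add: ennreal_mult_less_top)
    finally show ?thesis .
  qed
  have f1: "f = (1/2) *\<^sub>R (f + v) + (1/2) *\<^sub>R (f - v)"
    by (simp add: algebra_simps flip: scaleR_left_distrib)
  have comb: "ennreal s * A + ennreal t * B < \<infinity>" if "A < \<infinity>" "B < \<infinity>" for s t :: real and A B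
    using that by (simp add: ennreal_mult_less_top)
  have "(\<integral>\<^sup>+\<xi>. \<phi> f \<xi> * indicator R \<xi> \<partial>\<mu> ((1/2) *\<^sub>R (f + v) + (1/2) *\<^sub>R (f - v))) =
    ennreal (1/2) * (\<integral>\<^sup>+\<xi>. \<phi> f \<xi> * indicator R \<xi> \<partial>\<mu> (f + v)) +
    ennreal (1/2) * (\<integral>\<^sup>+\<xi>. \<phi> f \<xi> * indicator R \<xi> \<partial>\<mu> (f - v))"
    by (rule nn_integral_\<mu>_linear) (use fv in auto)
  also have "\<dots> < \<infinity>"
    by (rule comb[OF part[OF fv(1) fv(2) orth' inR(1)] part[OF fv(2) fv(1) orth inR(2)]])
  finally have "(\<integral>\<^sup>+\<xi>. \<phi> f \<xi> * indicator R \<xi> \<partial>\<mu> f) < \<infinity>" unfolding f1[symmetric] .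
  moreover have "(\<integral>\<^sup>+\<xi>. \<phi> f \<xi> * indicator (- R) \<xi> \<partial>\<mu> f) < \<infinity>"
  proof -
    have "(\<integral>\<^sup>+\<xi>. \<phi> f \<xi> * indicator (- R) \<xi> \<partial>\<mu> (1 *\<^sub>R p + 1 *\<^sub>R a)) =
      ennreal 1 * (\<integral>\<^sup>+\<xi>. \<phi> f \<xi> * indicator (- R) \<xi> \<partial>\<mu> p) +
      ennreal 1 * (\<integral>\<^sup>+\<xi>. \<phi> f \<xi> * indicator (- R) \<xi> \<partial>\<mu> a)"
      by (rule nn_integral_\<mu>_linear) (use sq in auto)
    also have "\<dots> < \<infinity>"
      by (rule comb[OF part[OF sq(1) sq(2) ap] part[OF sq(2) sq(1) pa]]) (use outR in auto)
    finally show ?thesis by (simp add: f_def)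
  qed
  moreover have "(\<integral>\<^sup>+\<xi>. \<phi> f \<xi> \<partial>\<mu> f) =
      (\<integral>\<^sup>+\<xi>. \<phi> f \<xi> * indicator R \<xi> + \<phi> f \<xi> * indicator (- R) \<xi> \<partial>\<mu> f)"
    by (intro nn_integral_cong) (simp add: indicator_def)
  moreover have "\<dots> = (\<integral>\<^sup>+\<xi>. \<phi> f \<xi> * indicator R \<xi> \<partial>\<mu> f) + (\<integral>\<^sup>+\<xi>. \<phi> f \<xi> * indicator (- R) \<xi> \<partial>\<mu> f)"
    by (intro nn_integral_add measurable_\<mu>[OF sq(3)]) measurable
  ultimately have ff: "(\<integral>\<^sup>+\<xi>. \<phi> f \<xi> \<partial>\<mu> f) < \<infinity>" by simp
  have "(\<integral>\<^sup>+\<xi>. \<phi> f \<xi> \<partial>\<mu> (1 *\<^sub>R p + 1 *\<^sub>R a)) = (\<integral>\<^sup>+\<xi>. \<phi> f \<xi> \<partial>\<mu> p) + (\<integral>\<^sup>+\<xi>. \<phi> f \<xi> \<partial>\<mu> a)"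
    by (subst nn_integral_\<mu>_linear) (use sq in auto)
  hence fp: "(\<integral>\<^sup>+\<xi>. \<phi> f \<xi> \<partial>\<mu> p) < \<infinity>"
    using ff by (simp add: f_def)
  have "(\<integral>\<^sup>+\<xi>. \<phi> e \<xi> \<partial>\<mu> p) \<le> (\<integral>\<^sup>+\<xi>. \<phi> f \<xi> + \<phi> (e - p) \<xi> \<partial>\<mu> p)"
  proof (rule nn_integral_mono)
    fix \<xi> assume "\<xi> \<in> space (\<mu> p)"
    hence \<xi>: "\<xi> \<in> squares" by (simp add: space_\<mu> sq)
    have nn: "p \<bullet> \<xi> \<ge> 0" "a \<bullet> \<xi> \<ge> 0" "(e - p) \<bullet> \<xi> \<ge> 0"
      using squares_inner_nonneg sq \<xi> by auto
    have "min (e \<bullet> \<xi>) 1 \<le> min (f \<bullet> \<xi>) 1 + min ((e - p) \<bullet> \<xi>) 1"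
      using nn by (auto simp: f_def inner_add_left inner_diff_left min_def)
    hence "ennreal (min (e \<bullet> \<xi>) 1) \<le> ennreal (min (f \<bullet> \<xi>) 1 + min ((e - p) \<bullet> \<xi>) 1)"
      by (rule ennreal_leI)
    also have "\<dots> = \<phi> f \<xi> + \<phi> (e - p) \<xi>"
      unfolding \<phi>_def using nn by (intro ennreal_plus) (auto simp: f_def inner_add_left)
    finally show "\<phi> e \<xi> \<le> \<phi> f \<xi> + \<phi> (e - p) \<xi>" by (simp add: \<phi>_def)
  qed
  also have "\<dots> = (\<integral>\<^sup>+\<xi>. \<phi> f \<xi> \<partial>\<mu> p) + (\<integral>\<^sup>+\<xi>. \<phi> (e - p) \<xi> \<partial>\<mu> p)"
    by (intro nn_integral_add measurable_\<mu>[OF sq(1)]) measurable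
  also have "\<dots> < \<infinity>" using fp fin[OF sq(4,1) pe] by simp
  finally show ?thesis by (simp add: \<phi>_def)
qed

theorem linear_jump_measure_integrable:
  assumes dim: "DIM('a) > 2" and x: "x \<in> squares"
  shows "(\<integral>\<^sup>+\<xi>. ennreal (min (norm \<xi>) 1) \<partial>\<mu> x) < \<infinity>"
proof -
  let ?I = "\<lambda>x. (\<integral>\<^sup>+\<xi>. ennreal (min (e \<bullet> \<xi>) 1) \<partial>\<mu> x)"
  have lin: "?I (s *\<^sub>R y + t *\<^sub>R z) = ennreal s * ?I y + ennreal t * ?I z"
    if "y \<in> squares" "z \<in> squares" "s \<ge> 0" "t \<ge> 0" for s t y z
    by (rule nn_integral_\<mu>_linear) (use that in auto)
  have "?I x < \<infinity>"
    using x
  proof (induction rule: squares_induct)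
    case zero
    show ?case using lin[of e e 0 0] by simp
  next
    case (primitive p)
    show ?case by (rule primitive_integrable[OF primitive dim])
  next
    case (add x y)
    thus ?case using lin[of x y 1 1] by simp
  next
    case (scale x t)
    thus ?case using lin[of x x t 0] by (simp add: ennreal_mult_less_top)
  qed
  obtain M where M: "M > 0" "\<And>x. x \<in> squares \<Longrightarrow> norm x \<le> M * (x \<bullet> e)"
    using norm_squares_bound by blast
  define M' where "M' = max M 1"
  have "(\<integral>\<^sup>+\<xi>. ennreal (min (norm \<xi>) 1) \<partial>\<mu> x) \<le> (\<integral>\<^sup>+\<xi>. ennreal M' * ennreal (min (e \<bullet> \<xi>) 1) \<partial>\<mu> x)"
  proof (rule nn_integral_mono)
    fix \<xi> assume "\<xi> \<in> space (\<mu> x)"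
    hence \<xi>: "\<xi> \<in> squares" by (simp add: space_\<mu> x)
    have nn: "e \<bullet> \<xi> \<ge> 0" using squares_inner_nonneg[OF unit_in_squares \<xi>] .
    have "norm \<xi> \<le> M * (e \<bullet> \<xi>)" using M(2)[OF \<xi>] by (simp add: inner_commute)
    also have "\<dots> \<le> M' * (e \<bullet> \<xi>)" using nn by (intro mult_right_mono) (auto simp: M'_def)
    finally have "min (norm \<xi>) 1 \<le> M' * min (e \<bullet> \<xi>) 1"
      by (auto simp: min_def M'_def)
    thus "ennreal (min (norm \<xi>) 1) \<le> ennreal M' * ennreal (min (e \<bullet> \<xi>) 1)"
      using nn by (simp add: ennreal_mult[symmetric] ennreal_leI M'_def)
  qed
  also have "\<dots> = ennreal M' * ?I x"
    by (intro nn_integral_cmult measurable_\<mu>[OF x]) simp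
  also have "\<dots> < \<infinity>" using \<open>?I x < \<infinity>\<close> by (simp add: ennreal_mult_less_top)
  finally show ?thesis .
qed

end

section \<open>Exponential sums\<close>

lemma one_minus_exp_bounds:
  fixes k :: real
  assumes "k \<ge> 0"
  shows "k * (1 - k) \<le> 1 - exp (- k)" "1 - exp (- k) \<le> k"
proof -
  have "exp (- k) * (1 + k) \<le> exp (- k) * exp k"
    by (intro mult_left_mono exp_ge_add_one_self) simp
  hence "exp (- k) * (1 + k) \<le> 1" by (simp flip: exp_add)
  also have "1 \<le> (1 - k + k\<^sup>2) * (1 + k)"
    using assms by (simp add: algebra_simps power2_eq_square)
  finally have "exp (- k) \<le> 1 - k + k\<^sup>2"
    using assms by (simp add: mult_le_cancel_right)
  thus "k * (1 - k) \<le> 1 - exp (- k)" by (simp add: power2_eq_square algebra_simps)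
  show "1 - exp (- k) \<le> k" using exp_ge_add_one_self[of "- k"] by simp
qed

lemma exp_second_difference_le:
  fixes z :: real
  shows "exp z + exp (- z) - 2 \<le> z\<^sup>2 * exp \<bar>z\<bar>"
proof -
  have pos: "exp t + exp (- t) - 2 \<le> t\<^sup>2 * exp t" if t: "t \<ge> 0" for t :: real
  proof -
    have "(1 - exp (- t))\<^sup>2 \<le> t\<^sup>2"
      using one_minus_exp_bounds(2)[OF t] t by (intro power_mono) auto
    hence "exp t * (1 - exp (- t))\<^sup>2 \<le> exp t * t\<^sup>2" by (intro mult_left_mono) auto
    moreover have "exp t * exp (- t) = 1" by (simp flip: exp_add)
    moreover have "exp t * (1 - exp (- t))\<^sup>2 =
        exp t - 2 * (exp t * exp (- t)) + (exp t * exp (- t)) * exp (- t)"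
      by (simp add: power2_eq_square algebra_simps)
    ultimately show ?thesis by (simp add: mult.commute)
  qed
  show ?thesis using pos[of z] pos[of "- z"] by (cases "z \<ge> 0") auto
qed

text \<open>
  The functions \<open>f = \<Sum> a\<^sub>i exp (- \<langle>u\<^sub>i, y\<rangle>)\<close> with \<open>u\<^sub>i\<close> in \<open>K\<close>, together with the moments
  \<open>k = \<Sum> a\<^sub>i\<close>, \<open>l = \<Sum> a\<^sub>i u\<^sub>i\<close> and \<open>s = \<Sum> a\<^sub>i q(u\<^sub>i, u\<^sub>i)\<close>. These are the value, minus the gradient and
  the trace of the Hessian against \<open>q\<close> at the origin. Keeping track of the moments instead of
  derivatives turns the Leibniz rule into algebra.
\<close>

inductive exp_sum ::
  "'a::euclidean_space set \<Rightarrow> ('a \<Rightarrow> 'a \<Rightarrow> real) \<Rightarrow> ('a \<Rightarrow> real) \<Rightarrow> real \<Rightarrow> 'a \<Rightarrow> real \<Rightarrow> bool"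
  for K q where
  exp: "u \<in> K \<Longrightarrow> exp_sum K q (\<lambda>y. exp (- (u \<bullet> y))) 1 u (q u u)"
| add: "exp_sum K q f k l s \<Longrightarrow> exp_sum K q f' k' l' s' \<Longrightarrow>
    exp_sum K q (\<lambda>y. f y + f' y) (k + k') (l + l') (s + s')"
| scale: "exp_sum K q f k l s \<Longrightarrow> exp_sum K q (\<lambda>y. t * f y) (t * k) (t *\<^sub>R l) (t * s)"

lemma exp_sum_eq:
  assumes "exp_sum K q f k l s" "\<And>y. g y = f y" "k' = k" "l' = l" "s' = s"
  shows "exp_sum K q g k' l' s'"
proof -
  have "g = f" using assms(2) by auto
  thus ?thesis using assms by simp
qed

lemma exp_sum_diff:
  assumes "exp_sum K q f k l s" "exp_sum K q f' k' l' s'"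
  shows "exp_sum K q (\<lambda>y. f y - f' y) (k - k') (l - l') (s - s')"
  by (rule exp_sum_eq[OF exp_sum.add[OF assms(1) exp_sum.scale[OF assms(2), of "-1"]]]) auto

lemma exp_sum_continuous: "exp_sum K q f k l s \<Longrightarrow> continuous_on UNIV f"
  by (induction rule: exp_sum.induct) (auto intro!: continuous_intros)

lemma exp_sum_zero: "exp_sum K q f k l s \<Longrightarrow> f 0 = k"
  by (induction rule: exp_sum.induct) auto

lemma exp_sum_bounded:
  assumes "exp_sum K q f k l s" and dual: "\<And>u v. u \<in> K \<Longrightarrow> v \<in> K \<Longrightarrow> u \<bullet> v \<ge> 0"
  shows "\<exists>C\<ge>0. \<forall>y. x + y \<in> K \<longrightarrow> \<bar>f y\<bar> \<le> C"
  using assms(1)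
proof (induction rule: exp_sum.induct)
  case (exp u)
  have "\<bar>exp (- (u \<bullet> y))\<bar> \<le> exp (u \<bullet> x)" if "x + y \<in> K" for y
    using dual[OF exp that] by (simp add: inner_add_right)
  thus ?case by (intro exI[of _ "exp (u \<bullet> x)"]) auto
next
  case (add f k l s f' k' l' s')
  then obtain C C' where "C \<ge> 0" "C' \<ge> 0" "\<forall>y. x + y \<in> K \<longrightarrow> \<bar>f y\<bar> \<le> C" "\<forall>y. x + y \<in> K \<longrightarrow> \<bar>f' y\<bar> \<le> C'"
    by blast
  thus ?case by (intro exI[of _ "C + C'"]) (auto intro: order_trans[OF abs_triangle_ineq] add_mono)
next
  case (scale f k l s t)
  then obtain C where "C \<ge> 0" "\<forall>y. x + y \<in> K \<longrightarrow> \<bar>f y\<bar> \<le> C" by blast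
  thus ?case by (intro exI[of _ "\<bar>t\<bar> * C"]) (auto simp: abs_mult intro: mult_left_mono)
qed

lemma exp_sum_lipschitz:
  assumes "exp_sum K q f k l s" and dual: "\<And>u v. u \<in> K \<Longrightarrow> v \<in> K \<Longrightarrow> u \<bullet> v \<ge> 0"
  shows "\<exists>C\<ge>0. \<forall>y\<in>K. \<bar>f y - k\<bar> \<le> C * min (norm y) 1"
  using assms(1)
proof (induction rule: exp_sum.induct)
  case (exp u)
  have "\<bar>exp (- (u \<bullet> y)) - 1\<bar> \<le> (norm u + 1) * min (norm y) 1" if y: "y \<in> K" for y
  proof -
    have nn: "u \<bullet> y \<ge> 0" by (rule dual[OF exp y])
    have "\<bar>exp (- (u \<bullet> y)) - 1\<bar> = 1 - exp (- (u \<bullet> y))" using nn by simp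
    moreover have "1 - exp (- (u \<bullet> y)) \<le> norm u * norm y"
      using one_minus_exp_bounds(2)[OF nn] norm_cauchy_schwarz[of u y] by linarith
    moreover have "1 - exp (- (u \<bullet> y)) \<le> 1" by simp
    moreover have "norm u * norm y \<le> (norm u + 1) * norm y" by (simp add: mult_right_mono)
    moreover have "(norm u + 1) * 1 \<ge> 1" by simp
    ultimately show ?thesis unfolding min_def by (split if_split) linarith
  qed
  thus ?case by (intro exI[of _ "norm u + 1"]) auto
next
  case (add f k l s f' k' l' s')
  then obtain C C' where C: "C \<ge> 0" "C' \<ge> 0" "\<forall>y\<in>K. \<bar>f y - k\<bar> \<le> C * min (norm y) 1"
    "\<forall>y\<in>K. \<bar>f' y - k'\<bar> \<le> C' * min (norm y) 1" by blast
  have "\<bar>f y + f' y - (k + k')\<bar> \<le> (C + C') * min (norm y) 1" if "y \<in> K" for y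
    using C(3,4)[rule_format, OF that] by (simp add: distrib_right)
  thus ?case using C by (intro exI[of _ "C + C'"]) auto
next
  case (scale f k l s t)
  then obtain C where C: "C \<ge> 0" "\<forall>y\<in>K. \<bar>f y - k\<bar> \<le> C * min (norm y) 1" by blast
  have "\<bar>t * f y - t * k\<bar> \<le> \<bar>t\<bar> * C * min (norm y) 1" if "y \<in> K" for y
    using mult_left_mono[OF C(2)[rule_format, OF that] abs_ge_zero[of t]]
    by (simp add: mult.assoc flip: abs_mult right_diff_distrib)
  thus ?case using C by (intro exI[of _ "\<bar>t\<bar> * C"]) auto
qed

locale exp_sum_algebra =
  fixes K :: "'a::euclidean_space set" and q :: "'a \<Rightarrow> 'a \<Rightarrow> real"
  assumes K_zero: "0 \<in> K" and K_add: "u \<in> K \<Longrightarrow> v \<in> K \<Longrightarrow> u + v \<in> K"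
    and q_bilinear: "bilinear q" and q_sym: "q u v = q v u"
begin

lemmas q_simps = bilinear_ladd[OF q_bilinear] bilinear_radd[OF q_bilinear]
  bilinear_lmul[OF q_bilinear] bilinear_rmul[OF q_bilinear]
  bilinear_lzero[OF q_bilinear] bilinear_rzero[OF q_bilinear]
  bilinear_lneg[OF q_bilinear] bilinear_rneg[OF q_bilinear]
  bilinear_lsub[OF q_bilinear] bilinear_rsub[OF q_bilinear]

lemma const: "exp_sum K q (\<lambda>_. t) t 0 0"
  by (rule exp_sum_eq[OF exp_sum.scale[OF exp_sum.exp[OF K_zero], of q t]]) (auto simp: q_simps)

text \<open>The Leibniz rule up to order two.\<close>

lemma mult:
  assumes "exp_sum K q f k l s" "exp_sum K q g k' l' s'"
  shows "exp_sum K q (\<lambda>y. f y * g y) (k * k') (k' *\<^sub>R l + k *\<^sub>R l') (s * k' + 2 * q l l' + k * s')"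
  using assms(1)
proof (induction rule: exp_sum.induct)
  case (exp u)
  show ?case
    using assms(2)
  proof (induction rule: exp_sum.induct)
    case (exp v)
    show ?case
      by (rule exp_sum_eq[OF exp_sum.exp[OF K_add[OF \<open>u \<in> K\<close> exp], of q]])
         (auto simp: q_simps q_sym[of v u] inner_add_left exp_add[symmetric])
  next
    case (add f k l s f' k' l' s')
    show ?case
      by (rule exp_sum_eq[OF exp_sum.add[OF add.IH]]) (auto simp: algebra_simps q_simps)
  next
    case (scale f k l s t)
    show ?case
      by (rule exp_sum_eq[OF exp_sum.scale[OF scale.IH, of t]]) (auto simp: algebra_simps q_simps)
  qed
next
  case (add f k l s f' k' l' s')
  show ?case
    by (rule exp_sum_eq[OF exp_sum.add[OF add.IH]]) (auto simp: algebra_simps q_simps)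
next
  case (scale f k l s t)
  show ?case
    by (rule exp_sum_eq[OF exp_sum.scale[OF scale.IH, of t]]) (auto simp: algebra_simps q_simps)
qed

lemma sum:
  assumes "finite A" "\<And>i. i \<in> A \<Longrightarrow> exp_sum K q (f i) (k i) (l i) (s i)"
  shows "exp_sum K q (\<lambda>y. \<Sum>i\<in>A. f i y) (\<Sum>i\<in>A. k i) (\<Sum>i\<in>A. l i) (\<Sum>i\<in>A. s i)"
  using assms
proof (induction A rule: finite_induct)
  case empty
  show ?case using const[of 0] by simp
next
  case (insert i A)
  show ?case
    by (rule exp_sum_eq[OF exp_sum.add[OF insert.prems[of i] insert.IH]]) (use insert in auto)
qed

lemma power:
  assumes "exp_sum K q f 1 0 s"
  shows "\<exists>s'. exp_sum K q (\<lambda>y. f y ^ n) 1 0 s'"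
proof (induction n)
  case 0
  show ?case using const[of 1] by auto
next
  case (Suc n)
  then obtain s' where "exp_sum K q (\<lambda>y. f y ^ n) 1 0 s'" by blast
  from exp_sum_eq[OF mult[OF assms this], of "\<lambda>y. f y ^ Suc n" 1 0] show ?case by auto
qed

lemma one_minus_exp:
  "u \<in> K \<Longrightarrow> exp_sum K q (\<lambda>y. 1 - exp (- (u \<bullet> y))) 0 (- u) (- q u u)"
  by (rule exp_sum_eq[OF exp_sum_diff[OF const[of 1] exp_sum.exp]]) auto

lemma square_vanishing:
  "exp_sum K q f 0 l s \<Longrightarrow> exp_sum K q (\<lambda>y. (f y)\<^sup>2) 0 0 (2 * q l l)"
  by (rule exp_sum_eq[OF mult]) (auto simp: power2_eq_square)

end

section \<open>The maximum principle\<close>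

locale jordan_affine_process =
  jordan_parameters J e tr h Q b B c \<gamma> m \<mu> +
  affine_parameters "cone_of_squares J" h Q b B c \<gamma> m \<mu> \<phi> \<psi> +
  affine_process "cone_of_squares J" p \<phi> \<psi>
  for J :: "'a::euclidean_space \<Rightarrow> 'a \<Rightarrow> 'a" and e tr h Q b B c \<gamma> m \<mu> \<phi> \<psi> p
begin

abbreviation diffusion_form :: "'a \<Rightarrow> 'a \<Rightarrow> 'a \<Rightarrow> real" where
  "diffusion_form x u v \<equiv> x \<bullet> Q u v"

lemma exp_sum_algebra: "exp_sum_algebra squares (diffusion_form x)"
proof
  show "bilinear (diffusion_form x)"
    unfolding bilinear_def
    by (auto intro!: linearI simp: bilinear_ladd[OF Q_bilinear] bilinear_radd[OF Q_bilinear]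
        bilinear_lmul[OF Q_bilinear] bilinear_rmul[OF Q_bilinear] inner_add_right)
qed (auto intro: squares_add simp: Q_sym)

lemma kernel_measure:
  assumes "t \<ge> 0" "x \<in> squares"
  shows "subprob_space (p t x)" "sets (p t x) = sets (borel_on squares)" "space (p t x) = squares"
proof -
  have x: "x \<in> space (borel_on squares)" using assms(2) by (simp add: space_restrict_space)
  show "subprob_space (p t x)" by (rule subprob_space_kernel[OF kernel[OF assms(1)] x])
  show s: "sets (p t x) = sets (borel_on squares)"
    using subprob_measurableD[OF kernel[OF assms(1)] x] by auto
  show "space (p t x) = squares"
    using sets_eq_imp_space_eq[OF s] by (simp add: space_restrict_space)
qed

lemma measurable_sets_eq:
  assumes "sets N = sets (borel_on squares)" "continuous_on UNIV f"
  shows "f \<in> borel_measurable N"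
  using measurable_cong_sets[OF assms(1) refl]
    measurable_restrict_space1[OF borel_measurable_continuous_onI[OF assms(2)]] by blast

lemma integrable_kernel:
  assumes f: "exp_sum squares q f k l s" and t: "t \<ge> 0" and x: "x \<in> squares"
  shows "integrable (p t x) (\<lambda>\<xi>. f (\<xi> - x))"
proof -
  interpret subprob_space "p t x" by (rule kernel_measure[OF t x])
  obtain C where C: "\<And>y. x + y \<in> squares \<Longrightarrow> \<bar>f y\<bar> \<le> C"
    using exp_sum_bounded[OF f squares_inner_nonneg, of x] by blast
  have "continuous_on UNIV (\<lambda>\<xi>. f (\<xi> - x))"
    by (rule continuous_on_compose2[OF exp_sum_continuous[OF f]]) (auto intro!: continuous_intros)
  hence "(\<lambda>\<xi>. f (\<xi> - x)) \<in> borel_measurable (p t x)"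
    by (rule measurable_sets_eq[OF kernel_measure(2)[OF t x]])
  moreover have "AE \<xi> in p t x. norm (f (\<xi> - x)) \<le> C"
    using C kernel_measure(3)[OF t x] by (intro AE_I2) auto
  ultimately show ?thesis by (intro integrable_const_bound)
qed

lemma integrable_min_norm:
  assumes N: "sets N = sets (borel_on squares)"
    and fin: "(\<integral>\<^sup>+\<xi>. ennreal (min (norm \<xi>) 1) \<partial>N) < \<infinity>"
  shows "integrable N (\<lambda>\<xi>. C * min (norm \<xi>) 1)"
proof (intro integrable_mult_right integrableI_bounded)
  show "(\<lambda>\<xi>::'a. min (norm \<xi>) 1) \<in> borel_measurable N"
    by (rule measurable_sets_eq[OF N]) (intro continuous_intros)
  show "(\<integral>\<^sup>+\<xi>. ennreal (norm (min (norm \<xi>) 1)) \<partial>N) < \<infinity>"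
    using fin by (simp add: min_def)
qed

lemma integrable_of_le_min_norm:
  fixes f :: "'a \<Rightarrow> real"
  assumes N: "sets N = sets (borel_on squares)"
    and fin: "(\<integral>\<^sup>+\<xi>. ennreal (min (norm \<xi>) 1) \<partial>N) < \<infinity>"
    and f: "continuous_on UNIV f" and le: "\<And>\<xi>. \<xi> \<in> squares \<Longrightarrow> \<bar>f \<xi>\<bar> \<le> C * min (norm \<xi>) 1"
  shows "integrable N f"
proof (rule Bochner_Integration.integrable_bound[OF integrable_min_norm[OF N fin, of C]])
  show "f \<in> borel_measurable N" by (rule measurable_sets_eq[OF N f])
  have "space N = squares" using sets_eq_imp_space_eq[OF N] by (simp add: space_restrict_space)
  thus "AE \<xi> in N. norm (f \<xi>) \<le> norm (C * min (norm \<xi>) 1)"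
    using order_trans[OF le abs_ge_self] by (intro AE_I2) simp
qed

lemma truncation_bound: "\<exists>C. \<forall>\<xi>. norm (h \<xi>) \<le> C * min (norm \<xi>) 1"
proof -
  obtain \<delta> where \<delta>: "\<delta> > 0" "\<And>\<xi>. norm \<xi> < \<delta> \<Longrightarrow> h \<xi> = \<xi>"
    using truncation by (auto simp: truncation_function_def)
  have h1: "norm (h \<xi>) \<le> 1" for \<xi> using truncation by (simp add: truncation_function_def)
  define C where "C = 1 / min \<delta> 1"
  have C: "C \<ge> 1" "C * min \<delta> 1 = 1" using \<delta>(1) by (auto simp: C_def min_def)
  have "norm (h \<xi>) \<le> C * min (norm \<xi>) 1" for \<xi>
  proof (cases "norm \<xi> < \<delta>")
    case True
    have "norm (h \<xi>) \<le> 1 * min (norm \<xi>) 1" using h1[of \<xi>] \<delta>(2)[OF True] by simp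
    also have "\<dots> \<le> C * min (norm \<xi>) 1" using C(1) by (intro mult_right_mono) auto
    finally show ?thesis .
  next
    case False
    hence "C * min \<delta> 1 \<le> C * min (norm \<xi>) 1"
      using C(1) by (intro mult_left_mono) (auto simp: min_def)
    thus ?thesis using h1[of \<xi>] C(2) by linarith
  qed
  thus ?thesis by blast
qed

lemma h_continuous: "continuous_on UNIV h"
  using truncation by (simp add: truncation_function_def)

text \<open>
  The generator of the process, applied to \<open>\<xi> \<mapsto> f (\<xi> - x)\<close> and evaluated at \<open>x\<close>; \<open>k\<close>, \<open>l\<close> and \<open>s\<close> stand
  for the moments of \<open>f\<close>.
\<close>

definition generator :: "'a \<Rightarrow> ('a \<Rightarrow> real) \<Rightarrow> real \<Rightarrow> 'a \<Rightarrow> real \<Rightarrow> real" where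
  "generator x f k l s = - (b \<bullet> l) - x \<bullet> adjoint B l + s / 2 - k * (c + \<gamma> \<bullet> x) +
    (\<integral>\<xi>. f \<xi> - k \<partial>m) + (\<integral>\<xi>. f \<xi> - k + h \<xi> \<bullet> l \<partial>\<mu> x)"

lemma exponential_derivative:
  assumes u: "u \<in> squares" and x: "x \<in> squares"
  shows "integrable (\<mu> x) (\<lambda>\<xi>. exp (- (u \<bullet> \<xi>)) - 1 + h \<xi> \<bullet> u)"
    and "((\<lambda>t. \<integral>\<xi>. exp (- (u \<bullet> (\<xi> - x))) \<partial>p t x) has_real_derivative
      generator x (\<lambda>y. exp (- (u \<bullet> y))) 1 u (diffusion_form x u u)) (at 0 within {0..})"
proof -
  obtain v where v: "has_cone_integral squares \<mu> (\<lambda>\<xi>. exp (- (u \<bullet> \<xi>)) - 1 + h \<xi> \<bullet> u) v"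
    and d\<psi>: "((\<lambda>t. \<psi> t u) has_vector_derivative
          (- (1/2) *\<^sub>R Q u u + adjoint B u + \<gamma> - v)) (at 0 within {0..})"
    using R[OF u] by blast
  show "integrable (\<mu> x) (\<lambda>\<xi>. exp (- (u \<bullet> \<xi>)) - 1 + h \<xi> \<bullet> u)"
    using v x by (simp add: has_cone_integral_def)
  have xv: "x \<bullet> v = (\<integral>\<xi>. exp (- (u \<bullet> \<xi>)) - 1 + h \<xi> \<bullet> u \<partial>\<mu> x)"
    using v x by (simp add: has_cone_integral_def)
  let ?F = "b \<bullet> u + c - (\<integral>\<xi>. exp (- (u \<bullet> \<xi>)) - 1 \<partial>m)"
  let ?R = "- (1/2) *\<^sub>R Q u u + adjoint B u + \<gamma> - v"
  have d\<phi>: "((\<lambda>t. \<phi> t u) has_real_derivative ?F) (at 0 within {0..})" by (rule F[OF u])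
  have d\<psi>x: "((\<lambda>t. \<psi> t u \<bullet> x) has_real_derivative ?R \<bullet> x) (at 0 within {0..})"
    using bounded_linear.has_vector_derivative[OF bounded_linear_inner_left d\<psi>]
    by (simp add: has_real_derivative_iff_has_vector_derivative)
  have form: "(\<integral>\<xi>. exp (- (u \<bullet> (\<xi> - x))) \<partial>p t x) = exp (u \<bullet> x) * exp (- \<phi> t u - \<psi> t u \<bullet> x)"
    if "t \<ge> 0" for t
  proof -
    have "(\<integral>\<xi>. exp (- (u \<bullet> (\<xi> - x))) \<partial>p t x) = (\<integral>\<xi>. exp (u \<bullet> x) * exp (- (u \<bullet> \<xi>)) \<partial>p t x)"
      by (simp add: inner_diff_right flip: exp_add)
    also have "\<dots> = exp (u \<bullet> x) * (\<integral>\<xi>. exp (- (u \<bullet> \<xi>)) \<partial>p t x)" by simp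
    finally show ?thesis using affine[OF that u x] by simp
  qed
  have sp: "x \<in> space (borel_on squares)" using x by (simp add: space_restrict_space)
  have "(\<integral>\<xi>. exp (- (u \<bullet> (\<xi> - x))) \<partial>p 0 x) = 1"
    unfolding start[OF x]
    by (subst integral_return[OF sp])
       (auto intro!: measurable_restrict_space1 borel_measurable_continuous_onI continuous_intros)
  hence at0: "exp (u \<bullet> x) * exp (- \<phi> 0 u - \<psi> 0 u \<bullet> x) = 1" using form[of 0] by simp
  have "((\<lambda>t. exp (u \<bullet> x) * exp (- \<phi> t u - \<psi> t u \<bullet> x)) has_real_derivative
      exp (u \<bullet> x) * (exp (- \<phi> 0 u - \<psi> 0 u \<bullet> x) * (- ?F - ?R \<bullet> x))) (at 0 within {0..})"
    by (intro DERIV_cmult DERIV_chain2[OF DERIV_exp] DERIV_diff DERIV_minus d\<phi> d\<psi>x)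
  also have "exp (u \<bullet> x) * (exp (- \<phi> 0 u - \<psi> 0 u \<bullet> x) * (- ?F - ?R \<bullet> x)) = - ?F - ?R \<bullet> x"
    unfolding mult.assoc[symmetric] at0 by simp
  also have "- ?F - ?R \<bullet> x = generator x (\<lambda>y. exp (- (u \<bullet> y))) 1 u (diffusion_form x u u)"
    unfolding generator_def xv[symmetric]
    by (simp add: inner_add_left inner_diff_left inner_commute[of x])
  finally show "((\<lambda>t. \<integral>\<xi>. exp (- (u \<bullet> (\<xi> - x))) \<partial>p t x) has_real_derivative
      generator x (\<lambda>y. exp (- (u \<bullet> y))) 1 u (diffusion_form x u u)) (at 0 within {0..})"
    by (rule has_field_derivative_transform_within[where d = 1]) (use form in auto)
qed

lemma exp_sum_derivative:
  assumes f: "exp_sum squares (diffusion_form x) f k l s" and x: "x \<in> squares"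
  shows "integrable m (\<lambda>\<xi>. f \<xi> - k) \<and> integrable (\<mu> x) (\<lambda>\<xi>. f \<xi> - k + h \<xi> \<bullet> l) \<and>
    ((\<lambda>t. \<integral>\<xi>. f (\<xi> - x) \<partial>p t x) has_real_derivative generator x f k l s) (at 0 within {0..})"
  using f
proof (induction rule: exp_sum.induct)
  case (exp u)
  note E = exp_sum.exp[OF exp, of "diffusion_form x"]
  obtain C where "\<forall>\<xi>\<in>squares. \<bar>exp (- (u \<bullet> \<xi>)) - 1\<bar> \<le> C * min (norm \<xi>) 1"
    using exp_sum_lipschitz[OF E squares_inner_nonneg] by blast
  hence "integrable m (\<lambda>\<xi>. exp (- (u \<bullet> \<xi>)) - 1)"
    using m_sets m_integrable by (intro integrable_of_le_min_norm) (auto intro!: continuous_intros)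
  thus ?case using exponential_derivative[OF exp x] by blast
next
  case (add f k l s f' k' l' s')
  have lin: "linear (adjoint B)" by (rule adjoint_linear[OF B_linear])
  have i: "integrable m (\<lambda>\<xi>. f \<xi> - k)" "integrable m (\<lambda>\<xi>. f' \<xi> - k')"
    "integrable (\<mu> x) (\<lambda>\<xi>. f \<xi> - k + h \<xi> \<bullet> l)" "integrable (\<mu> x) (\<lambda>\<xi>. f' \<xi> - k' + h \<xi> \<bullet> l')"
    using add.IH by auto
  have eq: "(\<lambda>\<xi>. f \<xi> + f' \<xi> - (k + k')) = (\<lambda>\<xi>. (f \<xi> - k) + (f' \<xi> - k'))"
    "(\<lambda>\<xi>. f \<xi> + f' \<xi> - (k + k') + h \<xi> \<bullet> (l + l')) = (\<lambda>\<xi>. (f \<xi> - k + h \<xi> \<bullet> l) + (f' \<xi> - k' + h \<xi> \<bullet> l'))"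
    by (auto simp: inner_add_right)
  have "((\<lambda>t. (\<integral>\<xi>. f (\<xi> - x) \<partial>p t x) + (\<integral>\<xi>. f' (\<xi> - x) \<partial>p t x)) has_real_derivative
      generator x f k l s + generator x f' k' l' s') (at 0 within {0..})"
    using add.IH by (intro DERIV_add) auto
  also have "generator x f k l s + generator x f' k' l' s' =
      generator x (\<lambda>y. f y + f' y) (k + k') (l + l') (s + s')"
    unfolding generator_def eq Bochner_Integration.integral_add[OF i(1,2)]
      Bochner_Integration.integral_add[OF i(3,4)]
    unfolding linear_add[OF lin] inner_add_right
    by (simp add: algebra_simps add_divide_distrib)
  finally have "((\<lambda>t. \<integral>\<xi>. f (\<xi> - x) + f' (\<xi> - x) \<partial>p t x) has_real_derivative
      generator x (\<lambda>y. f y + f' y) (k + k') (l + l') (s + s')) (at 0 within {0..})"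
    by (rule has_field_derivative_transform_within[where d = 1])
       (use integrable_kernel[OF add.hyps(1) _ x] integrable_kernel[OF add.hyps(2) _ x] in auto)
  thus ?case unfolding eq using i by simp
next
  case (scale f k l s t)
  have lin: "linear (adjoint B)" by (rule adjoint_linear[OF B_linear])
  have eq: "(\<lambda>\<xi>. t * f \<xi> - t * k) = (\<lambda>\<xi>. t * (f \<xi> - k))"
    "(\<lambda>\<xi>. t * f \<xi> - t * k + h \<xi> \<bullet> (t *\<^sub>R l)) = (\<lambda>\<xi>. t * (f \<xi> - k + h \<xi> \<bullet> l))"
    by (auto simp: algebra_simps)
  have "((\<lambda>r. t * (\<integral>\<xi>. f (\<xi> - x) \<partial>p r x)) has_real_derivative t * generator x f k l s) (at 0 within {0..})"
    using scale.IH by (intro DERIV_cmult) auto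
  also have "t * generator x f k l s = generator x (\<lambda>y. t * f y) (t * k) (t *\<^sub>R l) (t * s)"
    unfolding generator_def eq integral_mult_right_zero
    by (simp add: linear_scale[OF lin] algebra_simps)
  finally show ?case unfolding eq using scale.IH by simp
qed

text \<open>
  The kernels are positive measures on the cone and \<open>f\<close> vanishes at the starting point, so all
  difference quotients at time zero are nonnegative.
\<close>

theorem maximum_principle:
  assumes f: "exp_sum squares (diffusion_form x) f 0 l s" and x: "x \<in> squares"
    and nonneg: "\<And>y. x + y \<in> squares \<Longrightarrow> f y \<ge> 0"
  shows "generator x f 0 l s \<ge> 0"
proof -
  let ?g = "\<lambda>t. \<integral>\<xi>. f (\<xi> - x) \<partial>p t x"
  have sp: "x \<in> space (borel_on squares)" using x by (simp add: space_restrict_space)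
  have cont: "continuous_on UNIV (\<lambda>\<xi>. f (\<xi> - x))"
    by (rule continuous_on_compose2[OF exp_sum_continuous[OF f]]) (auto intro!: continuous_intros)
  have "?g 0 = f (x - x)"
    unfolding start[OF x]
    by (rule integral_return[OF sp measurable_restrict_space1[OF borel_measurable_continuous_onI[OF cont]]])
  hence g0: "?g 0 = 0" using exp_sum_zero[OF f] by simp
  have "(?g has_real_derivative generator x f 0 l s) (at 0 within {0..})"
    using exp_sum_derivative[OF f x] by blast
  hence "((\<lambda>t. (?g t - ?g 0) / (t - 0)) \<longlongrightarrow> generator x f 0 l s) (at 0 within {0..})"
    by (simp add: has_field_derivative_iff)
  moreover have "\<forall>\<^sub>F t in at 0 within {0..}. 0 \<le> (?g t - ?g 0) / (t - 0)"
    unfolding eventually_at_filter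
  proof (rule always_eventually, intro allI impI)
    fix t :: real assume t: "t \<noteq> 0" "t \<in> {0..}"
    have "?g t \<ge> 0"
      using kernel_measure(3)[of t x] t x nonneg[of "_ - x"] by (intro integral_nonneg_AE AE_I2) auto
    thus "0 \<le> (?g t - ?g 0) / (t - 0)" using t g0 by simp
  qed
  moreover have "at (0::real) within {0..} \<noteq> bot" by (simp add: at_within_Ici_at_right)
  ultimately show ?thesis by (rule tendsto_lowerbound)
qed


section \<open>Localisation\<close>

text \<open>
  The penalty is an exponential sum of order two at the origin that is positive elsewhere. Its
  exponents \<open>e\<close> and \<open>e + w\<close> lie in the cone and span the space.
\<close>

definition test_points :: "'a set" where
  "test_points = insert e ((\<lambda>w. e + w) ` Basis)"

lemma test_points: "finite test_points" "u \<in> test_points \<Longrightarrow> u \<in> squares"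
  using spectral_bounds(2) by (auto simp: test_points_def)

definition penalty :: "'a \<Rightarrow> real" where
  "penalty y = (\<Sum>u\<in>test_points. (1 - exp (- (u \<bullet> y)))\<^sup>2)"

lemma penalty_nonneg: "penalty y \<ge> 0"
  by (simp add: penalty_def sum_nonneg)

lemma penalty_exp_sum: "\<exists>s. exp_sum squares (diffusion_form x) penalty 0 0 s"
proof -
  interpret E: exp_sum_algebra squares "diffusion_form x" by (rule exp_sum_algebra)
  have "exp_sum squares (diffusion_form x) penalty (\<Sum>u\<in>test_points. 0) (\<Sum>u\<in>test_points. 0)
      (\<Sum>u\<in>test_points. 2 * diffusion_form x (- u) (- u))"
    unfolding penalty_def
    by (intro E.sum E.square_vanishing[OF E.one_minus_exp] test_points)
  thus ?thesis by auto
qed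

lemma abs_le_of_exp_near_one:
  fixes z :: real
  assumes "\<bar>1 - exp (- z)\<bar> < \<delta>" "\<delta> \<le> 1/2"
  shows "\<bar>z\<bar> \<le> 2 * \<delta>"
proof (cases "z \<ge> 0")
  case True
  have "exp (- z) > 1/2" using assms True by (simp add: abs_if split: if_splits)
  moreover have "z * exp (- z) \<le> 1 - exp (- z)"
  proof -
    have "exp (- z) * (1 + z) \<le> exp (- z) * exp z"
      by (intro mult_left_mono exp_ge_add_one_self) simp
    thus ?thesis by (simp add: algebra_simps flip: exp_add)
  qed
  moreover have "z * (1/2) \<le> z * exp (- z)" using True calculation(1) by (intro mult_left_mono) auto
  ultimately show ?thesis using assms(1) True by (simp add: abs_if split: if_splits)
next
  case False
  have "- z \<le> exp (- z) - 1" using exp_ge_add_one_self[of "- z"] by simp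
  thus ?thesis using assms(1) False by (simp add: abs_if split: if_splits)
qed

text \<open>
  A small penalty forces all \<open>\<langle>u, y\<rangle>\<close>, \<open>u\<close> a test point, to be small, and differences of test points
  run through an orthonormal basis.
\<close>

lemma penalty_lower_bound:
  assumes "\<eta> > 0"
  shows "\<exists>\<theta>>0. \<forall>y. norm y \<ge> \<eta> \<longrightarrow> penalty y \<ge> \<theta>"
proof -
  \<comment> \<open>Below \<open>\<delta>\<^sup>2\<close> the penalty confines every coordinate of \<open>y\<close> to \<open>4 \<delta>\<close>, hence \<open>|y|\<close> to \<open>\<eta>/2\<close>.\<close>
  define \<delta> where "\<delta> = min (1/2) (\<eta> / (8 * DIM('a)))"
  have \<delta>: "\<delta> > 0" "\<delta> \<le> 1/2" using assms by (auto simp: \<delta>_def)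
  have "penalty y \<ge> \<delta>\<^sup>2" if y: "norm y \<ge> \<eta>" for y
  proof (rule ccontr)
    assume small: "\<not> penalty y \<ge> \<delta>\<^sup>2"
    have u: "\<bar>u \<bullet> y\<bar> \<le> 2 * \<delta>" if "u \<in> test_points" for u
    proof (rule abs_le_of_exp_near_one[OF _ \<delta>(2)])
      have "(1 - exp (- (u \<bullet> y)))\<^sup>2 \<le> penalty y"
        unfolding penalty_def using that test_points(1) by (intro member_le_sum) auto
      hence "\<bar>1 - exp (- (u \<bullet> y))\<bar>\<^sup>2 < \<delta>\<^sup>2" using small by simp
      thus "\<bar>1 - exp (- (u \<bullet> y))\<bar> < \<delta>"
        by (rule power2_less_imp_less) (use \<delta>(1) in simp)
    qed
    have "\<bar>y \<bullet> w\<bar> \<le> 4 * \<delta>" if "w \<in> Basis" for w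
    proof -
      have "e \<in> test_points" "e + w \<in> test_points" using that by (auto simp: test_points_def)
      from u[OF this(1)] u[OF this(2)] show ?thesis
        by (simp add: inner_add_left inner_commute[of y w])
    qed
    hence "(\<Sum>w\<in>Basis. \<bar>y \<bullet> w\<bar>) \<le> (\<Sum>w\<in>(Basis::'a set). 4 * \<delta>)" by (rule sum_mono)
    hence "norm y \<le> DIM('a) * (4 * \<delta>)" using norm_le_l1[of y] by simp
    also have "\<dots> \<le> DIM('a) * (4 * (\<eta> / (8 * DIM('a))))"
      by (intro mult_left_mono) (auto simp: \<delta>_def)
    also have "\<dots> < \<eta>" using assms by simp
    finally show False using y by simp
  qed
  thus ?thesis using \<delta>(1) by (intro exI[of _ "\<delta>\<^sup>2"]) auto
qed

text \<open>
  Let \<open>\<Theta>\<close> be the penalty. A large multiple of \<open>\<Theta>\<^sup>2\<close> makes \<open>f\<close> nonnegative on the whole cone, and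
  \<open>(1 - \<Theta>/T)\<^sup>n\<close> tends to zero away from the origin. Neither changes the moments of \<open>f\<close>, because \<open>\<Theta>\<close> has
  no first order term and \<open>f\<close> vanishes at the origin. Letting \<open>n \<rightarrow> \<infinity>\<close> in the maximum principle removes
  the jump integrals by dominated convergence, up to the compensator.
\<close>

theorem local_maximum_principle:
  assumes f: "exp_sum squares (diffusion_form x) f 0 l s" and x: "x \<in> squares"
    and \<eta>: "\<eta> > 0" and nonneg: "\<And>y. x + y \<in> squares \<Longrightarrow> norm y < \<eta> \<Longrightarrow> f y \<ge> 0"
    and int: "(\<integral>\<^sup>+\<xi>. ennreal (min (norm \<xi>) 1) \<partial>\<mu> x) < \<infinity>"
  shows "- (b \<bullet> l) - x \<bullet> adjoint B l + s / 2 + (\<integral>\<xi>. h \<xi> \<bullet> l \<partial>\<mu> x) \<ge> 0"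
proof -
  interpret E: exp_sum_algebra squares "diffusion_form x" by (rule exp_sum_algebra)
  obtain s\<Theta> where \<Theta>: "exp_sum squares (diffusion_form x) penalty 0 0 s\<Theta>"
    using penalty_exp_sum by blast
  obtain \<theta> where \<theta>: "\<theta> > 0" "\<And>y. norm y \<ge> \<eta> \<Longrightarrow> penalty y \<ge> \<theta>"
    using penalty_lower_bound[OF \<eta>] by blast
  obtain C1 where C1: "C1 \<ge> 0" "\<And>y. x + y \<in> squares \<Longrightarrow> \<bar>f y\<bar> \<le> C1"
    using exp_sum_bounded[OF f squares_inner_nonneg, of x] by blast
  obtain T0 where T0: "T0 \<ge> 0" "\<And>y. x + y \<in> squares \<Longrightarrow> \<bar>penalty y\<bar> \<le> T0"
    using exp_sum_bounded[OF \<Theta> squares_inner_nonneg, of x] by blast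
  define T where "T = T0 + 1"
  define g where "g = (\<lambda>y. f y + (C1 / \<theta>\<^sup>2) * (penalty y)\<^sup>2)"
  define bump where "bump = (\<lambda>y. 1 - (1 / T) * penalty y)"
  have g: "exp_sum squares (diffusion_form x) g 0 l s"
    unfolding g_def
    by (rule exp_sum_eq[OF exp_sum.add[OF f exp_sum.scale[OF E.square_vanishing[OF \<Theta>], of "C1 / \<theta>\<^sup>2"]]]) (auto simp: E.q_simps)
  have g_nonneg: "g y \<ge> 0" if "x + y \<in> squares" for y
  proof (cases "norm y < \<eta>")
    case True
    thus ?thesis using nonneg[OF that] C1(1) by (simp add: g_def)
  next
    case False
    hence "\<theta>\<^sup>2 \<le> (penalty y)\<^sup>2" using \<theta> by (intro power_mono) auto
    hence "C1 / \<theta>\<^sup>2 * \<theta>\<^sup>2 \<le> C1 / \<theta>\<^sup>2 * (penalty y)\<^sup>2"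
      using C1(1) by (intro mult_left_mono) auto
    hence "C1 \<le> C1 / \<theta>\<^sup>2 * (penalty y)\<^sup>2" using \<theta>(1) by simp
    thus ?thesis using C1(2)[OF that] by (simp add: g_def abs_le_iff)
  qed
  have bump: "exp_sum squares (diffusion_form x) bump 1 0 (- (1 / T) * s\<Theta>)"
    unfolding bump_def
    by (rule exp_sum_eq[OF exp_sum_diff[OF E.const[of 1] exp_sum.scale[OF \<Theta>, of "1 / T"]]]) auto
  have bump01: "0 \<le> bump y" "bump y \<le> 1" if "x + y \<in> squares" for y
    using T0(1) T0(2)[OF that] penalty_nonneg[of y] by (auto simp: bump_def T_def divide_simps)
  define G where "G = (\<lambda>n y. g y * bump y ^ n)"
  have G: "exp_sum squares (diffusion_form x) (G n) 0 l s" for n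
  proof -
    obtain s' where "exp_sum squares (diffusion_form x) (\<lambda>y. bump y ^ n) 1 0 s'"
      using E.power[OF bump] by blast
    from E.mult[OF g this] show ?thesis unfolding G_def by (simp add: E.q_simps)
  qed
  have gen: "generator x (G n) 0 l s \<ge> 0" for n
    by (rule maximum_principle[OF G x]) (use g_nonneg bump01 in \<open>auto simp: G_def\<close>)
  obtain C where C: "C \<ge> 0" "\<And>\<xi>. \<xi> \<in> squares \<Longrightarrow> \<bar>g \<xi>\<bar> \<le> C * min (norm \<xi>) 1"
    using exp_sum_lipschitz[OF g squares_inner_nonneg] by auto
  have xs: "x + \<xi> \<in> squares" if "\<xi> \<in> squares" for \<xi> using squares_add[OF x that] .
  have G_bound: "\<bar>G n \<xi>\<bar> \<le> C * min (norm \<xi>) 1" if \<xi>: "\<xi> \<in> squares" for n \<xi>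
  proof -
    have "\<bar>G n \<xi>\<bar> = \<bar>g \<xi>\<bar> * bump \<xi> ^ n"
      using bump01[OF xs[OF \<xi>]] by (simp add: G_def abs_mult)
    also have "\<dots> \<le> \<bar>g \<xi>\<bar> * 1"
      using bump01[OF xs[OF \<xi>]] by (intro mult_left_mono power_le_one) auto
    finally show ?thesis using C(2)[OF \<xi>] by simp
  qed
  have G_lim: "(\<lambda>n. G n \<xi>) \<longlonglongrightarrow> 0" if \<xi>: "\<xi> \<in> squares" for \<xi>
  proof (cases "\<xi> = 0")
    case True
    thus ?thesis using exp_sum_zero[OF g] by (simp add: G_def)
  next
    case False
    then obtain \<theta>' where "\<theta>' > 0" "penalty \<xi> \<ge> \<theta>'"
      using penalty_lower_bound[of "norm \<xi>"] by auto
    hence "bump \<xi> < 1" using T0(1) by (simp add: bump_def T_def)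
    hence "(\<lambda>n. bump \<xi> ^ n) \<longlonglongrightarrow> 0"
      using bump01[OF xs[OF \<xi>]] by (intro LIMSEQ_realpow_zero) auto
    thus ?thesis unfolding G_def by (rule tendsto_mult_right_zero)
  qed
  have lim: "(\<lambda>n. \<integral>\<xi>. G n \<xi> \<partial>N) \<longlonglongrightarrow> 0" and int_G: "\<And>n. integrable N (G n)"
    if N: "sets N = sets (borel_on squares)" and fin: "(\<integral>\<^sup>+\<xi>. ennreal (min (norm \<xi>) 1) \<partial>N) < \<infinity>"
    for N
  proof -
    have sp: "space N = squares" using sets_eq_imp_space_eq[OF N] by (simp add: space_restrict_space)
    have "(\<lambda>n. \<integral>\<xi>. G n \<xi> \<partial>N) \<longlonglongrightarrow> (\<integral>\<xi>. 0 \<partial>N)"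
    proof (rule integral_dominated_convergence[where w = "\<lambda>\<xi>. C * min (norm \<xi>) 1"])
      show "G n \<in> borel_measurable N" for n
        by (rule measurable_sets_eq[OF N exp_sum_continuous[OF G]])
      show "integrable N (\<lambda>\<xi>. C * min (norm \<xi>) 1)" by (rule integrable_min_norm[OF N fin])
    qed (use G_bound G_lim sp in auto)
    thus "(\<lambda>n. \<integral>\<xi>. G n \<xi> \<partial>N) \<longlonglongrightarrow> 0" by simp
    show "integrable N (G n)" for n
      by (rule integrable_of_le_min_norm[OF N fin exp_sum_continuous[OF G] G_bound])
  qed
  obtain Ch where Ch: "\<And>\<xi>. norm (h \<xi>) \<le> Ch * min (norm \<xi>) 1" using truncation_bound by blast
  have int_h: "integrable (\<mu> x) (\<lambda>\<xi>. h \<xi> \<bullet> l)"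
  proof (rule integrable_of_le_min_norm[OF sets_\<mu>[OF x] int])
    show "continuous_on UNIV (\<lambda>\<xi>. h \<xi> \<bullet> l)" by (intro continuous_intros h_continuous)
    show "\<bar>h \<xi> \<bullet> l\<bar> \<le> (Ch * norm l) * min (norm \<xi>) 1" for \<xi>
    proof -
      have "\<bar>h \<xi> \<bullet> l\<bar> \<le> norm (h \<xi>) * norm l" by (rule Cauchy_Schwarz_ineq2)
      also have "\<dots> \<le> (Ch * min (norm \<xi>) 1) * norm l" by (intro mult_right_mono Ch) simp
      finally show ?thesis by (simp add: mult_ac)
    qed
  qed
  have split: "(\<integral>\<xi>. G n \<xi> + h \<xi> \<bullet> l \<partial>\<mu> x) = (\<integral>\<xi>. G n \<xi> \<partial>\<mu> x) + (\<integral>\<xi>. h \<xi> \<bullet> l \<partial>\<mu> x)" for n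
    by (rule Bochner_Integration.integral_add[OF int_G[OF sets_\<mu>[OF x] int] int_h])
  let ?c = "- (b \<bullet> l) - x \<bullet> adjoint B l + s / 2 + (\<integral>\<xi>. h \<xi> \<bullet> l \<partial>\<mu> x)"
  have "(\<lambda>n. ?c + ((\<integral>\<xi>. G n \<xi> \<partial>m) + (\<integral>\<xi>. G n \<xi> \<partial>\<mu> x))) \<longlonglongrightarrow> ?c + (0 + 0)"
    by (intro tendsto_add tendsto_const lim m_sets m_integrable sets_\<mu> x int)
  moreover have "0 \<le> ?c + ((\<integral>\<xi>. G n \<xi> \<partial>m) + (\<integral>\<xi>. G n \<xi> \<partial>\<mu> x))" for n
    using gen[of n] by (simp add: generator_def split algebra_simps)
  ultimately show ?thesis
    using LIMSEQ_le_const[of _ "?c + (0 + 0)" 0] by auto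
qed

end

section \<open>The drift condition\<close>

context euclidean_jordan_algebra
begin

lemma quad_rep_adjoint: "x \<bullet> quad_rep J w y = quad_rep J w x \<bullet> y"
  by (simp add: quad_rep_def inner_diff_left inner_diff_right inner_assoc)

lemma peirce_half_orthogonal:
  assumes g: "J g g = g" and v: "v \<in> peirce_half g"
  shows "g \<bullet> v = 0" "e \<bullet> v = 0" "J g a = 0 \<Longrightarrow> a \<bullet> v = 0"
proof -
  have gv: "J g v = (1/2) *\<^sub>R v" using v by (simp add: peirce_half_def)
  have half: "(1/2) * (y \<bullet> v) = J g y \<bullet> v" for y
    using inner_assoc[of g y v] by (simp add: gv)
  show gv0: "g \<bullet> v = 0" using half[of g] by (simp add: g)
  show "e \<bullet> v = 0" using half[of e] gv0 by simp
  show "a \<bullet> v = 0" if "J g a = 0" using half[of a] that by simp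
qed

end

context trace_form
begin

text \<open>
  A vector \<open>v \<noteq> 0\<close> of the half space yields the nonzero orthogonal vectors \<open>g\<close>, \<open>v\<close> and \<open>half_square g v\<close>.
\<close>

lemma peirce_half_trivial:
  assumes g: "primitive_idempotent J g" and dim: "DIM('a) \<le> 2"
  shows "dim (peirce_half g) = 0"
proof (rule ccontr)
  note gg = primitive_idempotentD[OF g]
  assume "dim (peirce_half g) \<noteq> 0"
  then obtain v where v: "v \<in> peirce_half g" "v \<noteq> 0"
    by (auto simp: dim_eq_0)
  define a where "a = half_square g v"
  note F = half_square_relations[OF g v(1), folded a_def]
  have "a \<bullet> a > 0" unfolding F(2) using v(2) by simp
  hence a0: "a \<noteq> 0" by auto
  have o: "g \<bullet> v = 0" "a \<bullet> v = 0" "g \<bullet> a = 0"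
    using peirce_half_orthogonal[OF gg(1) v(1)] inner_eq_0_of_mult_eq_0[OF gg(1)] F(1) by auto
  have neq: "g \<noteq> v" "g \<noteq> a" "a \<noteq> v" using o a0 v(2) by auto
  have "pairwise orthogonal {g, v, a}"
    using o by (auto simp: pairwise_def orthogonal_def inner_commute)
  hence "independent {g, v, a}"
    using gg(2) v(2) a0 by (intro pairwise_orthogonal_independent) auto
  hence "card {g, v, a} \<le> DIM('a)" using independent_bound by blast
  thus False using neq dim by simp
qed

text \<open>
  Positivity of \<open>\<xi>\<close> on the orbit of \<open>g\<close> bounds the component of \<open>\<xi>\<close> in the half space by
  its \<open>g\<close>-coordinate, with a constant that tends to the optimal one as \<open>\<xi>\<close> tends to
  \<open>t (e - g)\<close>.
\<close>

lemma half_component_bound: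
  assumes g: "primitive_idempotent J g" and t: "t > 0"
    and \<xi>: "t *\<^sub>R (e - g) + y \<in> squares"
    and W: "finite W" "W \<subseteq> peirce_half g" "pairwise orthogonal W" "\<And>w. w \<in> W \<Longrightarrow> norm w = 1"
  shows "(\<Sum>w\<in>W. (w \<bullet> y)\<^sup>2) \<le> 2 * (t + norm y) * (g \<bullet> y)"
proof -
  note gg = primitive_idempotentD[OF g]
  let ?x = "t *\<^sub>R (e - g)"
  have gn: "g \<bullet> g = 1" by (rule primitive_norm[OF g])
  have eg: "e \<bullet> g = 1" using inner_assoc[of g e g] gg(1) gn by simp
  define z where "z = (\<Sum>w\<in>W. (w \<bullet> y) *\<^sub>R w)"
  define S where "S = (\<Sum>w\<in>W. (w \<bullet> y)\<^sup>2)"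
  have z: "z \<in> peirce_half g"
    unfolding z_def using W(2) subspace_peirce_half
    by (intro subspace_sum subspace_scale) auto
  have zy: "z \<bullet> y = S"
    by (simp add: z_def S_def inner_sum_left power2_eq_square)
  have zw: "z \<bullet> w = w \<bullet> y" if w: "w \<in> W" for w
  proof -
    have "z \<bullet> w = (\<Sum>u\<in>W. if u = w then w \<bullet> y else 0)"
      unfolding z_def inner_sum_left
    proof (intro sum.cong refl)
      fix u assume "u \<in> W"
      thus "(u \<bullet> y) *\<^sub>R u \<bullet> w = (if u = w then w \<bullet> y else 0)"
        using W(3) W(4)[OF w] w by (auto simp: pairwise_def orthogonal_def dot_square_norm)
    qed
    thus ?thesis using W(1) w by simp
  qed
  have "z \<bullet> z = (\<Sum>w\<in>W. (w \<bullet> y) * (z \<bullet> w))"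
    by (subst (2) z_def) (simp add: inner_sum_right)
  also have "\<dots> = S" unfolding S_def by (intro sum.cong) (auto simp: zw power2_eq_square)
  finally have zz: "z \<bullet> z = S" .
  define a where "a = half_square g z"
  note F = half_square_relations[OF g z, folded a_def]
  have S0: "S \<ge> 0" by (simp add: S_def sum_nonneg)
  have na: "norm a = S / 2"
    using F(2) S0 zz by (simp add: norm_eq_sqrt_inner)
  have ga: "g \<bullet> a = 0" by (rule inner_eq_0_of_mult_eq_0[OF gg(1) F(1)])
  have "e \<bullet> a = e \<bullet> J z z - (S / 2) * (e \<bullet> g)"
    by (simp add: a_def half_square_def zz inner_diff_right)
  also have "e \<bullet> J z z = z \<bullet> z"
    using inner_assoc[of z e z] by simp
  finally have ea: "e \<bullet> a = S / 2" by (simp add: zz eg)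
  have xa: "?x \<bullet> a = t * (S / 2)" by (simp add: inner_diff_left ea ga)
  have xz: "?x \<bullet> z = 0"
    using peirce_half_orthogonal[OF gg(1) z] by (simp add: inner_diff_left)
  have xg: "?x \<bullet> g = 0" by (simp add: inner_diff_left eg gn)
  have "y \<bullet> a \<le> norm y * (S / 2)" using norm_cauchy_schwarz[of y a] na by simp
  hence xya: "(?x + y) \<bullet> a \<le> (t + norm y) * (S / 2)"
    unfolding inner_add_left[of ?x y a] xa distrib_right by linarith
  \<comment> \<open>The minimiser of the quadratic polynomial \<open>\<langle>g, y\<rangle> + \<tau> S + \<tau>\<^sup>2 (t + |y|) S / 2\<close> in \<open>\<tau>\<close>.\<close>
  define \<tau> where "\<tau> = - (1 / (t + norm y))"
  have n0: "t + norm y > 0" using t by (simp add: add_pos_nonneg)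
  have "\<tau> *\<^sub>R z \<in> peirce_half g" using z subspace_peirce_half by (simp add: subspace_scale)
  moreover have "half_square g (\<tau> *\<^sub>R z) = \<tau>\<^sup>2 *\<^sub>R a"
    by (simp add: half_square_def a_def prod_simps power2_eq_square scaleR_diff_right)
  ultimately have "g + \<tau> *\<^sub>R z + \<tau>\<^sup>2 *\<^sub>R a \<in> squares"
    using orbit_in_squares[OF g, of "\<tau> *\<^sub>R z"] by simp
  from squares_inner_nonneg[OF \<xi> this]
  have "0 \<le> (?x + y) \<bullet> g + \<tau> * ((?x + y) \<bullet> z) + \<tau>\<^sup>2 * ((?x + y) \<bullet> a)"
    by (simp add: inner_add_right)
  also have "\<dots> \<le> g \<bullet> y + \<tau> * S + \<tau>\<^sup>2 * ((t + norm y) * (S / 2))"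
  proof -
    have "(?x + y) \<bullet> g = g \<bullet> y" "(?x + y) \<bullet> z = S"
      unfolding inner_add_left[of ?x] xg xz using zy by (simp_all add: inner_commute)
    thus ?thesis using mult_left_mono[OF xya, of "\<tau>\<^sup>2"] by simp
  qed
  also have "\<tau>\<^sup>2 * ((t + norm y) * (S / 2)) = - \<tau> * S / 2"
    using n0 by (simp add: \<tau>_def power2_eq_square)
  finally have "- \<tau> * S \<le> 2 * (g \<bullet> y)" by (simp add: mult.commute)
  hence "S / (t + norm y) \<le> 2 * (g \<bullet> y)" by (simp add: \<tau>_def)
  thus ?thesis
    using n0 by (simp add: S_def[symmetric] pos_divide_le_eq mult_ac)
qed

end

context jordan_affine_process
begin

lemma integral_\<mu>_scale:
  fixes f :: "'a \<Rightarrow> real"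
  assumes x: "x \<in> squares" and t: "t \<ge> 0" and f: "continuous_on UNIV f"
  shows "(\<integral>\<xi>. f \<xi> \<partial>\<mu> (t *\<^sub>R x)) = t * (\<integral>\<xi>. f \<xi> \<partial>\<mu> x)"
proof -
  have tx: "t *\<^sub>R x \<in> squares" using x t by (rule squares_scale)
  have "\<mu> (t *\<^sub>R x) = density (\<mu> x) (\<lambda>_. ennreal t)"
  proof (rule measure_eqI)
    show "sets (\<mu> (t *\<^sub>R x)) = sets (density (\<mu> x) (\<lambda>_. ennreal t))"
      using sets_\<mu>[OF tx] sets_\<mu>[OF x] by simp
    fix A assume "A \<in> sets (\<mu> (t *\<^sub>R x))"
    hence A: "A \<in> sets (borel_on squares)" using sets_\<mu>[OF tx] by simp
    thus "emeasure (\<mu> (t *\<^sub>R x)) A = emeasure (density (\<mu> x) (\<lambda>_. ennreal t)) A"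
      using cone_valued_measure_linear[OF \<mu>_measure squares_inner_nonneg x x _ t order_refl A] tx sets_\<mu>[OF x]
      by (simp add: emeasure_density_const)
  qed
  thus ?thesis
    using t by (simp add: integral_density measurable_sets_eq[OF sets_\<mu>[OF x] f])
qed

text \<open>
  The test function has gradient \<open>(t + t\<^sup>2) g\<close>. Its second order part is, on the half space, minus half of
  the squared length; the part along \<open>g\<close> is invisible to the diffusion at \<open>t (e - g)\<close>. The factor \<open>t + t\<^sup>2\<close>
  exceeds \<open>t\<close>, the constant in \<open>half_component_bound\<close> at \<open>y = 0\<close>, and the surplus absorbs the higher order
  errors near the base point.
\<close>

lemma drift_estimate:
  assumes g: "primitive_idempotent J g" and dim: "DIM('a) > 2" and t: "t > 0"
  defines "D \<equiv> (e - g) \<bullet> adjoint B g - (\<integral>\<xi>. h \<xi> \<bullet> g \<partial>\<mu> (e - g))"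
  shows "real (dim (peirce_half g)) * (((1/4) *\<^sub>R Q e e) \<bullet> g) \<le> (1 + t) * (b \<bullet> g + t * D)"
proof -
  note gg = primitive_idempotentD[OF g]
  have gs: "g \<in> squares" and egs: "e - g \<in> squares"
    using gg idempotent_complement idempotent_in_squares by auto
  define x where "x = t *\<^sub>R (e - g)"
  have x: "x \<in> squares" unfolding x_def using t egs by (intro squares_scale) auto
  have gx: "g \<bullet> x = 0"
    using inner_eq_0_of_mult_eq_0[OF gg(1), of x] by (simp add: x_def prod_simps gg(1))
  interpret E: exp_sum_algebra squares "diffusion_form x" by (rule exp_sum_algebra)
  obtain W where W: "W \<subseteq> peirce_half g" "pairwise orthogonal W" "\<And>w. w \<in> W \<Longrightarrow> norm w = 1"
    "independent W" "card W = dim (peirce_half g)"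
    using orthonormal_basis_subspace[OF subspace_peirce_half, of g] by metis
  have finW: "finite W" using W(4) independent_imp_finite by blast
  \<comment> \<open>A second difference of exponentials with the same second order term as \<open>\<langle>w, y\<rangle>\<^sup>2\<close>.\<close>
  define S where "S = (\<lambda>w y. exp (- ((e + w) \<bullet> y)) + exp (- ((e - w) \<bullet> y)) - 2 * exp (- (e \<bullet> y)))"
  define f where "f = (\<lambda>y. (t + t\<^sup>2) * (1 - exp (- (g \<bullet> y))) - (1/2) * (\<Sum>w\<in>W. S w y))"
  let ?q = "diffusion_form x"
  have S: "exp_sum squares ?q (S w) 0 0 (2 * ?q w w)" if w: "w \<in> W" for w
  proof -
    have "e + w \<in> squares" "e - w \<in> squares"
      using spectral_bounds(2)[of w] spectral_bounds(2)[of "- w"] W(3)[OF w] by auto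
    from exp_sum_diff[OF exp_sum.add[OF this[THEN exp_sum.exp]] exp_sum.scale[OF exp_sum.exp[OF unit_in_squares]],
        of ?q 2]
    show ?thesis
      unfolding S_def by (rule exp_sum_eq) (auto simp: E.q_simps E.q_sym[of w e] scaleR_2)
  qed
  have sum_S: "exp_sum squares ?q (\<lambda>y. \<Sum>w\<in>W. S w y) 0 0 (\<Sum>w\<in>W. 2 * ?q w w)"
    using E.sum[OF finW S] by simp
  have f: "exp_sum squares ?q f 0 (- (t + t\<^sup>2) *\<^sub>R g) (- (t + t\<^sup>2) * ?q g g - (\<Sum>w\<in>W. ?q w w))"
    unfolding f_def
    by (rule exp_sum_eq[OF exp_sum_diff[OF exp_sum.scale[OF E.one_minus_exp[OF gs], of "t + t\<^sup>2"]
          exp_sum.scale[OF sum_S, of "1/2"]]])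
       (auto simp: sum_distrib_left algebra_simps)
  have qg: "?q g g = 0" by (rule Q_boundary[OF gs x gx])
  have qw: "?q w w = t / 2 * (g \<bullet> Q e e)" if w: "w \<in> W" for w
  proof -
    have wh: "w \<in> peirce_half g" using W(1) w by blast
    have ww: "w \<bullet> w = 1" using W(3)[OF w] by (simp add: dot_square_norm)
    have "J w g = (1/2) *\<^sub>R w" using wh by (simp add: peirce_half_def commute[of w g])
    hence "quad_rep J w (e - g) = J g (J w w)"
      using scaleR_left_diff_distrib[of 1 "1/2" "J w w"]
      by (simp add: quad_rep_def prod_simps commute[of "J w w" g] scaleR_2)
    also have "\<dots> = (1/2) *\<^sub>R g" using half_square_relations(5)[OF g wh] by (simp add: ww)
    finally have 1: "quad_rep J w (e - g) = (1/2) *\<^sub>R g" .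
    have "Q w w = quad_rep J w (Q e e)"
      by (rule boundary_form_eq_quad_rep[OF Q_bilinear Q_sym Q_cone Q_boundary])
    hence "?q w w = t * ((e - g) \<bullet> quad_rep J w (Q e e))" by (simp add: x_def)
    also have "\<dots> = t * ((1/2) *\<^sub>R g \<bullet> Q e e)" by (simp only: quad_rep_adjoint 1)
    finally show ?thesis by simp
  qed
  \<comment> \<open>Near the origin \<open>f y\<close> is at least \<open>\<langle>g, y\<rangle> N |y|\<close>, and \<open>N 0 = t\<^sup>2\<close>.\<close>
  define N where "N = (\<lambda>r. (t + t\<^sup>2) * (1 - r) - exp ((norm e + 1) * r) * (t + r))"
  have "isCont N 0" unfolding N_def by (intro continuous_intros)
  hence "(N \<longlongrightarrow> N 0) (nhds 0)" by (simp add: isCont_def tendsto_at_iff_tendsto_nhds)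
  hence "\<forall>\<^sub>F r in nhds 0. N r > 0"
    by (rule order_tendstoD) (use t in \<open>simp add: N_def\<close>)
  then obtain \<eta> where \<eta>: "\<eta> > 0" "\<And>r. \<bar>r\<bar> < \<eta> \<Longrightarrow> N r > 0"
    unfolding eventually_nhds_metric by (auto simp: dist_real_def)
  have "f y \<ge> 0" if y: "x + y \<in> squares" "norm y < \<eta>" for y
  proof -
    let ?k = "g \<bullet> y"
    have k0: "?k \<ge> 0"
      using squares_inner_nonneg[OF gs y(1)] gx by (simp add: inner_add_right)
    have "norm g = 1" using primitive_norm[OF g] by (simp add: norm_eq_sqrt_inner)
    hence k1: "?k \<le> norm y" using norm_cauchy_schwarz[of g y] by simp
    have Sw: "S w y \<le> exp ((norm e + 1) * norm y) * (w \<bullet> y)\<^sup>2" if w: "w \<in> W" for w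
    proof -
      have "S w y = exp (- (e \<bullet> y)) * (exp (w \<bullet> y) + exp (- (w \<bullet> y)) - 2)"
        by (simp add: S_def inner_add_left inner_diff_left algebra_simps flip: exp_add)
      also have "\<dots> \<le> exp (- (e \<bullet> y)) * ((w \<bullet> y)\<^sup>2 * exp \<bar>w \<bullet> y\<bar>)"
        by (intro mult_left_mono exp_second_difference_le) simp
      also have "\<dots> = exp (- (e \<bullet> y) + \<bar>w \<bullet> y\<bar>) * (w \<bullet> y)\<^sup>2"
        by (simp only: exp_add mult_ac)
      also have "\<dots> \<le> exp ((norm e + 1) * norm y) * (w \<bullet> y)\<^sup>2"
        using Cauchy_Schwarz_ineq2[of e y] Cauchy_Schwarz_ineq2[of w y] W(3)[OF w]
        by (intro mult_right_mono) (auto simp: distrib_right)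
      finally show ?thesis .
    qed
    have "(\<Sum>w\<in>W. S w y) \<le> exp ((norm e + 1) * norm y) * (\<Sum>w\<in>W. (w \<bullet> y)\<^sup>2)"
      unfolding sum_distrib_left by (intro sum_mono Sw)
    also have "\<dots> \<le> exp ((norm e + 1) * norm y) * (2 * (t + norm y) * ?k)"
      by (intro mult_left_mono half_component_bound[OF g t y(1)[unfolded x_def] finW W(1-3)]) auto
    also have "\<dots> = 2 * (?k * (exp ((norm e + 1) * norm y) * (t + norm y)))" by (simp only: mult_ac)
    finally have sumS: "(1/2) * (\<Sum>w\<in>W. S w y) \<le> ?k * (exp ((norm e + 1) * norm y) * (t + norm y))"
      by simp
    have "?k * (1 - norm y) \<le> ?k * (1 - ?k)" using k0 k1 by (intro mult_left_mono) auto
    also have "\<dots> \<le> 1 - exp (- ?k)" by (rule one_minus_exp_bounds(1)[OF k0])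
    finally have "(t + t\<^sup>2) * (?k * (1 - norm y)) \<le> (t + t\<^sup>2) * (1 - exp (- ?k))"
      using t by (intro mult_left_mono) auto
    hence "?k * N (norm y) \<le> f y" using sumS by (simp add: f_def N_def algebra_simps)
    moreover have "?k * N (norm y) \<ge> 0"
      using k0 \<eta>(2)[of "norm y"] y(2) by (intro mult_nonneg_nonneg) auto
    ultimately show ?thesis by linarith
  qed
  from local_maximum_principle[OF f x \<eta>(1) this linear_jump_measure_integrable[OF dim x]]
  have "0 \<le> - (b \<bullet> (- (t + t\<^sup>2) *\<^sub>R g)) - x \<bullet> adjoint B (- (t + t\<^sup>2) *\<^sub>R g) +
      (- (t + t\<^sup>2) * ?q g g - (\<Sum>w\<in>W. ?q w w)) / 2 + (\<integral>\<xi>. h \<xi> \<bullet> (- (t + t\<^sup>2) *\<^sub>R g) \<partial>\<mu> x)"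
    by simp
  also have "?q g g = 0" by (rule qg)
  also have "(\<Sum>w\<in>W. ?q w w) = real (card W) * (t / 2 * (g \<bullet> Q e e))" by (simp add: qw)
  also have "adjoint B (- (t + t\<^sup>2) *\<^sub>R g) = (- (t + t\<^sup>2)) *\<^sub>R adjoint B g"
    by (rule linear_scale[OF adjoint_linear[OF B_linear]])
  also have "(\<integral>\<xi>. h \<xi> \<bullet> (- (t + t\<^sup>2) *\<^sub>R g) \<partial>\<mu> x) = - (t + t\<^sup>2) * (t * (\<integral>\<xi>. h \<xi> \<bullet> g \<partial>\<mu> (e - g)))"
  proof -
    have "continuous_on UNIV (\<lambda>\<xi>. h \<xi> \<bullet> g)" by (intro continuous_intros h_continuous)
    from integral_\<mu>_scale[OF egs less_imp_le[OF t] this] show ?thesis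
      unfolding x_def inner_scaleR_right integral_mult_right_zero by simp
  qed
  finally have "0 \<le> t * ((1 + t) * (b \<bullet> g + t * D) - real (card W) * ((1/4) * (g \<bullet> Q e e)))"
    by (simp add: x_def D_def inner_diff_left power2_eq_square algebra_simps)
  hence "0 \<le> (1 + t) * (b \<bullet> g + t * D) - real (card W) * ((1/4) * (g \<bullet> Q e e))"
    using t by (simp add: zero_le_mult_iff)
  thus ?thesis by (simp add: W(5) inner_commute[of g])
qed

lemma drift_primitive:
  assumes g: "primitive_idempotent J g" and dim: "DIM('a) > 2"
  shows "real (dim (peirce_half g)) * (((1/4) *\<^sub>R Q e e) \<bullet> g) \<le> b \<bullet> g"
proof -
  let ?D = "(e - g) \<bullet> adjoint B g - (\<integral>\<xi>. h \<xi> \<bullet> g \<partial>\<mu> (e - g))"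
  have "((\<lambda>t. (1 + t) * (b \<bullet> g + t * ?D)) \<longlongrightarrow> (1 + 0) * (b \<bullet> g + 0 * ?D)) (at_right 0)"
    by (intro tendsto_intros)
  moreover have "\<forall>\<^sub>F t in at_right (0::real).
      real (dim (peirce_half g)) * (((1/4) *\<^sub>R Q e e) \<bullet> g) \<le> (1 + t) * (b \<bullet> g + t * ?D)"
    using eventually_at_right_less[of "0::real"] by eventually_elim (rule drift_estimate[OF g dim])
  ultimately have "real (dim (peirce_half g)) * (((1/4) *\<^sub>R Q e e) \<bullet> g) \<le> (1 + 0) * (b \<bullet> g + 0 * ?D)"
    by (rule tendsto_lowerbound) simp
  thus ?thesis by simp
qed

theorem drift_condition:
  assumes d: "peirce_invariant J e d"
  shows "b - real (d * (jordan_rank J e - 1)) *\<^sub>R ((1/4) *\<^sub>R Q e e) \<in> squares"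
  unfolding squares_self_dual
proof
  let ?n = "real (d * (jordan_rank J e - 1))" and ?\<alpha> = "(1/4) *\<^sub>R Q e e"
  fix y assume "y \<in> squares"
  thus "0 \<le> (b - ?n *\<^sub>R ?\<alpha>) \<bullet> y"
  proof (induction rule: squares_induct)
    case (primitive g)
    have "?n * (?\<alpha> \<bullet> g) \<le> b \<bullet> g"
    proof (cases "DIM('a) > 2")
      case True
      thus ?thesis using drift_primitive[OF primitive] dim_peirce_half[OF primitive d] by simp
    next
      case False
      hence "d * (jordan_rank J e - 1) = 0"
        using peirce_half_trivial[OF primitive] dim_peirce_half[OF primitive d] by simp
      moreover have "b \<bullet> g \<ge> 0"
        using squares_inner_nonneg[OF b] idempotent_in_squares primitive_idempotentD[OF primitive] by blast
      ultimately show ?thesis by (simp only: of_nat_0 mult_zero_left)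
    qed
    thus ?case by (simp add: inner_diff_left)
  qed (simp_all add: inner_add_right)
qed

end

theorem theorem2p12:
  fixes J :: "'a::euclidean_space \<Rightarrow> 'a \<Rightarrow> 'a" and e :: 'a and tr :: "'a \<Rightarrow> real"
    and K :: "'a set" and r d :: nat
    and p :: "real \<Rightarrow> 'a \<Rightarrow> 'a measure"
    and \<phi> :: "real \<Rightarrow> 'a \<Rightarrow> real" and \<psi> :: "real \<Rightarrow> 'a \<Rightarrow> 'a" and h :: "'a \<Rightarrow> 'a"
    and Q :: "'a \<Rightarrow> 'a \<Rightarrow> 'a" and b :: 'a and B :: "'a \<Rightarrow> 'a" and c :: real and \<gamma> :: 'a
    and m :: "'a measure" and \<mu> :: "'a \<Rightarrow> 'a measure"
  assumes algebra: "simple_euclidean_jordan_algebra J e"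
    and trace: "jordan_trace J e tr"
    and inner: "\<And>x y. x \<bullet> y = tr (J x y)"
    and cone: "K = cone_of_squares J"
    and rank: "r = jordan_rank J e"
    and peirce: "peirce_invariant J e d"
    and process: "affine_process K p \<phi> \<psi>"
    and truncation: "truncation_function h"
    and parameters: "affine_parameters K h Q b B c \<gamma> m \<mu> \<phi> \<psi>"
  shows "(\<exists>\<alpha>\<in>K. \<alpha> = (1/4) *\<^sub>R Q e e \<and>
      (\<forall>u. Q u u = 4 *\<^sub>R quad_rep J u \<alpha>) \<and>
      (DIM('a) > 2 \<longrightarrow>
        (\<forall>x\<in>K. (\<integral>\<^sup>+\<xi>. ennreal (min (norm \<xi>) 1) \<partial>(\<mu> x)) < \<infinity>)) \<and>
      cone_le K (real (d * (r - 1)) *\<^sub>R \<alpha>) b)"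
proof -
  interpret simple_euclidean_jordan_algebra J e by (rule algebra)
  interpret affine_parameters "cone_of_squares J" h Q b B c \<gamma> m \<mu> \<phi> \<psi>
    using parameters unfolding cone .
  interpret affine_process "cone_of_squares J" p \<phi> \<psi>
    using process unfolding cone .
  interpret jordan_affine_process J e tr h Q b B c \<gamma> m \<mu> \<phi> \<psi> p
    by unfold_locales (use trace inner truncation simple in auto)
  let ?\<alpha> = "(1/4) *\<^sub>R Q e e"
  have \<alpha>: "?\<alpha> \<in> squares" by (rule squares_scale[OF Q_cone]) simp
  have quad: "Q u u = 4 *\<^sub>R quad_rep J u ?\<alpha>" for u
  proof -
    have "Q u u = quad_rep J u (Q e e)"
      by (rule boundary_form_eq_quad_rep[OF Q_bilinear Q_sym Q_cone Q_boundary])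
    also have "\<dots> = 4 *\<^sub>R quad_rep J u ?\<alpha>"
      by (simp add: quad_rep_def prod_simps scaleR_diff_right)
    finally show ?thesis .
  qed
  show ?thesis
    unfolding cone rank cone_le_def
    using \<alpha> quad linear_jump_measure_integrable drift_condition[OF peirce] by blast
qed

end
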